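(* Let $f\in L^1([-\pi,\pi])$ have real Fourier coefficients, be $2\pi$-periodically extended to $\mathbb{R}$, and be sparsely vanishing. Let $Y_n\in\mathbb{R}^{n\times n}$ be the anti-identity matrix and let $T_n[f]\in\mathbb{R}^{n\times n}$ be the Toeplitz matrix generated by $f$. Let $\{C_n\}_n$ be a sequence of nonsingular circulant matrices, $C_n$ of size $n\times n$, such that \[ \{C_n^{-1}T_n[f]\}_n\sim_\sigma 1 . \] Then \[ \{|C_n|^{-1}Y_nT_n[f]\}_n\sim_\lambda \phi_1 \] over the domain $[-2\pi,2\pi]$, where $\phi_1(\theta)=1$ for $\theta\in[0,2\pi]$ and $\phi_1(\theta)=-1$ for $\theta\in[-2\pi,0)$.
   Context: The function $f$ is complex-valued and Lebesgue integrable; it is sparsely vanishing if its set of zeros has Lebesgue measure zero. Its Fourier coefficients are $a_k=\frac{1}{2\pi}\int_{-\pi}^{\pi}f(\theta)e^{-\mathbf{i}k\theta}\,d\theta$, $k\in\mathbb{Z}$. The Toeplitz matrix generated by $f$ is the $n\times n$ matrix with entries $[T_n[f]]_{s,t}=a_{s-t}$, $s,t\in\{1,\dots,n\}$. The anti-identity (flip) matrix $Y_n$ has entries $[Y_n]_{s,t}=1$ if $s+t=n+1$ and $0$ otherwise. For a circulant matrix $C_n\in\mathbb{C}^{n\times n}$, the absolute value circulant matrix is $|C_n|=(C_n^*C_n)^{1/2}=(C_nC_n^* )^{1/2}=F_n|\Lambda_n|F_n^*$, where $F_n=\left[\omega^{jk}/\sqrt n\right]_{j,k=0}^{n-1}$,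 $\omega=e^{-2\pi\mathbf{i}/n}$, $C_n=F_n\Lambda_nF_n^*$ with $\Lambda_n$ diagonal, and $|\Lambda_n|$ is $\Lambda_n$ with all entries replaced by their magnitudes. Let $h:\Omega\subset\mathbb{R}\to\mathbb{C}$ be measurable with $0<\mu_1(\Omega)<\infty$ ($\mu_1$ Lebesgue measure), and let $X_n$ be $n\times n$ matrices. Then $\{X_n\}_n\sim_\lambda h$ over $\Omega$ means $\lim_{n\to\infty}\frac1n\sum_{j=1}^nF(\lambda_j(X_n))=\frac{1}{\mu_1(\Omega)}\int_\Omega F(h(\theta))\,d\theta$ for every complex-valued continuous $F$ on $\mathbb{C}$ with bounded support, where $\lambda_j(X_n)$ are the eigenvalues counted with multiplicity. Similarly $\{X_n\}_n\sim_\sigma h$ means $\lim_{n\to\infty}\frac1n\sum_{j=1}^nF(\sigma_j(X_n))=\frac{1}{\mu_1(\Omega)}\int_\Omega F(|h(\theta)|)\,d\theta$ for every complex-valued continuous $F$ on $\mathbb{R}$ with bounded support, where $\sigma_j(X_n)$ are the singular values; in particular $\{X_n\}_n\sim_\sigma 1$ means $\frac1n\sum_{j=1}^nF(\sigma_j(X_n))\to F(1)$ for all such $F$. *)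

theory Defs
  imports
    "HOL-Analysis.Analysis"
    "HOL-Computational_Algebra.Fundamental_Theorem_Algebra"
    "Jordan_Normal_Form.Char_Poly"
    "Jordan_Normal_Form.Schur_Decomposition"
    "Jordan_Normal_Form.Gauss_Jordan_Elimination"
begin

definition fourier_coeff :: "(real \<Rightarrow> complex) \<Rightarrow> int \<Rightarrow> complex" where
  "fourier_coeff f k =
     1 / (2 * of_real pi) *
     (LINT \<theta>:{-pi..pi}|lebesgue. f \<theta> * exp (- \<i> * of_int k * of_real \<theta>))"

definition sparsely_vanishing_on :: "real set \<Rightarrow> (real \<Rightarrow> complex) \<Rightarrow> bool" where
  "sparsely_vanishing_on S f \<longleftrightarrow> {\<theta> \<in> S. f \<theta> = 0} \<in> null_sets lebesgue"

text \<open>Matrix indices start at 0, so an index pair \<open>(s, t)\<close> below stands for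
  \<open>(s + 1, t + 1)\<close> in 1-based notation.\<close>

definition toeplitz_mat :: "(real \<Rightarrow> complex) \<Rightarrow> nat \<Rightarrow> complex mat" where
  "toeplitz_mat f n = Matrix.mat n n (\<lambda>(s, t). fourier_coeff f (int s - int t))"

definition flip_mat :: "nat \<Rightarrow> complex mat" where
  "flip_mat n = Matrix.mat n n (\<lambda>(s, t). if (s + 1) + (t + 1) = n + 1 then 1 else 0)"

definition circulant_mat :: "nat \<Rightarrow> complex mat \<Rightarrow> bool" where
  "circulant_mat n C \<longleftrightarrow>
     (\<exists>c :: int \<Rightarrow> complex. C = Matrix.mat n n (\<lambda>(s, t). c ((int s - int t) mod int n)))"

definition fourier_mat :: "nat \<Rightarrow> complex mat" where
  "fourier_mat n =
     Matrix.mat n n (\<lambda>(j, k). exp (- 2 * of_real pi * \<i> / of_nat n) ^ (j * k) / of_real (sqrt (of_nat n)))"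

text \<open>The diagonal matrix \<open>\<Lambda>\<close> in \<open>C = F \<Lambda> F\<^sup>*\<close> is \<open>F\<^sup>* C F\<close>, as \<open>F\<close> is unitary; see
  \<open>circulant_mat_diagonalization\<close> below.\<close>

definition circulant_eig_mat :: "nat \<Rightarrow> complex mat \<Rightarrow> complex mat" where
  "circulant_eig_mat n C = mat_adjoint (fourier_mat n) * C * fourier_mat n"

definition circulant_abs :: "nat \<Rightarrow> complex mat \<Rightarrow> complex mat" where
  "circulant_abs n C =
     fourier_mat n * map_mat (\<lambda>z. of_real (cmod z)) (circulant_eig_mat n C) * mat_adjoint (fourier_mat n)"

text \<open>Only meaningful for invertible arguments.\<close>

definition inv_mat :: "complex mat \<Rightarrow> complex mat" where
  "inv_mat A = the (mat_inverse A)"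

definition eigenvalue_mset :: "complex mat \<Rightarrow> complex multiset" where
  "eigenvalue_mset A = proots (char_poly A)"

definition singular_value_mset :: "complex mat \<Rightarrow> real multiset" where
  "singular_value_mset A =
     image_mset (\<lambda>z. sqrt (Re z)) (eigenvalue_mset (mat_adjoint A * A))"

definition eigenvalue_distribution ::
  "(nat \<Rightarrow> complex mat) \<Rightarrow> (real \<Rightarrow> complex) \<Rightarrow> real set \<Rightarrow> bool" where
  "eigenvalue_distribution X h \<Omega> \<longleftrightarrow>
     \<Omega> \<in> lmeasurable \<and> 0 < measure lebesgue \<Omega> \<and> h \<in> borel_measurable (lebesgue_on \<Omega>) \<and>
     (\<forall>F :: complex \<Rightarrow> complex. continuous_on UNIV F \<longrightarrow> bounded {z. F z \<noteq> 0} \<longrightarrow>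
       (\<lambda>n. 1 / of_nat n * (\<Sum>z \<in># eigenvalue_mset (X n). F z))
         \<longlonglongrightarrow> 1 / of_real (measure lebesgue \<Omega>) * (LINT \<theta>:\<Omega>|lebesgue. F (h \<theta>)))"

definition singular_value_distribution ::
  "(nat \<Rightarrow> complex mat) \<Rightarrow> (real \<Rightarrow> complex) \<Rightarrow> real set \<Rightarrow> bool" where
  "singular_value_distribution X h \<Omega> \<longleftrightarrow>
     \<Omega> \<in> lmeasurable \<and> 0 < measure lebesgue \<Omega> \<and> h \<in> borel_measurable (lebesgue_on \<Omega>) \<and>
     (\<forall>F :: real \<Rightarrow> complex. continuous_on UNIV F \<longrightarrow> bounded {x. F x \<noteq> 0} \<longrightarrow>
       (\<lambda>n. 1 / of_nat n * (\<Sum>x \<in># singular_value_mset (X n). F x))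
         \<longlonglongrightarrow> 1 / of_real (measure lebesgue \<Omega>) * (LINT \<theta>:\<Omega>|lebesgue. F (cmod (h \<theta>))))"

definition phi1 :: "real \<Rightarrow> complex" where
  "phi1 \<theta> = (if 0 \<le> \<theta> then 1 else - 1)"

lemma singular_value_distribution_one_iff:
  assumes "\<Omega> \<in> lmeasurable" "0 < measure lebesgue \<Omega>"
  shows "singular_value_distribution X (\<lambda>_. 1) \<Omega> \<longleftrightarrow>
     (\<forall>F :: real \<Rightarrow> complex. continuous_on UNIV F \<longrightarrow> bounded {x. F x \<noteq> 0} \<longrightarrow>
       (\<lambda>n. 1 / of_nat n * (\<Sum>x \<in># singular_value_mset (X n). F x)) \<longlonglongrightarrow> F 1)"
proof -
  have "(LINT \<theta>:\<Omega>|lebesgue. c) = of_real (measure lebesgue \<Omega>) * c" for c :: complex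
    using assms(1) by (subst set_integral_const) (auto simp: fmeasurable_def scaleR_conv_of_real)
  with assms show ?thesis
    unfolding singular_value_distribution_def by auto
qed

lemma fourier_mat_carrier [simp]: "fourier_mat n \<in> carrier_mat n n"
  by (simp add: fourier_mat_def)

lemma dim_mat_adjoint [simp]:
  "dim_row (mat_adjoint A) = dim_col A" "dim_col (mat_adjoint A) = dim_row A"
  by (simp_all add: mat_adjoint_def)

lemma index_mat_adjoint:
  fixes A :: "complex mat"
  assumes "i < dim_col A" "j < dim_row A"
  shows "mat_adjoint A $$ (i, j) = cnj (A $$ (j, i))"
  using assms by (simp add: mat_adjoint_def mat_of_rows_index)

lemma exp_root_power:
  assumes "n > 0"
  shows "exp (- 2 * of_real pi * \<i> / of_nat n :: complex) ^ n = 1"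
proof -
  have "exp (- 2 * of_real pi * \<i> / of_nat n :: complex) ^ n = exp (- (2 * of_real pi * \<i>))"
    using assms by (subst exp_of_nat_mult [symmetric]) simp
  then show ?thesis by (simp add: exp_minus exp_two_pi_i)
qed

lemma fourier_mat_unitary: "mat_adjoint (fourier_mat n) * fourier_mat n = 1\<^sub>m n"
proof (rule eq_matI)
  fix i j assume "i < dim_row (1\<^sub>m n :: complex mat)" "j < dim_col (1\<^sub>m n :: complex mat)"
  then have ij: "i < n" "j < n" by simp_all
  define w where "w = exp (- 2 * of_real pi * \<i> / of_nat n :: complex)"
  define q where "q = w ^ j / w ^ i"
  have w0: "w \<noteq> 0" by (simp add: w_def)
  have nw: "cmod w = 1" by (simp add: w_def)
  have cw: "cnj w = inverse w"
    using nw by (metis complex_cnj_cnj complex_div_cnj div_by_1 inverse_eq_divide of_real_1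
        mult_1 one_power2)
  have wn: "w ^ n = 1"
    using ij unfolding w_def by (intro exp_root_power) simp
  have inj: "q = 1 \<longleftrightarrow> i = j"
  proof
    assume "q = 1"
    then have "w ^ i = w ^ j" using w0 by (simp add: q_def)
    then have "exp (- 2 * of_real pi * \<i> / of_nat n * of_nat i) = exp (- 2 * of_real pi * \<i> / of_nat n * of_nat j :: complex)"
      by (simp add: w_def exp_of_nat_mult [symmetric] mult.commute)
    then obtain k :: int where k: "- 2 * of_real pi * \<i> / of_nat n * of_nat i =
        - 2 * of_real pi * \<i> / of_nat n * of_nat j + (of_int (2 * k) * pi) * \<i>"
      unfolding exp_eq by auto
    then have "Im (- 2 * of_real pi * \<i> / of_nat n * of_nat i) =
        Im (- 2 * of_real pi * \<i> / of_nat n * of_nat j + (of_int (2 * k) * pi) * \<i>)" by simp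
    then have "- (2 * pi * real i / real n) = - (2 * pi * real j / real n) + 2 * real_of_int k * pi"
      by simp
    then have "(2 * pi) * real i = (2 * pi) * (real j - of_int k * real n)"
      using ij by (simp add: field_simps)
    then have "real i = real j - of_int k * real n"
      unfolding mult_cancel_left by simp
    then have "real_of_int (int i) = real_of_int (int j - k * int n)" by simp
    then have "int i = int j - k * int n" by linarith
    then have "int i mod int n = int j mod int n"
      by (metis mod_diff_right_eq mod_mult_self2_is_0 diff_zero)
    then show "i = j" using ij by simp
  qed (simp add: q_def w0)
  have "(mat_adjoint (fourier_mat n) * fourier_mat n) $$ (i, j)
      = (\<Sum>l<n. cnj (w ^ (l * i) / of_real (sqrt n)) * (w ^ (l * j) / of_real (sqrt n)))"
    using ij by (simp add: scalar_prod_def index_mat_adjoint fourier_mat_def w_def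
        carrier_matD[OF fourier_mat_carrier] atLeast0LessThan)
  also have "\<dots> = (\<Sum>l<n. q ^ l / n)"
  proof (rule sum.cong[OF refl])
    fix l assume "l \<in> {..<n}"
    have s: "of_real (sqrt n) * of_real (sqrt n) = (of_nat n :: complex)"
      by (metis of_nat_0_le_iff of_real_mult of_real_of_nat_eq real_sqrt_mult_self abs_of_nonneg)
    have q: "q ^ l = inverse w ^ (l * i) * w ^ (l * j)"
      unfolding q_def divide_inverse mult.commute[of l] power_mult power_mult_distrib power_inverse
      by (rule mult.commute)
    show "cnj (w ^ (l * i) / of_real (sqrt n)) * (w ^ (l * j) / of_real (sqrt n)) = q ^ l / n"
      unfolding q s[symmetric] by (simp add: cw)
  qed
  also have "\<dots> = (if i = j then 1 else 0)"
  proof (cases "i = j")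
    case True
    then show ?thesis using ij by (simp add: inj[THEN iffD2])
  next
    case False
    have "q ^ n = 1"
      by (simp add: q_def power_divide power_mult[symmetric] mult.commute[of _ n])
         (simp add: power_mult wn w0)
    with False inj show ?thesis
      by (simp add: sum_divide_distrib[symmetric] geometric_sum)
  qed
  finally show "(mat_adjoint (fourier_mat n) * fourier_mat n) $$ (i, j) = 1\<^sub>m n $$ (i, j)"
    using ij by simp
qed (simp_all add: fourier_mat_def)

lemma circulant_mat_diagonalization:
  assumes "circulant_mat n C"
  shows "diagonal_mat (circulant_eig_mat n C)"
    and "C = fourier_mat n * circulant_eig_mat n C * mat_adjoint (fourier_mat n)"
proof -
  let ?F = "fourier_mat n" and ?G = "mat_adjoint (fourier_mat n)"
  obtain c where C: "C = Matrix.mat n n (\<lambda>(s, t). c ((int s - int t) mod int n))"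
    using assms by (auto simp: circulant_mat_def)
  have Cc: "C \<in> carrier_mat n n" by (simp add: C)
  have Fc: "?F \<in> carrier_mat n n" and Gc: "?G \<in> carrier_mat n n"
    by (simp, rule carrier_matI) (simp_all add: fourier_mat_def)
  have GF: "?G * ?F = 1\<^sub>m n" by (rule fourier_mat_unitary)
  have FG: "?F * ?G = 1\<^sub>m n" using mat_mult_left_right_inverse[OF Gc Fc GF] .
  define w where "w = exp (- 2 * of_real pi * \<i> / of_nat n :: complex)"
  define L where "L = Matrix.mat n n (\<lambda>(s, t). if s = t then \<Sum>m<n. c (int m) * w powi (- int m * int t) else 0)"
  have Lc: "L \<in> carrier_mat n n" by (simp add: L_def)
  have w0: "w \<noteq> 0" by (simp add: w_def)
  have wmod: "w powi (a mod int n * b) = w powi (a * b)" if "n > 0" for a b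
  proof -
    have wn: "w ^ n = 1"
      using that unfolding w_def by (rule exp_root_power)
    have "a * b = a mod int n * b + int n * (a div int n * b)"
      by (metis (no_types, opaque_lifting) mod_mult_div_eq distrib_right mult.assoc)
    then have "w powi (a * b) = w powi (a mod int n * b) * (w powi int n) powi (a div int n * b)"
      using w0 by (simp add: power_int_add power_int_mult)
    then show ?thesis by (simp add: wn)
  qed
  have CF: "C * ?F = ?F * L"
  proof (rule eq_matI)
    fix s k assume "s < dim_row (?F * L)" "k < dim_col (?F * L)"
    then have sk: "s < n" "k < n" using Fc Lc by auto
    then have n: "n > 0" by simp
    have "(C * ?F) $$ (s, k) = (\<Sum>t<n. c ((int s - int t) mod int n) * (w ^ (t * k) / of_real (sqrt n)))"
      using sk by (simp add: C scalar_prod_def fourier_mat_def w_def atLeast0LessThan)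
    also have "\<dots> = (\<Sum>m<n. c (int m) * (w powi ((int s - int m) * int k) / of_real (sqrt n)))"
    proof (rule sum.reindex_bij_witness[where
          i = "\<lambda>m. nat ((int s - int m) mod int n)" and j = "\<lambda>t. nat ((int s - int t) mod int n)"])
      fix t assume "t \<in> {..<n}"
      then have t: "t < n" by simp
      have *: "(int s - (int s - int t) mod int n) mod int n = int t"
        using t by (simp add: mod_diff_right_eq)
      show "nat ((int s - int (nat ((int s - int t) mod int n))) mod int n) = t"
        using * n by simp
      then show "nat ((int s - int (nat ((int s - int t) mod int n))) mod int n) = t" .
      show "nat ((int s - int t) mod int n) \<in> {..<n}"
        using n by (simp add: nat_less_iff)
      then show "nat ((int s - int t) mod int n) \<in> {..<n}" .
      have "w powi ((int s - (int s - int t) mod int n) * int k) = w powi (int t * int k)"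
        using wmod[OF n, of "int s - (int s - int t) mod int n" "int k"] * by simp
      also have "\<dots> = w ^ (t * k)"
        by (metis of_nat_mult power_int_of_nat)
      finally show "c (int (nat ((int s - int t) mod int n))) *
          (w powi ((int s - int (nat ((int s - int t) mod int n))) * int k) / of_real (sqrt n)) =
          c ((int s - int t) mod int n) * (w ^ (t * k) / of_real (sqrt n))"
        using n by simp
    qed
    also have "\<dots> = (w ^ (s * k) / of_real (sqrt n)) * (\<Sum>m<n. c (int m) * w powi (- int m * int k))"
    proof -
      have "w powi ((int s - int m) * int k) = w ^ (s * k) * w powi (- int m * int k)" for m
      proof -
        have "(int s - int m) * int k = int (s * k) + - int m * int k"
          by (simp add: algebra_simps)
        then show ?thesis
          using w0 by (metis power_int_add power_int_of_nat)
      qed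
      then show ?thesis by (simp add: sum_distrib_left mult_ac)
    qed
    also have "\<dots> = (?F * L) $$ (s, k)"
    proof -
      have "(?F * L) $$ (s, k) = (\<Sum>j<n. (w ^ (s * j) / of_real (sqrt n)) *
          (if j = k then \<Sum>m<n. c (int m) * w powi (- int m * int k) else 0))"
        using sk by (simp add: L_def scalar_prod_def fourier_mat_def w_def atLeast0LessThan)
      also have "\<dots> = (\<Sum>j<n. if j = k then (w ^ (s * k) / of_real (sqrt n)) *
          (\<Sum>m<n. c (int m) * w powi (- int m * int k)) else 0)"
        by (intro sum.cong) auto
      finally show ?thesis using sk by simp
    qed
    finally show "(C * ?F) $$ (s, k) = (?F * L) $$ (s, k)" .
  qed (use Cc Lc in \<open>simp_all add: carrier_matD[OF Fc] carrier_matD[OF Cc] carrier_matD[OF Lc]\<close>)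
  have E: "circulant_eig_mat n C = L"
    unfolding circulant_eig_mat_def assoc_mult_mat[OF Gc Cc Fc] CF
    using assoc_mult_mat[OF Gc Fc Lc] GF Lc by simp
  then show "diagonal_mat (circulant_eig_mat n C)"
    by (simp add: diagonal_mat_def L_def)
  show "C = ?F * circulant_eig_mat n C * ?G"
    unfolding E CF[symmetric] assoc_mult_mat[OF Cc Fc Gc] FG using Cc by simp
qed

end

theory Submission
  imports Defs
begin

text \<open>Write \<open>T = T\<^sub>n[f]\<close>, \<open>H = Y\<^sub>n T\<close> (real symmetric), \<open>P = \<bar>C\<^sub>n\<bar>\<close> and \<open>A = P\<^sup>-\<^sup>1 H\<close>. Since \<open>T\<close> is real and flipping conjugates
  the discrete Fourier transform up to unimodular factors, \<open>A x\<close> and \<open>C\<^sub>n\<^sup>-\<^sup>1 T\<close> applied to the conjugate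
  of \<open>x\<close> have the same norm; so \<open>A\<close> is almost isometric off a subspace of codimension \<open>o(n)\<close>. Its
  eigenvalues are real, with eigenvectors orthonormal for the inner product of \<open>P\<close>.

  \<^emph>\<open>Moduli.\<close> As \<open>f\<close> is sparsely vanishing, all but a small fraction of the singular values of \<open>T\<close>, and hence of
  the eigenvalues of \<open>P\<close>, lie in a fixed interval \<open>[\<tau>, \<tau>']\<close> with \<open>\<tau> > 0\<close>, so that off a small codimension the norm
  of \<open>P\<close> and the Euclidean norm are comparable. If many eigenvalues had \<open>\<bar>\<lambda>\<bar> \<le> c < 1\<close>, then on their
  eigenspaces \<open>A\<^sup>k\<close> would contract the \<open>P\<close>-norm by \<open>c\<^sup>k\<close> while almost preserving the Euclidean norm, which is
  absurd for large \<open>k\<close>; likewise for \<open>\<bar>\<lambda>\<bar> \<ge> c > 1\<close>.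

  \<^emph>\<open>Signs.\<close> By Sylvester's law the signs of the eigenvalues of \<open>A\<close> are those of \<open>H\<close>. The two diagonal
  blocks of \<open>H\<close> are negligible, so with \<open>J = diag(I, -I)\<close> the matrix \<open>H + J H J\<close> is negligible
  and the two signs occur equally often up to \<open>o(n)\<close>.\<close>

section \<open>Subspaces of small codimension\<close>

text \<open>A product of a positive definite and a Hermitian matrix need not be normal, so its
  singular values do not determine the moduli of its eigenvalues. The link is a norm in which the
  matrix is self-adjoint, but that norm is not uniformly equivalent to the Euclidean one:
  \<open>f\<close> is merely integrable, so neither the Toeplitz matrices nor the preconditioners
  need have bounded norms or inverses. Hence estimates are stated on subspaces cut out by few
  equations, and contradictions come from adding codimensions until a nonzero vector is left. Powers
  defeat the condition number: a fixed factor \<open>\<tau>' / \<tau>\<close> loses against a ratio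
  of rates raised to a large exponent. The choices are ordered accordingly: a crude accuracy for the
  singular values fixes \<open>\<tau>\<close> and \<open>\<tau>'\<close>, these fix the exponent,
  and only then is the accuracy refined, at a codimension that can be paid once per factor of the
  power. Integrability enters through the trace norm of T_n[g], at most n / (2 pi) times the L^1
  norm of g; beyond that, approximation by trigonometric polynomials leaves errors of rank bounded
  independently of n.\<close>

definition vnorm :: "complex vec \<Rightarrow> real" where
  "vnorm x = L2_set (\<lambda>i. cmod (x $ i)) {..<dim_vec x}"

lemma vnorm_ge_0 [simp]: "0 \<le> vnorm x"
  by (simp add: vnorm_def)

lemma vnorm_sq: "(vnorm x)\<^sup>2 = (\<Sum>i<dim_vec x. (cmod (x $ i))\<^sup>2)"
  by (simp add: vnorm_def L2_set_def sum_nonneg)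

lemma vnorm_eq_0_iff: "x \<in> carrier_vec n \<Longrightarrow> vnorm x = 0 \<longleftrightarrow> x = 0\<^sub>v n"
  unfolding vnorm_def by (subst L2_set_eq_0_iff) (auto intro!: eq_vecI)

lemma vnorm_pos: "x \<in> carrier_vec n \<Longrightarrow> x \<noteq> 0\<^sub>v n \<Longrightarrow> 0 < vnorm x"
  using vnorm_eq_0_iff[of x n] vnorm_ge_0[of x] by linarith

lemma vnorm_add_le:
  assumes "x \<in> carrier_vec n" "y \<in> carrier_vec n"
  shows "vnorm (x + y) \<le> vnorm x + vnorm y"
proof -
  have "vnorm (x + y) = L2_set (\<lambda>i. cmod (x $ i + y $ i)) {..<n}"
    using assms unfolding vnorm_def by (intro L2_set_cong) auto
  also have "\<dots> \<le> L2_set (\<lambda>i. cmod (x $ i) + cmod (y $ i)) {..<n}"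
    by (intro L2_set_mono) (auto simp: norm_triangle_ineq)
  also have "\<dots> \<le> vnorm x + vnorm y"
    using assms L2_set_triangle_ineq[of "\<lambda>i. cmod (x $ i)" "\<lambda>i. cmod (y $ i)" "{..<n}"]
    unfolding vnorm_def by auto
  finally show ?thesis .
qed

lemma vnorm_cong:
  assumes "dim_vec x = dim_vec y" "\<And>i. i < dim_vec y \<Longrightarrow> cmod (x $ i) = cmod (y $ i)"
  shows "vnorm x = vnorm y"
  unfolding vnorm_def using assms by (intro L2_set_cong) auto

lemma vnorm_smult: "vnorm (a \<cdot>\<^sub>v x) = cmod a * vnorm x"
proof -
  have "vnorm (a \<cdot>\<^sub>v x) = L2_set (\<lambda>i. cmod a * cmod (x $ i)) {..<dim_vec x}"
    unfolding vnorm_def by (intro L2_set_cong) (auto simp: norm_mult)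
  then show ?thesis by (simp add: vnorm_def L2_set_right_distrib)
qed

lemma vnorm_conjugate [simp]: "vnorm (conjugate x) = vnorm x"
  by (rule vnorm_cong) (simp_all)

lemma cscalar_prod_sum:
  "y \<in> carrier_vec n \<Longrightarrow> x \<bullet>c y = (\<Sum>i<n. x $ i * cnj (y $ i))" for x :: "complex vec"
  by (simp add: scalar_prod_def atLeast0LessThan)

lemma cscalar_prod_self: "x \<bullet>c x = of_real ((vnorm x)\<^sup>2)" for x :: "complex vec"
proof -
  have "x \<bullet>c x = (\<Sum>i<dim_vec x. of_real ((cmod (x $ i))\<^sup>2))"
    by (subst cscalar_prod_sum[of _ "dim_vec x"]) (auto simp: complex_norm_square[symmetric])
  then show ?thesis by (simp only: vnorm_sq of_real_sum)
qed

lemma cauchy_schwarz_vec: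
  fixes x y :: "complex vec"
  assumes "x \<in> carrier_vec n" "y \<in> carrier_vec n"
  shows "cmod (x \<bullet>c y) \<le> vnorm x * vnorm y"
proof -
  have "cmod (x \<bullet>c y) \<le> (\<Sum>i<n. cmod (x $ i) * cmod (y $ i))"
    unfolding cscalar_prod_sum[OF assms(2)] by (rule order_trans[OF norm_sum]) (simp add: norm_mult)
  also have "\<dots> \<le> vnorm x * vnorm y"
    using assms L2_set_mult_ineq[of "\<lambda>i. cmod (x $ i)" "\<lambda>i. cmod (y $ i)" "{..<n}"]
    by (simp add: vnorm_def)
  finally show ?thesis .
qed

section \<open>Matrices acting on vectors, adjoints and isometries\<close>

lemma index_mult_mat_vec_sum:
  assumes "A \<in> carrier_mat n m" "x \<in> carrier_vec m" "i < n"
  shows "(A *\<^sub>v x) $ i = (\<Sum>j<m. A $$ (i, j) * x $ j)"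
  using assms by (simp add: scalar_prod_def atLeast0LessThan)

lemma mat_adjoint_carrier [simp, intro]:
  "A \<in> carrier_mat n m \<Longrightarrow> mat_adjoint A \<in> carrier_mat m n"
  by (intro carrier_matI) auto

lemma mat_adjoint_adjoint [simp]: "mat_adjoint (mat_adjoint A) = A" for A :: "complex mat"
  by (rule eq_matI) (auto simp: index_mat_adjoint)

lemma cscalar_prod_adjoint:
  fixes A :: "complex mat"
  assumes "A \<in> carrier_mat n m" "x \<in> carrier_vec m" "y \<in> carrier_vec n"
  shows "(A *\<^sub>v x) \<bullet>c y = x \<bullet>c (mat_adjoint A *\<^sub>v y)"
proof -
  have a: "mat_adjoint A *\<^sub>v y \<in> carrier_vec m"
    using assms mult_mat_vec_carrier[OF mat_adjoint_carrier] by blast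
  have "(A *\<^sub>v x) \<bullet>c y = (\<Sum>i<n. \<Sum>j<m. A $$ (i, j) * x $ j * cnj (y $ i))"
    unfolding cscalar_prod_sum[OF assms(3)]
    by (intro sum.cong refl) (subst index_mult_mat_vec_sum[OF assms(1,2)], auto simp: sum_distrib_right)
  also have "\<dots> = (\<Sum>j<m. \<Sum>i<n. A $$ (i, j) * x $ j * cnj (y $ i))" by (rule sum.swap)
  also have "\<dots> = x \<bullet>c (mat_adjoint A *\<^sub>v y)"
    unfolding cscalar_prod_sum[OF a]
    by (intro sum.cong refl) (subst index_mult_mat_vec_sum[of _ m n], 
        use assms in \<open>auto simp: sum_distrib_left index_mat_adjoint mult_ac\<close>)
  finally show ?thesis .
qed

lemma vnorm_unitary:
  assumes "U \<in> carrier_mat n m" "mat_adjoint U * U = 1\<^sub>m m" "x \<in> carrier_vec m"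
  shows "vnorm (U *\<^sub>v x) = vnorm x"
proof -
  have "(U *\<^sub>v x) \<bullet>c (U *\<^sub>v x) = x \<bullet>c (mat_adjoint U *\<^sub>v (U *\<^sub>v x))"
    using assms by (intro cscalar_prod_adjoint) auto
  also have "mat_adjoint U *\<^sub>v (U *\<^sub>v x) = x"
    using assms by (subst assoc_mult_mat_vec[symmetric, of _ m n _ m]) auto
  finally have "(vnorm (U *\<^sub>v x))\<^sup>2 = (vnorm x)\<^sup>2"
    unfolding cscalar_prod_self of_real_eq_iff .
  then show ?thesis by (simp add: power2_eq_iff_nonneg)
qed

text \<open>\<open>codim_le n r V\<close>: the set \<open>V\<close> contains a subspace of \<open>\<complex>\<^sup>n\<close> that is cut out by at most
  \<open>r\<close> linear equations. The set itself need not be a subspace.\<close>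

definition codim_le :: "nat \<Rightarrow> real \<Rightarrow> complex vec set \<Rightarrow> bool" where
  "codim_le n r V \<longleftrightarrow> (\<exists>L. set L \<subseteq> carrier_vec n \<and> real (length L) \<le> r \<and>
     (\<forall>x\<in>carrier_vec n. (\<forall>v\<in>set L. v \<bullet> x = 0) \<longrightarrow> x \<in> V))"

abbreviation norm_le :: "complex mat \<Rightarrow> real \<Rightarrow> complex Matrix.vec set" where
  "norm_le A b \<equiv> {x. vnorm (A *\<^sub>v x) \<le> b * vnorm x}"

abbreviation norm_ge :: "complex mat \<Rightarrow> real \<Rightarrow> complex Matrix.vec set" where
  "norm_ge A a \<equiv> {x. a * vnorm x \<le> vnorm (A *\<^sub>v x)}"

lemma codim_le_mono:
  "codim_le n r V \<Longrightarrow> r \<le> r' \<Longrightarrow> (\<And>x. x \<in> carrier_vec n \<Longrightarrow> x \<in> V \<Longrightarrow> x \<in> V') \<Longrightarrow> codim_le n r' V'"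
  unfolding codim_le_def by (meson order_trans)

lemma codim_le_Int:
  assumes "codim_le n r V" "codim_le n s W"
  shows "codim_le n (r + s) (V \<inter> W)"
proof -
  obtain L M where "set L \<subseteq> carrier_vec n" "real (length L) \<le> r"
     "\<forall>x\<in>carrier_vec n. (\<forall>v\<in>set L. v \<bullet> x = 0) \<longrightarrow> x \<in> V"
     "set M \<subseteq> carrier_vec n" "real (length M) \<le> s"
     "\<forall>x\<in>carrier_vec n. (\<forall>v\<in>set M. v \<bullet> x = 0) \<longrightarrow> x \<in> W"
    using assms unfolding codim_le_def by blast
  then show ?thesis unfolding codim_le_def by (intro exI[of _ "L @ M"]) auto
qed

lemma codim_le_UNIV: "0 \<le> r \<Longrightarrow> (\<And>x. x \<in> carrier_vec n \<Longrightarrow> x \<in> V) \<Longrightarrow> codim_le n r V"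
  unfolding codim_le_def by (intro exI[of _ "[]"]) auto

lemma codim_le_INT:
  assumes "\<And>j. j < k \<Longrightarrow> codim_le n r (V j)"
  shows "codim_le n (of_nat k * r) {x. \<forall>j<k. x \<in> V j}"
  using assms
proof (induction k)
  case 0
  then show ?case by (intro codim_le_UNIV) auto
next
  case (Suc k)
  have "codim_le n (of_nat k * r + r) ({x. \<forall>j<k. x \<in> V j} \<inter> V k)"
    by (intro codim_le_Int Suc) (use Suc.prems in auto)
  then show ?case
    by (rule codim_le_mono) (auto simp: algebra_simps less_Suc_eq)
qed

text \<open>The equation with coefficient vector \<open>v\<close>, imposed on the image under
  \<open>A\<close>, is the equation with coefficient vector
  \<open>transpose_mat A *\<^sub>v v\<close> imposed on \<open>x\<close>. Pulling back never raises
  the number of equations, even for singular \<open>A\<close>.\<close>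

lemma codim_le_preimage:
  assumes A: "A \<in> carrier_mat n m" and V: "codim_le n r V"
  shows "codim_le m r {x. A *\<^sub>v x \<in> V}"
proof -
  obtain L where L: "set L \<subseteq> carrier_vec n" "real (length L) \<le> r"
     "\<And>x. x\<in>carrier_vec n \<Longrightarrow> (\<forall>v\<in>set L. v \<bullet> x = 0) \<Longrightarrow> x \<in> V"
    using V unfolding codim_le_def by blast
  have *: "(transpose_mat A *\<^sub>v v) \<bullet> x = v \<bullet> (A *\<^sub>v x)" if "v \<in> set L" "x \<in> carrier_vec m" for v x
    using transpose_vec_mult_scalar[OF A that(2)] that L(1) by blast
  show ?thesis unfolding codim_le_def
    by (intro exI[of _ "map (\<lambda>v. transpose_mat A *\<^sub>v v) L"]) (use A L * in \<open>auto intro!: L(3)\<close>)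
qed

text \<open>Conjugation is only antilinear, hence no instance of \<open>codim_le_preimage\<close>;
  conjugating the coefficient vectors of the equations does it. It is called for because the flip
  identity compares norms at \<open>x\<close> and at \<open>conjugate x\<close>.\<close>

lemma codim_le_conjugate:
  assumes "codim_le n r V"
  shows "codim_le n r {x. conjugate x \<in> V}"
proof -
  obtain L where L: "set L \<subseteq> carrier_vec n" "real (length L) \<le> r"
     "\<And>x. x\<in>carrier_vec n \<Longrightarrow> (\<forall>v\<in>set L. v \<bullet> x = 0) \<Longrightarrow> x \<in> V"
    using assms unfolding codim_le_def by blast
  have *: "v \<bullet> conjugate x = 0" if "v \<in> set L" "x \<in> carrier_vec n" "conjugate v \<bullet> x = 0" for v x :: "complex vec"
    using that L(1) conjugate_conjugate_sprod[of v n x]  by (metis conjugate_zero subsetD)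
  show ?thesis unfolding codim_le_def
    by (intro exI[of _ "map conjugate L"]) (use L * in \<open>auto intro!: L(3)\<close>)
qed

lemma codim_le_coordinates:
  assumes W: "W \<in> carrier_mat m n" and "finite S" "S \<subseteq> {..<m}"
  shows "codim_le n (card S) {x. \<forall>i\<in>S. (W *\<^sub>v x) $ i = 0}"
proof -
  show ?thesis unfolding codim_le_def
    by (intro exI[of _ "map (row W) (sorted_list_of_set S)"]) (use assms in auto)
qed

text \<open>Every dimension count ends here: codimensions of several conditions are summed, and a
  total below \<open>n\<close> yields a nonzero vector satisfying all of them, since fewer than
  \<open>n\<close> homogeneous equations have a nontrivial solution.\<close>

lemma codim_le_nonzero:
  assumes "codim_le n r V" "r < n"
  obtains x where "x \<in> carrier_vec n" "x \<noteq> 0\<^sub>v n" "x \<in> V"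
proof -
  obtain L where L: "set L \<subseteq> carrier_vec n" "real (length L) \<le> r"
     "\<And>x. x\<in>carrier_vec n \<Longrightarrow> (\<forall>v\<in>set L. v \<bullet> x = 0) \<Longrightarrow> x \<in> V"
    using assms unfolding codim_le_def by blast
  have ln: "length L < n" using L(2) assms(2) by linarith
  \<comment> \<open>Zero rows make the system square. As there are fewer than \<open>n\<close>
    equations, at least the last row is zero, so the determinant vanishes.\<close>
  define M where "M = mat_of_rows n (L @ replicate (n - length L) (0\<^sub>v n))"
  have M: "M \<in> carrier_mat n n" using ln by (auto simp: M_def)
  have row: "row M i = (if i < length L then L ! i else 0\<^sub>v n)" if "i < n" for i
    using that L(1) unfolding M_def by (subst mat_of_rows_row) (auto simp: nth_append)
  have row0: "row M (n - 1) = 0\<^sub>v n" using row[of "n - 1"] ln by auto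
  have "M = mat\<^sub>r n n (\<lambda>i. if i = n - 1 then 0\<^sub>v n else row M i)"
  proof (rule eq_matI)
    fix i j assume "i < dim_row (mat\<^sub>r n n (\<lambda>i. if i = n - 1 then 0\<^sub>v n else row M i))"
      "j < dim_col (mat\<^sub>r n n (\<lambda>i. if i = n - 1 then 0\<^sub>v n else row M i))"
    then have ij: "i < n" "j < n" by auto
    then have "M $$ (i, j) = row M i $ j" using M by auto
    with ij row0 show "M $$ (i, j) = mat\<^sub>r n n (\<lambda>i. if i = n - 1 then 0\<^sub>v n else row M i) $$ (i, j)"
      by auto
  qed (use M in auto)
  moreover have "row M \<in> {0..<n} \<rightarrow> carrier_vec n" using M by auto
  ultimately have "det M = 0"
    using det_row_0[of "n - 1" n "row M"] ln by auto
  then obtain v where v: "v \<in> carrier_vec n" "v \<noteq> 0\<^sub>v n" "M *\<^sub>v v = 0\<^sub>v n"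
    using det_0_iff_vec_prod_zero[OF M] by auto
  have "L ! i \<bullet> v = 0" if "i < length L" for i
    using arg_cong[OF v(3), of "\<lambda>w. w $ i"] row[of i] that ln M by auto
  then have "\<forall>w\<in>set L. w \<bullet> v = 0" by (auto simp: in_set_conv_nth)
  then show thesis using that[OF v(1,2) L(3)] v by auto
qed

section \<open>Spectral theorem and singular values\<close>

lemma trace_mult_commute:
  fixes A B :: "'a :: comm_semiring_0 mat"
  assumes "A \<in> carrier_mat n m" "B \<in> carrier_mat m n"
  shows "(\<Sum>i<n. (A * B) $$ (i, i)) = (\<Sum>j<m. (B * A) $$ (j, j))"
proof -
  have "(\<Sum>i<n. (A * B) $$ (i, i)) = (\<Sum>i<n. \<Sum>j<m. A $$ (i, j) * B $$ (j, i))"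
    using assms by (intro sum.cong) (auto simp: scalar_prod_def atLeast0LessThan)
  also have "\<dots> = (\<Sum>j<m. \<Sum>i<n. A $$ (i, j) * B $$ (j, i))" by (rule sum.swap)
  also have "\<dots> = (\<Sum>j<m. (B * A) $$ (j, j))"
    using assms by (intro sum.cong) (auto simp: scalar_prod_def atLeast0LessThan mult.commute)
  finally show ?thesis .
qed

text \<open>Schur triangularization: the diagonal of the triangular form consists of roots of the
  characteristic polynomial, and the trace is invariant under similarity.\<close>

lemma trace_unique_eigenvalue:
  fixes A :: "complex mat"
  assumes A: "A \<in> carrier_mat n n" and ev: "\<And>k. eigenvalue A k \<Longrightarrow> k = \<mu>"
  shows "(\<Sum>i<n. A $$ (i, i)) = of_nat n * \<mu>"
proof -
  obtain as where "char_poly A = (\<Prod>a\<leftarrow>as. [:- a, 1:])"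
    using char_poly_factorized[OF A] by blast
  then obtain B where B: "B \<in> carrier_mat n n" "upper_triangular B" "similar_mat A B"
    using schur_decomposition_exists[OF A] by blast
  obtain P Q where PQ: "similar_mat_wit A B P Q" using B(3) unfolding similar_mat_def by blast
  note w = similar_mat_witD2[OF A PQ]
  have diag: "B $$ (i, i) = \<mu>" if "i < n" for i
  proof -
    have "poly (char_poly A) (B $$ (i, i)) = 0"
      unfolding char_poly_similar[OF B(3)] char_poly_upper_triangular[OF B(1,2)]
      using that B(1) by (auto simp: poly_prod_list prod_list_zero_iff diag_mat_def)
    then show ?thesis using ev eigenvalue_root_char_poly[OF A] by blast
  qed
  have "(\<Sum>i<n. A $$ (i, i)) = (\<Sum>i<n. (Q * (P * B)) $$ (i, i))"
    using trace_mult_commute[of "P * B" n n Q] w(3,5-7) by auto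
  also have "Q * (P * B) = B"
    using w by (metis assoc_mult_mat left_mult_one_mat)
  finally show ?thesis using diag by simp
qed

text \<open>Adding the rank-one terms \<open>(\<i> - d\<^sub>i) v\<^sub>i v\<^sub>i\<^sup>*\<close> moves the eigenvalues of the known eigenvectors to
  \<open>\<i>\<close>. If there were no other eigenvalue, then the imaginary part of the trace would be \<open>n\<close>, but it is \<open>k\<close>.\<close>

lemma hermitian_orthonormal_eigenvectors:
  fixes A :: "complex mat"
  assumes A: "A \<in> carrier_mat n n" and herm: "mat_adjoint A = A" and "k \<le> n"
  shows "\<exists>v d. (\<forall>i<k. v i \<in> carrier_vec n \<and> A *\<^sub>v v i = of_real (d i) \<cdot>\<^sub>v v i) \<and>
     (\<forall>i<k. \<forall>j<k. v i \<bullet>c v j = (if i = j then 1 else 0))"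
  using \<open>k \<le> n\<close>
proof (induction k)
  case (Suc k)
  then obtain v d where v: "\<And>i. i < k \<Longrightarrow> v i \<in> carrier_vec n"
      and Av: "\<And>i. i < k \<Longrightarrow> A *\<^sub>v v i = of_real (d i) \<cdot>\<^sub>v v i"
      and vv: "\<And>i j. i < k \<Longrightarrow> j < k \<Longrightarrow> v i \<bullet>c v j = (if i = j then 1 else 0)"
    using Suc_leD by blast
  define R where "R = Matrix.mat n n (\<lambda>(s, t). \<Sum>i<k. (\<i> - of_real (d i)) * v i $ s * cnj (v i $ t))"
  have R: "R \<in> carrier_mat n n" by (simp add: R_def)
  have Rw: "(R *\<^sub>v w) $ s = (\<Sum>i<k. (\<i> - of_real (d i)) * (w \<bullet>c v i) * v i $ s)"
    if "w \<in> carrier_vec n" "s < n" for w s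
  proof -
    have "(R *\<^sub>v w) $ s = (\<Sum>t<n. \<Sum>i<k. (\<i> - of_real (d i)) * v i $ s * cnj (v i $ t) * w $ t)"
      using that by (subst index_mult_mat_vec_sum[OF R]) (auto simp: R_def sum_distrib_right)
    also have "\<dots> = (\<Sum>i<k. \<Sum>t<n. (\<i> - of_real (d i)) * v i $ s * cnj (v i $ t) * w $ t)"
      by (rule sum.swap)
    also have "\<dots> = (\<Sum>i<k. (\<i> - of_real (d i)) * (w \<bullet>c v i) * v i $ s)"
      by (intro sum.cong refl) (simp add: cscalar_prod_sum[OF v] sum_distrib_left sum_distrib_right mult_ac)
    finally show ?thesis .
  qed
  have Rv: "(R *\<^sub>v w) \<bullet>c v j = (\<i> - of_real (d j)) * (w \<bullet>c v j)"
    if w: "w \<in> carrier_vec n" and j: "j < k" for w j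
  proof -
    have "(R *\<^sub>v w) \<bullet>c v j = (\<Sum>s<n. \<Sum>i<k. (\<i> - of_real (d i)) * (w \<bullet>c v i) * v i $ s * cnj (v j $ s))"
      unfolding cscalar_prod_sum[OF v[OF j]] by (intro sum.cong refl) (simp add: Rw[OF w] sum_distrib_right)
    also have "\<dots> = (\<Sum>i<k. \<Sum>s<n. (\<i> - of_real (d i)) * (w \<bullet>c v i) * v i $ s * cnj (v j $ s))"
      by (rule sum.swap)
    also have "\<dots> = (\<Sum>i<k. (\<i> - of_real (d i)) * (w \<bullet>c v i) * (v i \<bullet>c v j))"
      unfolding cscalar_prod_sum[OF v[OF j]] by (simp add: sum_distrib_left mult_ac)
    also have "\<dots> = (\<Sum>i<k. if i = j then (\<i> - of_real (d i)) * (w \<bullet>c v i) else 0)"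
      using j by (intro sum.cong refl) (simp add: vv)
    finally show ?thesis using j by simp
  qed
  have Aw: "(A *\<^sub>v w) \<bullet>c v j = of_real (d j) * (w \<bullet>c v j)"
    if w: "w \<in> carrier_vec n" and j: "j < k" for w j
  proof -
    have "(A *\<^sub>v w) \<bullet>c v j = w \<bullet>c (of_real (d j) \<cdot>\<^sub>v v j)"
      using cscalar_prod_adjoint[OF A w v[OF j]] by (simp add: herm Av[OF j])
    then show ?thesis
      by (subst (asm) cscalar_prod_sum[of _ n], use v[OF j] in simp)
         (use v[OF j] in \<open>simp add: cscalar_prod_sum[OF v[OF j]] sum_distrib_left mult_ac\<close>)
  qed
  define N where "N = A + R"
  have N: "N \<in> carrier_mat n n" using A R by (simp add: N_def)
  have Nw: "N *\<^sub>v w = A *\<^sub>v w + R *\<^sub>v w" if "w \<in> carrier_vec n" for w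
    using add_mult_distrib_mat_vec[OF A R that] by (simp add: N_def)
  have "\<exists>\<mu>. eigenvalue N \<mu> \<and> \<mu> \<noteq> \<i>"
  proof (rule ccontr)
    assume "\<not> ?thesis"
    then have "(\<Sum>s<n. N $$ (s, s)) = of_nat n * \<i>"
      by (intro trace_unique_eigenvalue[OF N]) auto
    then have "Im (\<Sum>s<n. N $$ (s, s)) = real n" by simp
    moreover have "Im (A $$ (s, s)) = 0" if "s < n" for s
    proof -
      have "cnj (A $$ (s, s)) = A $$ (s, s)"
        using index_mat_adjoint[of s A s] A that herm by simp
      then show ?thesis by (simp add: complex_eq_iff)
    qed
    moreover have "(\<Sum>s<n. R $$ (s, s)) = (\<Sum>i<k. \<i> - of_real (d i))"
    proof -
      have "(\<Sum>s<n. R $$ (s, s)) = (\<Sum>s<n. \<Sum>i<k. (\<i> - of_real (d i)) * v i $ s * cnj (v i $ s))"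
        by (simp add: R_def)
      also have "\<dots> = (\<Sum>i<k. \<Sum>s<n. (\<i> - of_real (d i)) * v i $ s * cnj (v i $ s))"
        by (rule sum.swap)
      also have "\<dots> = (\<Sum>i<k. (\<i> - of_real (d i)) * (v i \<bullet>c v i))"
        by (intro sum.cong refl) (simp add: cscalar_prod_sum[OF v] sum_distrib_left mult_ac)
      finally show ?thesis by (simp add: vv)
    qed
    moreover have "(\<Sum>s<n. N $$ (s, s)) = (\<Sum>s<n. A $$ (s, s)) + (\<Sum>s<n. R $$ (s, s))"
      using A R by (simp add: N_def sum.distrib)
    ultimately show False using Suc.prems by simp
  qed
  then obtain \<mu> w where w: "w \<in> carrier_vec n" "w \<noteq> 0\<^sub>v n" "N *\<^sub>v w = \<mu> \<cdot>\<^sub>v w" and \<mu>: "\<mu> \<noteq> \<i>"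
    using N unfolding eigenvalue_def eigenvector_def by auto
  \<comment> \<open>Pairing with \<open>v j\<close> turns \<open>N\<close> into multiplication by
    \<open>\<i>\<close>, because the terms with \<open>d j\<close> cancel. An eigenvector for any
    other eigenvalue is thus orthogonal to all \<open>v j\<close>, is annihilated by
    \<open>R\<close> and is an eigenvector of \<open>A\<close> itself.\<close>
  have orth: "w \<bullet>c v j = 0" if j: "j < k" for j
  proof -
    have "(N *\<^sub>v w) \<bullet>c v j = (A *\<^sub>v w) \<bullet>c v j + (R *\<^sub>v w) \<bullet>c v j"
      unfolding Nw[OF w(1)] using A R w v[OF j]
      by (subst add_scalar_prod_distrib[of _ n]) auto
    also have "\<dots> = \<i> * (w \<bullet>c v j)"
      by (simp add: Aw[OF w(1) j] Rv[OF w(1) j] algebra_simps)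
    finally have "\<mu> * (w \<bullet>c v j) = \<i> * (w \<bullet>c v j)"
      using w v[OF j] by (simp add: w(3))
    then show ?thesis using \<mu> by simp
  qed
  have "R *\<^sub>v w = 0\<^sub>v n"
    using R by (intro eq_vecI) (auto simp: Rw[OF w(1)] orth simp del: index_mult_mat_vec)
  then have Aw': "A *\<^sub>v w = \<mu> \<cdot>\<^sub>v w"
    using w(3) Nw[OF w(1)] A w(1) by (metis mult_mat_vec_carrier right_zero_vec)
  define u where "u = of_real (1 / vnorm w) \<cdot>\<^sub>v w"
  have nw: "vnorm w \<noteq> 0" using w vnorm_eq_0_iff by blast
  have u: "u \<in> carrier_vec n" using w by (simp add: u_def)
  have nu: "vnorm u = 1" using nw by (simp add: u_def vnorm_smult norm_divide)
  have Au: "A *\<^sub>v u = \<mu> \<cdot>\<^sub>v u"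
    unfolding u_def using mult_mat_vec[OF A w(1)] Aw' by (simp add: smult_smult_assoc mult.commute)
  have uu: "u \<bullet>c u = 1" using cscalar_prod_self[of u] nu by simp
  have "\<mu> = cnj \<mu>"
  proof -
    have "\<mu> = (A *\<^sub>v u) \<bullet>c u" using u uu Au by simp
    also have "\<dots> = u \<bullet>c (A *\<^sub>v u)" using cscalar_prod_adjoint[OF A u u] by (simp add: herm)
    also have "\<dots> = cnj \<mu> * (u \<bullet>c u)"
      unfolding Au by (subst cscalar_prod_sum[of _ n])
        (use u in \<open>auto simp: cscalar_prod_sum[OF u] sum_distrib_left mult_ac\<close>)
    finally show ?thesis using uu by simp
  qed
  then have \<mu>_real: "\<mu> = of_real (Re \<mu>)" by (simp add: complex_eq_iff)
  have orth_u: "u \<bullet>c v j = 0" if "j < k" for j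
    using orth[OF that] w v[OF that] by (simp add: u_def)
  have orth_u': "v j \<bullet>c u = 0" if "j < k" for j
  proof -
    have "v j \<bullet>c u = cnj (u \<bullet>c v j)"
      by (simp add: cscalar_prod_sum[OF u] cscalar_prod_sum[OF v[OF that]] mult_ac)
    then show ?thesis using orth_u[OF that] by simp
  qed
  show ?case
    by (intro exI[of _ "v(k := u)"] exI[of _ "d(k := Re \<mu>)"])
       (use v u Av Au \<mu>_real vv uu orth_u orth_u' in \<open>auto simp: less_Suc_eq\<close>)
qed auto

section \<open>Diagonal matrices and unitary diagonalization\<close>

definition diag_of :: "nat \<Rightarrow> (nat \<Rightarrow> complex) \<Rightarrow> complex mat" where
  "diag_of n d = Matrix.mat n n (\<lambda>(i, j). if i = j then d i else 0)"

lemma diag_of_carrier [simp]: "diag_of n d \<in> carrier_mat n n"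
  by (simp add: diag_of_def)

lemma diag_of_mult_vec:
  assumes "x \<in> carrier_vec n" shows "diag_of n d *\<^sub>v x = vec n (\<lambda>i. d i * x $ i)"
proof (rule eq_vecI)
  fix i assume i: "i < dim_vec (vec n (\<lambda>i. d i * x $ i))"
  then have "(diag_of n d *\<^sub>v x) $ i = (\<Sum>j<n. (if i = j then d i else 0) * x $ j)"
    by (subst index_mult_mat_vec_sum[OF diag_of_carrier assms]) (auto simp: diag_of_def)
  also have "\<dots> = (\<Sum>j<n. if i = j then d i * x $ j else 0)"
    by (intro sum.cong) auto
  finally have "(diag_of n d *\<^sub>v x) $ i = (\<Sum>j<n. if i = j then d i * x $ j else 0)" .
  then show "(diag_of n d *\<^sub>v x) $ i = vec n (\<lambda>i. d i * x $ i) $ i" using i by simp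
qed (simp add: diag_of_def)

lemma mult_diag_of:
  assumes "A \<in> carrier_mat m n"
  shows "A * diag_of n d = Matrix.mat m n (\<lambda>(i, j). A $$ (i, j) * d j)"
proof (rule eq_matI)
  fix i j assume "i < dim_row (Matrix.mat m n (\<lambda>(i, j). A $$ (i, j) * d j))"
    "j < dim_col (Matrix.mat m n (\<lambda>(i, j). A $$ (i, j) * d j))"
  then have ij: "i < m" "j < n" by auto
  then have "(A * diag_of n d) $$ (i, j) = (\<Sum>k<n. A $$ (i, k) * (if k = j then d k else 0))"
    using assms by (auto simp: scalar_prod_def atLeast0LessThan diag_of_def)
  also have "\<dots> = (\<Sum>k<n. if k = j then A $$ (i, j) * d j else 0)" by (intro sum.cong) auto
  finally show "(A * diag_of n d) $$ (i, j) = Matrix.mat m n (\<lambda>(i, j). A $$ (i, j) * d j) $$ (i, j)"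
    using ij by simp
qed (use assms in \<open>auto simp: diag_of_def\<close>)

lemma diag_of_mult_diag_of: "diag_of n a * diag_of n b = diag_of n (\<lambda>i. a i * b i)"
  by (subst mult_diag_of[OF diag_of_carrier]) (auto simp: diag_of_def intro!: eq_matI)

lemma adjoint_diag_of: "mat_adjoint (diag_of n d) = diag_of n (\<lambda>i. cnj (d i))"
  by (rule eq_matI) (auto simp: diag_of_def index_mat_adjoint)

lemma mat_adjoint_mult:
  fixes A B :: "complex mat"
  assumes "A \<in> carrier_mat n m" "B \<in> carrier_mat m k"
  shows "mat_adjoint (A * B) = mat_adjoint B * mat_adjoint A"
  by (rule eq_matI) (use assms in \<open>auto simp: index_mat_adjoint scalar_prod_def mult.commute intro!: sum.cong\<close>)

theorem hermitian_diagonalization: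
  fixes A :: "complex mat"
  assumes A: "A \<in> carrier_mat n n" and herm: "mat_adjoint A = A"
  obtains U d where "U \<in> carrier_mat n n" "mat_adjoint U * U = 1\<^sub>m n" "U * mat_adjoint U = 1\<^sub>m n"
    "A = U * diag_of n (\<lambda>i. complex_of_real (d i)) * mat_adjoint U"
proof -
  obtain v d where v: "\<And>i. i < n \<Longrightarrow> v i \<in> carrier_vec n"
      and Av: "\<And>i. i < n \<Longrightarrow> A *\<^sub>v v i = of_real (d i) \<cdot>\<^sub>v v i"
      and vv: "\<And>i j. i < n \<Longrightarrow> j < n \<Longrightarrow> v i \<bullet>c v j = (if i = j then 1 else 0)"
    using hermitian_orthonormal_eigenvectors[OF A herm order_refl] by blast
  define U where "U = Matrix.mat n n (\<lambda>(s, i). v i $ s)"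
  have U: "U \<in> carrier_mat n n" by (simp add: U_def)
  have UU: "mat_adjoint U * U = 1\<^sub>m n"
  proof (rule eq_matI)
    fix i j assume "i < dim_row (1\<^sub>m n :: complex mat)" "j < dim_col (1\<^sub>m n :: complex mat)"
    then have ij: "i < n" "j < n" by auto
    then have "(mat_adjoint U * U) $$ (i, j) = v j \<bullet>c v i"
      using U by (auto simp: scalar_prod_def atLeast0LessThan index_mat_adjoint U_def
          cscalar_prod_sum[OF v] carrier_vecD[OF v] mult.commute intro!: sum.cong)
    then show "(mat_adjoint U * U) $$ (i, j) = 1\<^sub>m n $$ (i, j)" using ij vv by simp
  qed (use U in auto)
  have UU': "U * mat_adjoint U = 1\<^sub>m n"
    using mat_mult_left_right_inverse[OF _ U UU] U by blast
  have AU: "A * U = U * diag_of n (\<lambda>i. of_real (d i))"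
  proof (rule eq_matI)
    fix s i assume "s < dim_row (U * diag_of n (\<lambda>i. of_real (d i)))" "i < dim_col (U * diag_of n (\<lambda>i. of_real (d i)))"
    then have si: "s < n" "i < n" using U by (auto simp: diag_of_def)
    have "col U i = v i" using si v[OF si(2)] by (auto simp: U_def)
    then have "(A * U) $$ (s, i) = (A *\<^sub>v v i) $ s"
      using si A U by simp
    also have "\<dots> = v i $ s * of_real (d i)" using Av si v[OF si(2)] by simp
    finally show "(A * U) $$ (s, i) = (U * diag_of n (\<lambda>i. of_real (d i))) $$ (s, i)"
      using si by (simp add: mult_diag_of[OF U]) (simp add: U_def)
  qed (use A U in \<open>auto simp: diag_of_def\<close>)
  have "A = A * (U * mat_adjoint U)" using A UU' by simp
  also have "\<dots> = U * diag_of n (\<lambda>i. of_real (d i)) * mat_adjoint U"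
    unfolding AU[symmetric] using A U by (intro assoc_mult_mat[symmetric]) auto
  finally show thesis using that U UU UU' by blast
qed

text \<open>The similarity may be non-unitary: besides Hermitian matrices this serves the
  preconditioned matrix, which is diagonalized by an oblique basis.\<close>

lemma eigenvalue_mset_diagonalizable:
  assumes "P \<in> carrier_mat n n" "Q \<in> carrier_mat n n" "P * Q = 1\<^sub>m n" "Q * P = 1\<^sub>m n"
    and A: "A = P * diag_of n d * Q"
  shows "eigenvalue_mset A = image_mset d (mset_set {..<n})"
proof -
  have "similar_mat A (diag_of n d)"
    by (rule similar_matI[of _ _ P Q n]) (use assms in auto)
  then have "char_poly A = (\<Prod>a\<leftarrow>diag_mat (diag_of n d). [:- a, 1:])"
    by (subst char_poly_similar) (auto intro!: char_poly_upper_triangular[of _ n] simp: upper_triangular_def diag_of_def)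
  also have "diag_mat (diag_of n d) = map d [0..<n]"
    by (auto simp: diag_mat_def diag_of_def)
  finally have cp: "char_poly A = (\<Prod>i\<leftarrow>[0..<n]. [:- d i, 1:])" by (simp add: comp_def)
  have "eigenvalue_mset A = (\<Sum>i\<leftarrow>[0..<n]. {#d i#})"
    unfolding eigenvalue_mset_def cp
  proof (induction n)
    case (Suc n)
    have "(\<Prod>i\<leftarrow>[0..<n]. [:- d i, 1:]) \<noteq> 0" by (auto simp: prod_list_zero_iff)
    then have "proots ((\<Prod>i\<leftarrow>[0..<n]. [:- d i, 1:]) * [:- d n, 1:]) =
        proots (\<Prod>i\<leftarrow>[0..<n]. [:- d i, 1:]) + {#d n#}"
      by (subst proots_mult) auto
    then show ?case using Suc by (simp del: mult_pCons_left mult_pCons_right)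
  qed simp
  also have "\<dots> = image_mset d (mset [0..<n])"
    by (induction n) auto
  finally show ?thesis by (simp add: atLeast0LessThan[symmetric] mset_upt)
qed

section \<open>Norms and forms in an orthonormal eigenbasis, singular values\<close>

abbreviation sq_coord :: "complex mat \<Rightarrow> complex Matrix.vec \<Rightarrow> nat \<Rightarrow> real" where
  "sq_coord W x i \<equiv> (cmod ((W *\<^sub>v x) $ i))\<^sup>2"

lemma hermitian_form_coordinates:
  assumes U: "U \<in> carrier_mat n n" and A: "A = U * diag_of n (\<lambda>i. of_real (d i)) * mat_adjoint U"
    and x: "x \<in> carrier_vec n"
  shows "(A *\<^sub>v x) \<bullet>c x = of_real (\<Sum>i<n. d i * sq_coord (mat_adjoint U) x i)"
proof -
  let ?y = "mat_adjoint U *\<^sub>v x"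
  have Ua: "mat_adjoint U \<in> carrier_mat n n" using U by blast
  have y: "?y \<in> carrier_vec n" using mult_mat_vec_carrier[OF Ua x] .
  have D: "diag_of n (\<lambda>i. of_real (d i)) *\<^sub>v ?y \<in> carrier_vec n"
    using mult_mat_vec_carrier[OF diag_of_carrier y] .
  have "A *\<^sub>v x = U *\<^sub>v (diag_of n (\<lambda>i. of_real (d i)) *\<^sub>v ?y)"
    unfolding A using U Ua x y
    by (simp add: assoc_mult_mat_vec[of _ n n _ n] assoc_mult_mat_vec[OF U diag_of_carrier y])
  then have "(A *\<^sub>v x) \<bullet>c x = (diag_of n (\<lambda>i. of_real (d i)) *\<^sub>v ?y) \<bullet>c ?y"
    using cscalar_prod_adjoint[OF U D x] by simp
  also have "\<dots> = (\<Sum>i<n. of_real (d i) * (?y $ i * cnj (?y $ i)))"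
    unfolding cscalar_prod_sum[OF y] diag_of_mult_vec[OF y] by (simp add: mult.assoc)
  finally show ?thesis by (simp only: complex_norm_square of_real_sum of_real_mult)
qed

lemma vnorm_sq_coordinates:
  assumes U: "U \<in> carrier_mat n n" "U * mat_adjoint U = 1\<^sub>m n" and x: "x \<in> carrier_vec n"
  shows "(vnorm x)\<^sup>2 = (\<Sum>i<n. sq_coord (mat_adjoint U) x i)"
proof -
  have "vnorm x = vnorm (mat_adjoint U *\<^sub>v x)"
    using vnorm_unitary[of "mat_adjoint U" n n x] U x by auto
  then show ?thesis using U(1) by (simp add: vnorm_sq)
qed

text \<open>This is the unitary diagonalization of \<open>mat_adjoint B * B\<close>; the columns of
  \<open>U\<close> are right singular vectors. The last conclusion, a weighted sum of squared
  coordinates, is the form in which singular values enter codimension bounds.\<close>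

theorem singular_value_decomposition:
  assumes B: "B \<in> carrier_mat n n"
  obtains U d where "U \<in> carrier_mat n n" "mat_adjoint U * U = 1\<^sub>m n" "U * mat_adjoint U = 1\<^sub>m n"
    "\<And>i. 0 \<le> d i" "singular_value_mset B = image_mset d (mset_set {..<n})"
    "mat_adjoint B * B = U * diag_of n (\<lambda>i. of_real ((d i)\<^sup>2)) * mat_adjoint U"
    "\<And>x. x \<in> carrier_vec n \<Longrightarrow> (vnorm (B *\<^sub>v x))\<^sup>2 = (\<Sum>i<n. (d i)\<^sup>2 * sq_coord (mat_adjoint U) x i)"
proof -
  let ?A = "mat_adjoint B * B"
  have Ba: "mat_adjoint B \<in> carrier_mat n n" using B by blast
  have A: "?A \<in> carrier_mat n n" using B by auto
  have "mat_adjoint ?A = ?A" using mat_adjoint_mult[OF Ba B] by simp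
  then obtain U e where U: "U \<in> carrier_mat n n" "mat_adjoint U * U = 1\<^sub>m n" "U * mat_adjoint U = 1\<^sub>m n"
      and Ae: "?A = U * diag_of n (\<lambda>i. of_real (e i)) * mat_adjoint U"
    using hermitian_diagonalization[OF A] by blast
  have Bx: "(vnorm (B *\<^sub>v x))\<^sup>2 = (\<Sum>i<n. e i * sq_coord (mat_adjoint U) x i)"
    if x: "x \<in> carrier_vec n" for x
  proof -
    have Bx: "B *\<^sub>v x \<in> carrier_vec n" using mult_mat_vec_carrier[OF B x] .
    have "of_real ((vnorm (B *\<^sub>v x))\<^sup>2) = (B *\<^sub>v x) \<bullet>c (B *\<^sub>v x)" by (simp add: cscalar_prod_self)
    also have "\<dots> = (?A *\<^sub>v x) \<bullet>c x"
      using cscalar_prod_adjoint[OF Ba Bx x] assoc_mult_mat_vec[OF Ba B x] by simp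
    also have "\<dots> = of_real (\<Sum>i<n. e i * sq_coord (mat_adjoint U) x i)"
      by (rule hermitian_form_coordinates[OF U(1) Ae x])
    finally show ?thesis unfolding of_real_eq_iff .
  qed
  have e: "e i \<ge> 0" if i: "i < n" for i
  proof -
    let ?x = "U *\<^sub>v unit_vec n i"
    have "mat_adjoint U *\<^sub>v ?x = unit_vec n i"
      using U assoc_mult_mat_vec[of "mat_adjoint U" n n U n "unit_vec n i"] by auto
    then have "(vnorm (B *\<^sub>v ?x))\<^sup>2 = (\<Sum>j<n. e j * (cmod (unit_vec n i $ j))\<^sup>2)"
      using Bx[of ?x] mult_mat_vec_carrier[OF U(1) unit_vec_carrier] by simp
    also have "\<dots> = (\<Sum>j<n. if j = i then e j else 0)"
      using i by (intro sum.cong) auto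
    also have "\<dots> = e i" using i by simp
    finally show ?thesis by (metis zero_le_power2)
  qed
  \<comment> \<open>The absolute value makes \<open>d i\<close> nonnegative for every
    \<open>i\<close>, including indices from \<open>n\<close> on, where \<open>e\<close> is
    arbitrary.\<close>
  define d where "d i = sqrt \<bar>e i\<bar>" for i
  have d: "(d i)\<^sup>2 = e i" if "i < n" for i using e[OF that] by (simp add: d_def)
  have "singular_value_mset B = image_mset (\<lambda>z. sqrt (Re z)) (image_mset (\<lambda>i. of_real (e i)) (mset_set {..<n}))"
    unfolding singular_value_mset_def
    by (subst eigenvalue_mset_diagonalizable[OF U(1) _ U(3,2) Ae]) (use U in auto)
  also have "\<dots> = image_mset d (mset_set {..<n})"
    by (auto simp: multiset.map_comp comp_def d_def e intro!: image_mset_cong)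
  finally have sv: "singular_value_mset B = image_mset d (mset_set {..<n})" .
  have "diag_of n (\<lambda>i. of_real (e i)) = diag_of n (\<lambda>i. of_real ((d i)\<^sup>2))"
    by (rule eq_matI) (auto simp: diag_of_def d[symmetric])
  with Ae have "?A = U * diag_of n (\<lambda>i. of_real ((d i)\<^sup>2)) * mat_adjoint U" by simp
  then show thesis
    using that[OF U _ sv] Bx d by (auto simp: d_def)
qed

text \<open>Annihilating the coordinates with too large a weight leaves only weights at most
  \<open>b\<close>. The matrix \<open>B\<close> enters through its sum of squares alone, so the
  lemma also applies to the change of basis \<open>W\<close> of the preconditioned problem, with the
  square roots of the eigenvalues of the preconditioner as weights.\<close>

lemma codim_le_singular_values_upper:
  assumes U: "U \<in> carrier_mat n n" "U * mat_adjoint U = 1\<^sub>m n"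
    and d: "\<And>i. 0 \<le> d i"
    and B: "\<And>x. x \<in> carrier_vec n \<Longrightarrow> (vnorm (B *\<^sub>v x))\<^sup>2 = (\<Sum>i<n. (d i)\<^sup>2 * sq_coord (mat_adjoint U) x i)"
    and b: "0 \<le> b"
  shows "codim_le n (card {i. i < n \<and> b < d i}) (norm_le B b)"
proof (rule codim_le_mono[OF codim_le_coordinates[of "mat_adjoint U" n n] order_refl])
  fix x assume x: "x \<in> carrier_vec n" "x \<in> {x. \<forall>i\<in>{i. i < n \<and> b < d i}. (mat_adjoint U *\<^sub>v x) $ i = 0}"
  have "(d i)\<^sup>2 * sq_coord (mat_adjoint U) x i \<le> b\<^sup>2 * sq_coord (mat_adjoint U) x i" if "i < n" for i
    using x that d[of i] by (cases "b < d i") (auto intro!: mult_right_mono power_mono)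
  then have "(vnorm (B *\<^sub>v x))\<^sup>2 \<le> (b * vnorm x)\<^sup>2"
    unfolding B[OF x(1)] power_mult_distrib vnorm_sq_coordinates[OF U x(1)] sum_distrib_left
    by (intro sum_mono) simp
  then show "x \<in> norm_le B b"
    using b by (auto intro: power2_le_imp_le)
qed (use U in auto)

lemma codim_le_singular_values_lower:
  assumes U: "U \<in> carrier_mat n n" "U * mat_adjoint U = 1\<^sub>m n"
    and B: "\<And>x. x \<in> carrier_vec n \<Longrightarrow> (vnorm (B *\<^sub>v x))\<^sup>2 = (\<Sum>i<n. (d i)\<^sup>2 * sq_coord (mat_adjoint U) x i)"
    and a: "0 \<le> a"
  shows "codim_le n (card {i. i < n \<and> d i < a}) (norm_ge B a)"
proof (rule codim_le_mono[OF codim_le_coordinates[of "mat_adjoint U" n n] order_refl])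
  fix x assume x: "x \<in> carrier_vec n" "x \<in> {x. \<forall>i\<in>{i. i < n \<and> d i < a}. (mat_adjoint U *\<^sub>v x) $ i = 0}"
  have "a\<^sup>2 * sq_coord (mat_adjoint U) x i \<le> (d i)\<^sup>2 * sq_coord (mat_adjoint U) x i" if "i < n" for i
    using x that a by (cases "d i < a") (auto intro!: mult_right_mono power_mono)
  then have "(a * vnorm x)\<^sup>2 \<le> (vnorm (B *\<^sub>v x))\<^sup>2"
    unfolding B[OF x(1)] power_mult_distrib vnorm_sq_coordinates[OF U x(1)] sum_distrib_left
    by (intro sum_mono) simp
  then show "x \<in> norm_ge B a"
    by (auto intro: power2_le_imp_le)
qed (use U in auto)

section \<open>Fourier coefficients and trigonometric polynomials\<close>

abbreviation circ :: "real measure" where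
  "circ \<equiv> lebesgue_on {-pi..pi}"

lemma integrable_circ_iff: "integrable circ f \<longleftrightarrow> set_integrable lebesgue {-pi..pi} f"
  for f :: "real \<Rightarrow> complex"
  unfolding set_integrable_def by (subst integrable_restrict_space) auto

lemma fourier_coeff_circ:
  "fourier_coeff f k = 1 / (2 * of_real pi) * (LINT \<theta>|circ. f \<theta> * exp (- \<i> * of_int k * of_real \<theta>))"
  unfolding fourier_coeff_def set_lebesgue_integral_def by (subst integral_restrict_space) auto

lemma integrable_circ_mult_bounded:
  fixes f b :: "real \<Rightarrow> complex"
  assumes "integrable circ f" "b \<in> borel_measurable circ" "\<And>\<theta>. cmod (b \<theta>) \<le> C"
  shows "integrable circ (\<lambda>\<theta>. f \<theta> * b \<theta>)"
proof (rule Bochner_Integration.integrable_bound[of _ "\<lambda>\<theta>. C * norm (f \<theta>)"])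
  show "AE \<theta> in circ. norm (f \<theta> * b \<theta>) \<le> norm (C * norm (f \<theta>))"
    using assms(3) order_trans[OF norm_ge_zero assms(3)]
    by (auto simp: norm_mult abs_mult mult.commute intro!: mult_right_mono)
qed (use assms in auto)

lemma continuous_measurable_circ:
  "continuous_on UNIV b \<Longrightarrow> b \<in> borel_measurable circ" for b :: "real \<Rightarrow> complex"
  by (meson continuous_imp_measurable_on_sets_lebesgue continuous_on_subset lmeasurable_interval(1)
      subset_UNIV fmeasurableD)

lemma borel_measurable_exp_circ [measurable]:
  "(\<lambda>\<theta>. exp (c * of_real \<theta>)) \<in> borel_measurable circ" for c :: complex
  by (intro continuous_measurable_circ continuous_intros)

lemma cmod_exp_imag [simp]: "cmod (exp (- \<i> * of_int k * of_real \<theta>)) = 1"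
  by (simp add: norm_exp_eq_Re)

lemma integrable_circ_fourier:
  fixes f :: "real \<Rightarrow> complex"
  shows "integrable circ f \<Longrightarrow> integrable circ (\<lambda>\<theta>. f \<theta> * exp (- \<i> * of_int k * of_real \<theta>))"
  by (rule integrable_circ_mult_bounded[where C = 1, OF _ borel_measurable_exp_circ]) simp_all

lemma fourier_coeff_add:
  assumes "integrable circ f" "integrable circ g"
  shows "fourier_coeff (\<lambda>\<theta>. f \<theta> + g \<theta>) k = fourier_coeff f k + fourier_coeff g k"
  unfolding fourier_coeff_circ
  by (simp only: distrib_right distrib_left
      Bochner_Integration.integral_add[OF integrable_circ_fourier[OF assms(1)] integrable_circ_fourier[OF assms(2)]])

lemma fourier_coeff_cmult:
  "fourier_coeff (\<lambda>\<theta>. c * f \<theta>) k = c * fourier_coeff f k"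
  unfolding fourier_coeff_circ by (simp only: mult.assoc integral_mult_right_zero) simp

lemma fourier_coeff_mult_exp:
  "fourier_coeff (\<lambda>\<theta>. f \<theta> * exp (\<i> * of_int m * of_real \<theta>)) k = fourier_coeff f (k - m)"
proof -
  have "exp (\<i> * of_int m * of_real \<theta>) * exp (- \<i> * of_int k * of_real \<theta>) =
      exp (- \<i> * of_int (k - m) * of_real \<theta> :: complex)" for \<theta>
    unfolding exp_add[symmetric] by (simp add: algebra_simps)
  then show ?thesis unfolding fourier_coeff_circ by (simp only: mult.assoc)
qed

lemma fourier_coeff_one: "fourier_coeff (\<lambda>_. 1) k = (if k = 0 then 1 else 0)"
proof (cases "k = 0")
  case True
  have "measure lebesgue {-pi..pi} = 2 * pi" by simp
  then have "(LINT \<theta>|circ. (1 :: complex)) = of_real (2 * pi)"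
    by (simp add: measure_restrict_space scaleR_conv_of_real)
  then show ?thesis using True by (simp add: fourier_coeff_circ)
next
  case False
  let ?F = "\<lambda>\<theta>. exp (- \<i> * of_int k * of_real \<theta>) / (- \<i> * of_int k)"
  have "((\<lambda>\<theta>. exp (- \<i> * of_int k * of_real \<theta>)) has_integral (?F pi - ?F (- pi))) {-pi..pi}"
  proof (rule fundamental_theorem_of_calculus)
    fix x :: real
    show "(?F has_vector_derivative exp (- \<i> * of_int k * of_real x)) (at x within {-pi..pi})"
      by (rule has_vector_derivative_real_field) (use False in \<open>auto intro!: derivative_eq_intros\<close>)
  qed simp
  moreover have "?F pi = ?F (- pi)"
  proof -
    have "exp (- \<i> * of_int k * of_real pi) = exp (- \<i> * of_int k * of_real (- pi) + of_int (2 * (- k)) * of_real pi * \<i> :: complex)"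
      by (simp add: algebra_simps)
    also have "\<dots> = exp (- \<i> * of_int k * of_real (- pi))"
      unfolding exp_eq by (intro exI[of _ "- k"]) simp
    finally show ?thesis by simp
  qed
  ultimately have hi: "((\<lambda>\<theta>. exp (- \<i> * of_int k * of_real \<theta>)) has_integral 0) {-pi..pi}" by (simp only: diff_self)
  have "integrable circ (\<lambda>\<theta>. 1 * exp (- \<i> * of_int k * of_real \<theta>) :: complex)"
    by (rule integrable_circ_fourier) simp
  then have "(LINT \<theta>|circ. exp (- \<i> * of_int k * of_real \<theta>)) = 0"
    using lebesgue_integral_eq_integral[of "{-pi..pi}" "\<lambda>\<theta>. exp (- \<i> * of_int k * of_real \<theta>)"]
      integral_unique[OF hi] by simp
  then show ?thesis using False by (simp add: fourier_coeff_circ)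
qed

text \<open>\<open>x \<bullet>c fourier_vec n \<theta>\<close> is the trigonometric polynomial with coefficient vector \<open>x\<close>, evaluated at \<open>\<theta>\<close>.\<close>

definition fourier_vec :: "nat \<Rightarrow> real \<Rightarrow> complex vec" where
  "fourier_vec n \<theta> = vec n (\<lambda>t. exp (- \<i> * of_nat t * of_real \<theta>))"

lemma fourier_vec_carrier [simp]: "fourier_vec n \<theta> \<in> carrier_vec n"
  by (simp add: fourier_vec_def)

lemma vnorm_fourier_vec: "(vnorm (fourier_vec n \<theta>))\<^sup>2 = n"
  by (simp add: vnorm_sq fourier_vec_def norm_exp_eq_Re)

lemma cscalar_prod_fourier_vec:
  "x \<bullet>c fourier_vec n \<theta> = (\<Sum>t<n. x $ t * exp (\<i> * of_nat t * of_real \<theta>))"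
  by (subst cscalar_prod_sum[OF fourier_vec_carrier]) (simp add: fourier_vec_def exp_cnj)

section \<open>Toeplitz forms and the trace norm\<close>

lemma toeplitz_carrier [simp]: "toeplitz_mat f n \<in> carrier_mat n n"
  by (simp add: toeplitz_mat_def)

lemma cmod_cscalar_prod_fourier_vec_le:
  "x \<in> carrier_vec n \<Longrightarrow> cmod (x \<bullet>c fourier_vec n \<theta>) \<le> vnorm x * sqrt n"
  using cauchy_schwarz_vec[of x n "fourier_vec n \<theta>"] vnorm_fourier_vec[of n \<theta>]
  by (metis fourier_vec_carrier real_sqrt_unique vnorm_ge_0)

text \<open>The entries are Fourier integrals, so finite sums move inside: the sesquilinear form is
  the integral of the symbol against a product of two trigonometric polynomials. Through this
  formula the L^1 norm of the symbol controls the matrix.\<close>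

lemma toeplitz_form:
  assumes g: "integrable circ g" and x: "x \<in> carrier_vec n" and y: "y \<in> carrier_vec n"
  shows "(toeplitz_mat g n *\<^sub>v x) \<bullet>c y =
     1 / (2 * of_real pi) * (LINT \<theta>|circ. g \<theta> * ((x \<bullet>c fourier_vec n \<theta>) * cnj (y \<bullet>c fourier_vec n \<theta>)))"
proof -
  have ptw: "g \<theta> * ((x \<bullet>c fourier_vec n \<theta>) * cnj (y \<bullet>c fourier_vec n \<theta>)) =
     (\<Sum>s<n. \<Sum>t<n. (x $ t * cnj (y $ s)) * (g \<theta> * exp (- \<i> * of_int (int s - int t) * of_real \<theta>)))" for \<theta>
  proof -
    have e: "exp (- \<i> * of_int (int s - int t) * of_real \<theta>) =
        exp (\<i> * of_nat t * of_real \<theta>) * cnj (exp (\<i> * of_nat s * of_real \<theta>))" for s t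
      unfolding exp_cnj exp_add[symmetric] by (simp add: algebra_simps)
    have "g \<theta> * ((x \<bullet>c fourier_vec n \<theta>) * cnj (y \<bullet>c fourier_vec n \<theta>)) =
       (\<Sum>t<n. \<Sum>s<n. g \<theta> * ((x $ t * exp (\<i> * of_nat t * of_real \<theta>)) * cnj (y $ s * exp (\<i> * of_nat s * of_real \<theta>))))"
      unfolding cscalar_prod_fourier_vec cnj_sum by (simp only: sum_product) (simp only: sum_distrib_left)
    also have "\<dots> = (\<Sum>s<n. \<Sum>t<n. g \<theta> * ((x $ t * exp (\<i> * of_nat t * of_real \<theta>)) * cnj (y $ s * exp (\<i> * of_nat s * of_real \<theta>))))"
      by (rule sum.swap)
    finally show ?thesis unfolding e by (simp add: mult_ac)
  qed
  have "(LINT \<theta>|circ. g \<theta> * ((x \<bullet>c fourier_vec n \<theta>) * cnj (y \<bullet>c fourier_vec n \<theta>))) =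
     (\<Sum>s<n. \<Sum>t<n. (x $ t * cnj (y $ s)) * (LINT \<theta>|circ. g \<theta> * exp (- \<i> * of_int (int s - int t) * of_real \<theta>)))"
    unfolding ptw using integrable_circ_fourier[OF g]
    by (simp add: Bochner_Integration.integral_sum del: of_int_diff)
  also have "1 / (2 * of_real pi) * \<dots> = (\<Sum>s<n. \<Sum>t<n. (x $ t * cnj (y $ s)) * fourier_coeff g (int s - int t))"
    unfolding fourier_coeff_circ sum_distrib_left by (simp only: mult.left_commute)
  also have "\<dots> = (toeplitz_mat g n *\<^sub>v x) \<bullet>c y"
    unfolding cscalar_prod_sum[OF y]
    by (intro sum.cong refl) (subst index_mult_mat_vec_sum[OF toeplitz_carrier x],
      auto simp: toeplitz_mat_def sum_distrib_left sum_distrib_right mult_ac)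
  finally show ?thesis by simp
qed

text \<open>A trace norm bound followed by Chebyshev's inequality. The sum of the singular values
  above \<open>\<eta>\<close> is the mean of \<open>g\<close> times a kernel \<open>h\<close> built
  from right and left singular vectors. By Bessel's inequality for both orthonormal systems,
  evaluated at the Fourier vector of squared norm \<open>n\<close>, \<open>h\<close> is bounded by
  \<open>n\<close>; so that sum is at most \<open>n / (2 * pi)\<close> times the L^1 norm of
  \<open>g\<close>.\<close>

lemma codim_le_toeplitz_L1:
  assumes g: "integrable circ g" and "\<eta> > 0"
  shows "codim_le n (n * (LINT \<theta>|circ. cmod (g \<theta>)) / (2 * pi * \<eta>))
           (norm_le (toeplitz_mat g n) \<eta>)"
proof -
  let ?T = "toeplitz_mat g n"
  have T: "?T \<in> carrier_mat n n" by simp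
  obtain U d where U: "U \<in> carrier_mat n n" "mat_adjoint U * U = 1\<^sub>m n" "U * mat_adjoint U = 1\<^sub>m n"
    and d: "\<And>i. 0 \<le> d i"
    and TT: "mat_adjoint ?T * ?T = U * diag_of n (\<lambda>i. of_real ((d i)\<^sup>2)) * mat_adjoint U"
    and Tx: "\<And>x. x \<in> carrier_vec n \<Longrightarrow> (vnorm (?T *\<^sub>v x))\<^sup>2 = (\<Sum>i<n. (d i)\<^sup>2 * sq_coord (mat_adjoint U) x i)"
    by (rule singular_value_decomposition[OF T]) (rule that; assumption)
  have Ua: "mat_adjoint U \<in> carrier_mat n n" using U by blast
  define S where "S = {i. i < n \<and> \<eta> < d i}"
  have S: "finite S" "S \<subseteq> {..<n}" by (auto simp: S_def)
  have dS: "d i > 0" if "i \<in> S" for i using that \<open>\<eta> > 0\<close> by (auto simp: S_def)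
  define u where "u i = U *\<^sub>v unit_vec n i" for i
  have u: "u i \<in> carrier_vec n" for i
    unfolding u_def using mult_mat_vec_carrier[OF U(1) unit_vec_carrier] .
  have Uu: "mat_adjoint U *\<^sub>v u i = unit_vec n i" for i
    unfolding u_def using U assoc_mult_mat_vec[of "mat_adjoint U" n n U n "unit_vec n i"] by auto
  have Tu: "?T *\<^sub>v u i \<in> carrier_vec n" for i using mult_mat_vec_carrier[OF T u] .
  have nTu: "(?T *\<^sub>v u i) \<bullet>c (?T *\<^sub>v u i) = of_real ((d i)\<^sup>2)" if "i < n" for i
  proof -
    have "(vnorm (?T *\<^sub>v u i))\<^sup>2 = (\<Sum>j<n. if j = i then (d i)\<^sup>2 else 0)"
      unfolding Tx[OF u] Uu using that by (intro sum.cong) auto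
    then show ?thesis using that by (simp add: cscalar_prod_self)
  qed
  have bessel_u: "(\<Sum>i\<in>S. (cmod (u i \<bullet>c e))\<^sup>2) \<le> (vnorm e)\<^sup>2" if e: "e \<in> carrier_vec n" for e
  proof -
    have "u i \<bullet>c e = cnj ((mat_adjoint U *\<^sub>v e) $ i)" if "i < n" for i
    proof -
      have "u i \<bullet>c e = unit_vec n i \<bullet>c (mat_adjoint U *\<^sub>v e)"
        unfolding u_def by (rule cscalar_prod_adjoint[OF U(1) unit_vec_carrier e])
      also have "\<dots> = cnj ((mat_adjoint U *\<^sub>v e) $ i)"
        using that U(1) mult_mat_vec_carrier[OF Ua e] by (subst scalar_prod_left_unit) (auto simp del: index_mult_mat_vec)
      finally show ?thesis .
    qed
    then have "(\<Sum>i\<in>S. (cmod (u i \<bullet>c e))\<^sup>2) = (\<Sum>i\<in>S. sq_coord (mat_adjoint U) e i)"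
      using S by (intro sum.cong) auto
    also have "\<dots> \<le> (\<Sum>i<n. sq_coord (mat_adjoint U) e i)"
      using S by (intro sum_mono2) auto
    finally show ?thesis using vnorm_sq_coordinates[OF U(1,3) e] by simp
  qed
  \<comment> \<open>Bessel's inequality for the left singular vectors
    \<open>(?T *\<^sub>v u i) / d i\<close>, by duality: with \<open>w\<close> as below, the image
    of \<open>U *\<^sub>v w\<close> under \<open>?T\<close> has squared norm \<open>?q\<close> and
    inner product \<open>?q\<close> with \<open>e\<close>, so Cauchy-Schwarz gives the
    bound.\<close>
  have bessel_Tu: "(\<Sum>i\<in>S. (cmod ((?T *\<^sub>v u i) \<bullet>c e) / d i)\<^sup>2) \<le> (vnorm e)\<^sup>2" if e: "e \<in> carrier_vec n" for e
  proof -
    let ?y = "mat_adjoint ?T *\<^sub>v e"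
    have y: "?y \<in> carrier_vec n" using mult_mat_vec_carrier[OF mat_adjoint_carrier[OF T] e] .
    have Uy: "mat_adjoint U *\<^sub>v ?y \<in> carrier_vec n" using mult_mat_vec_carrier[OF Ua y] .
    define c where "c i = cnj ((?T *\<^sub>v u i) \<bullet>c e) / d i" for i
    define w where "w = vec n (\<lambda>i. if i \<in> S then c i / d i else 0)"
    have w: "w \<in> carrier_vec n" by (simp add: w_def)
    have Uw: "U *\<^sub>v w \<in> carrier_vec n" using mult_mat_vec_carrier[OF U(1) w] .
    have UUw: "mat_adjoint U *\<^sub>v (U *\<^sub>v w) = w"
      using U w assoc_mult_mat_vec[OF Ua U(1) w] by simp
    let ?q = "\<Sum>i\<in>S. (cmod (c i))\<^sup>2"
    have "(vnorm (?T *\<^sub>v (U *\<^sub>v w)))\<^sup>2 = (\<Sum>i<n. if i \<in> S then (cmod (c i))\<^sup>2 else 0)"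
      unfolding Tx[OF Uw] UUw
      by (intro sum.cong refl) (use dS in \<open>force simp: w_def norm_divide power_divide\<close>)
    also have "\<dots> = ?q" using S by (simp add: sum.If_cases Int_absorb1)
    finally have n1: "(vnorm (?T *\<^sub>v (U *\<^sub>v w)))\<^sup>2 = ?q" .
    have "(?T *\<^sub>v (U *\<^sub>v w)) \<bullet>c e = w \<bullet>c (mat_adjoint U *\<^sub>v ?y)"
      using cscalar_prod_adjoint[OF T Uw e] cscalar_prod_adjoint[OF U(1) w]
        y by simp
    also have "\<dots> = (\<Sum>i<n. w $ i * cnj ((mat_adjoint U *\<^sub>v ?y) $ i))"
      by (rule cscalar_prod_sum[OF Uy])
    also have "\<dots> = (\<Sum>i<n. if i \<in> S then of_real ((cmod (c i))\<^sup>2) else 0)"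
    proof (intro sum.cong refl)
      fix i assume i: "i \<in> {..<n}"
      have "cnj ((mat_adjoint U *\<^sub>v ?y) $ i) = unit_vec n i \<bullet>c (mat_adjoint U *\<^sub>v ?y)"
        using i U(1) Uy
        by (subst scalar_prod_left_unit) (auto simp del: index_mult_mat_vec)
      also have "\<dots> = u i \<bullet>c ?y"
        unfolding u_def using cscalar_prod_adjoint[OF U(1) unit_vec_carrier y] ..
      also have "\<dots> = (?T *\<^sub>v u i) \<bullet>c e" using cscalar_prod_adjoint[OF T u e] by simp
      finally have a: "cnj ((mat_adjoint U *\<^sub>v ?y) $ i) = (?T *\<^sub>v u i) \<bullet>c e" .
      show "w $ i * cnj ((mat_adjoint U *\<^sub>v ?y) $ i) = (if i \<in> S then of_real ((cmod (c i))\<^sup>2) else 0)"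
        unfolding a complex_norm_square using i by (auto simp: w_def c_def)
    qed
    also have "\<dots> = of_real ?q" using S by (simp add: sum.If_cases Int_absorb1)
    finally have "?q = cmod ((?T *\<^sub>v (U *\<^sub>v w)) \<bullet>c e)" by (simp add: sum_nonneg del: of_real_sum)
    also have "\<dots> \<le> vnorm (?T *\<^sub>v (U *\<^sub>v w)) * vnorm e"
      using cauchy_schwarz_vec[OF mult_mat_vec_carrier[OF T Uw] e] .
    finally have "(vnorm (?T *\<^sub>v (U *\<^sub>v w)))\<^sup>2 \<le> vnorm (?T *\<^sub>v (U *\<^sub>v w)) * vnorm e" using n1 by simp
    then have "vnorm (?T *\<^sub>v (U *\<^sub>v w)) \<le> vnorm e"
      by (cases "vnorm (?T *\<^sub>v (U *\<^sub>v w)) = 0") (auto simp: power2_eq_square order_less_le)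
    then have "?q \<le> (vnorm e)\<^sup>2" unfolding n1[symmetric] by (intro power_mono) auto
    moreover have "(cmod (c i))\<^sup>2 = (cmod ((?T *\<^sub>v u i) \<bullet>c e) / d i)\<^sup>2" for i
      using d[of i] by (simp add: c_def norm_divide)
    ultimately show ?thesis by simp
  qed
  define h where "h \<theta> = (\<Sum>i\<in>S. (u i \<bullet>c fourier_vec n \<theta>) * cnj ((?T *\<^sub>v u i) \<bullet>c fourier_vec n \<theta>) / d i)" for \<theta>
  have h_le: "cmod (h \<theta>) \<le> n" for \<theta>
  proof -
    let ?p = "\<lambda>i. cmod (u i \<bullet>c fourier_vec n \<theta>)" and ?q = "\<lambda>i. cmod ((?T *\<^sub>v u i) \<bullet>c fourier_vec n \<theta>) / d i"
    have "cmod (h \<theta>) \<le> (\<Sum>i\<in>S. ?p i * ?q i)"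
      unfolding h_def by (rule order_trans[OF norm_sum]) (use d in \<open>simp add: norm_mult norm_divide\<close>)
    also have "\<dots> \<le> (\<Sum>i\<in>S. ((?p i)\<^sup>2 + (?q i)\<^sup>2) / 2)"
    proof (rule sum_mono)
      fix i show "?p i * ?q i \<le> ((?p i)\<^sup>2 + (?q i)\<^sup>2) / 2"
        using sum_squares_bound[of "?p i" "?q i"] by (simp add: mult_ac)
    qed
    also have "\<dots> = ((\<Sum>i\<in>S. (?p i)\<^sup>2) + (\<Sum>i\<in>S. (?q i)\<^sup>2)) / 2"
      by (simp add: sum.distrib sum_divide_distrib[symmetric])
    also have "\<dots> \<le> n"
      using bessel_u[of "fourier_vec n \<theta>"] bessel_Tu[of "fourier_vec n \<theta>"] vnorm_fourier_vec[of n \<theta>] by simp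
    finally show ?thesis .
  qed
  have int: "integrable circ (\<lambda>\<theta>. g \<theta> * ((u i \<bullet>c fourier_vec n \<theta>) * cnj ((?T *\<^sub>v u i) \<bullet>c fourier_vec n \<theta>)))" for i
  proof (rule integrable_circ_mult_bounded[OF g, where C = "(vnorm (u i) * sqrt n) * (vnorm (?T *\<^sub>v u i) * sqrt n)"])
    show "cmod ((u i \<bullet>c fourier_vec n \<theta>) * cnj ((?T *\<^sub>v u i) \<bullet>c fourier_vec n \<theta>)) \<le>
      (vnorm (u i) * sqrt n) * (vnorm (?T *\<^sub>v u i) * sqrt n)" for \<theta>
      unfolding norm_mult complex_mod_cnj
      using cmod_cscalar_prod_fourier_vec_le[OF u] cmod_cscalar_prod_fourier_vec_le[OF Tu]
      by (intro mult_mono) auto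
    show "(\<lambda>\<theta>. (u i \<bullet>c fourier_vec n \<theta>) * cnj ((?T *\<^sub>v u i) \<bullet>c fourier_vec n \<theta>)) \<in> borel_measurable circ"
      unfolding cscalar_prod_fourier_vec by (intro continuous_measurable_circ continuous_intros)
  qed
  have "of_real (\<Sum>i\<in>S. d i) = (\<Sum>i\<in>S. ((?T *\<^sub>v u i) \<bullet>c (?T *\<^sub>v u i)) / d i)"
    unfolding of_real_sum using S by (intro sum.cong) (auto simp: nTu power2_eq_square subset_iff)
  also have "\<dots> = (\<Sum>i\<in>S. 1 / (2 * of_real pi) * (LINT \<theta>|circ. g \<theta> * ((u i \<bullet>c fourier_vec n \<theta>) * cnj ((?T *\<^sub>v u i) \<bullet>c fourier_vec n \<theta>))) / d i)"
    by (intro sum.cong refl) (simp only: toeplitz_form[OF g u Tu])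
  also have "\<dots> = 1 / (2 * of_real pi) * (LINT \<theta>|circ. g \<theta> * h \<theta>)"
  proof -
    have "(LINT \<theta>|circ. g \<theta> * h \<theta>) = (LINT \<theta>|circ. (\<Sum>i\<in>S. g \<theta> * ((u i \<bullet>c fourier_vec n \<theta>) * cnj ((?T *\<^sub>v u i) \<bullet>c fourier_vec n \<theta>)) / d i))"
      by (simp add: h_def sum_distrib_left)
    also have "\<dots> = (\<Sum>i\<in>S. (LINT \<theta>|circ. g \<theta> * ((u i \<bullet>c fourier_vec n \<theta>) * cnj ((?T *\<^sub>v u i) \<bullet>c fourier_vec n \<theta>))) / d i)"
      using int by (subst Bochner_Integration.integral_sum) auto
    finally show ?thesis by (simp add: sum_distrib_left)
  qed
  finally have "(\<Sum>i\<in>S. d i) = cmod (1 / (2 * of_real pi) * (LINT \<theta>|circ. g \<theta> * h \<theta>))"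
    using d by (metis norm_of_real abs_of_nonneg sum_nonneg)
  also have "\<dots> \<le> 1 / (2 * pi) * (LINT \<theta>|circ. cmod (g \<theta>) * n)"
  proof -
    have hm: "h \<in> borel_measurable circ"
      unfolding h_def cscalar_prod_fourier_vec
      by (intro continuous_measurable_circ continuous_intros) (use dS in force)
    have "cmod (LINT \<theta>|circ. g \<theta> * h \<theta>) \<le> (LINT \<theta>|circ. cmod (g \<theta> * h \<theta>))"
      by (rule Bochner_Integration.integral_norm_bound)
    also have "\<dots> \<le> (LINT \<theta>|circ. cmod (g \<theta>) * n)"
      using g h_le integrable_norm[OF integrable_circ_mult_bounded[OF g hm h_le]]
      by (intro integral_mono) (auto simp: norm_mult intro!: mult_left_mono)
    finally have "cmod (LINT \<theta>|circ. g \<theta> * h \<theta>) \<le> (LINT \<theta>|circ. cmod (g \<theta>) * n)" .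
    then show ?thesis by (simp add: norm_mult norm_divide divide_right_mono)
  qed
  finally have "\<eta> * card S \<le> 1 / (2 * pi) * ((LINT \<theta>|circ. cmod (g \<theta>)) * n)"
    using sum_bounded_below[of S \<eta> d] by (auto simp: S_def mult.commute less_imp_le)
  then have "card S \<le> n * (LINT \<theta>|circ. cmod (g \<theta>)) / (2 * pi * \<eta>)"
    using \<open>\<eta> > 0\<close> by (simp add: field_simps)
  moreover have "codim_le n (card S) (norm_le ?T \<eta>)"
    unfolding S_def by (rule codim_le_singular_values_upper[OF U(1,3) d Tx]) (use \<open>\<eta> > 0\<close> in auto)
  ultimately show ?thesis using codim_le_mono by blast
qed


text \<open>Characters and sums are the generators, so a claim on Toeplitz matrices of trigonometric
  polynomials reduces to one truncated shift and an additivity step.\<close>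

inductive trig_poly :: "(real \<Rightarrow> complex) \<Rightarrow> bool" where
  char: "trig_poly (\<lambda>\<theta>. c * exp (\<i> * of_int k * of_real \<theta>))"
| add: "trig_poly p \<Longrightarrow> trig_poly q \<Longrightarrow> trig_poly (\<lambda>\<theta>. p \<theta> + q \<theta>)"

lemma trig_poly_const: "trig_poly (\<lambda>_. c)"
  using trig_poly.char[of c 0] by simp

lemma trig_poly_char_mult:
  "trig_poly q \<Longrightarrow> trig_poly (\<lambda>\<theta>. (c * exp (\<i> * of_int k * of_real \<theta>)) * q \<theta>)"
proof (induction rule: trig_poly.induct)
  case (char d m)
  have "(\<lambda>\<theta>. (c * exp (\<i> * of_int k * of_real \<theta>)) * (d * exp (\<i> * of_int m * of_real \<theta>))) =
      (\<lambda>\<theta>. (c * d) * exp (\<i> * of_int (k + m) * of_real \<theta>) :: complex)"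
    by (simp add: exp_add[symmetric] algebra_simps)
  then show ?case using trig_poly.char[of "c * d" "k + m"] by simp
next
  case (add p q)
  then show ?case using trig_poly.add by (simp only: distrib_left)
qed

lemma trig_poly_mult: "trig_poly p \<Longrightarrow> trig_poly q \<Longrightarrow> trig_poly (\<lambda>\<theta>. p \<theta> * q \<theta>)"
proof (induction rule: trig_poly.induct)
  case (add p p')
  then show ?case using trig_poly.add by (simp only: distrib_right)
qed (rule trig_poly_char_mult)

lemma trig_poly_continuous: "trig_poly p \<Longrightarrow> continuous_on UNIV p"
  by (induction rule: trig_poly.induct) (intro continuous_intros; assumption?)+

lemma trig_poly_integrable: "trig_poly p \<Longrightarrow> integrable circ p"
proof (induction rule: trig_poly.induct)
  case (char c k)
  have "integrable circ (\<lambda>\<theta>. c * exp (- \<i> * of_int (- k) * of_real \<theta>))"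
    by (rule integrable_circ_fourier) simp
  then show ?case by simp
qed simp

text \<open>A real linear form on the plane restricts to a combination of cosine and sine on the
  unit circle, that is, of the characters of frequency 1 and -1; products and sums stay in the
  class. This turns Stone-Weierstrass on the circle into approximation by trigonometric
  polynomials.\<close>

lemma trig_poly_of_real_polynomial:
  fixes p :: "complex \<Rightarrow> real"
  assumes "real_polynomial_function p"
  shows "trig_poly (\<lambda>\<theta>. of_real (p (cis \<theta>)))"
  using assms
proof (induction rule: real_polynomial_function.induct)
  case (linear f)
  have "f (cis \<theta>) = cos \<theta> * f 1 + sin \<theta> * f \<i>" for \<theta>
  proof -
    have "cis \<theta> = cos \<theta> *\<^sub>R 1 + sin \<theta> *\<^sub>R \<i>" by (simp add: complex_eq_iff)
    then have "f (cis \<theta>) = f (cos \<theta> *\<^sub>R 1 + sin \<theta> *\<^sub>R \<i>)" by simp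
    then show ?thesis
      using linear by (simp add: linear_add[OF bounded_linear.linear] linear_scale[OF bounded_linear.linear])
  qed
  then have "of_real (f (cis \<theta>)) =
      ((of_real (f 1) - \<i> * of_real (f \<i>)) / 2) * exp (\<i> * of_int 1 * of_real \<theta>) +
      ((of_real (f 1) + \<i> * of_real (f \<i>)) / 2) * exp (\<i> * of_int (- 1) * of_real \<theta>)" for \<theta>
    by (simp add: cos_of_real[symmetric] sin_of_real[symmetric] cos_exp_eq sin_exp_eq field_simps)
  then show ?case by (simp only: trig_poly.intros)
next
  case (const c)
  show ?case by (rule trig_poly_const)
next
  case (add f g)
  then show ?case using trig_poly.add by simp
next
  case (mult f g)
  then show ?case using trig_poly_mult by simp
qed

section \<open>Density of trigonometric polynomials in L^1\<close>

lemma cis_eq_cis_imp_eq: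
  assumes "cis x = cis y" "\<bar>x - y\<bar> < 2 * pi"
  shows "x = y"
proof -
  have "sin x = sin y \<and> cos x = cos y" using assms(1) by (auto simp: complex_eq_iff)
  then obtain n :: int where n: "x = y + 2 * pi * n" unfolding sin_cos_eq_iff by auto
  have "2 * pi * \<bar>real_of_int n\<bar> < 2 * pi * 1" using assms(2) n by (simp add: abs_mult)
  then have "\<bar>real_of_int n\<bar> < 1" by (subst (asm) mult_less_cancel_left_pos) auto
  then have "n = 0" by linarith
  then show ?thesis using n by simp
qed

text \<open>By regularity of Lebesgue measure \<open>A\<close> lies, up to small measure, between a
  closed \<open>K\<close> and an open \<open>Q\<close>. A Urysohn function separates the images of
  \<open>K\<close> and of the complement of \<open>Q\<close> on the unit circle, and
  Stone-Weierstrass replaces it uniformly by a polynomial. Working on the circle makes the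
  approximant periodic.\<close>

lemma trig_approximable_indicator:
  assumes A: "A \<in> sets circ"
  shows "\<epsilon> > 0 \<Longrightarrow> \<exists>p. trig_poly p \<and> (LINT \<theta>|circ. cmod (indicator A \<theta> - p \<theta>)) < \<epsilon>"
proof -
  assume \<epsilon>: "\<epsilon> > 0"
  \<comment> \<open>The error is at most the measure of the exceptional set plus the uniform error
    over the circle, less than \<open>2 * \<delta> + 8 * \<delta>\<close>, which is half of
    \<open>\<epsilon>\<close>.\<close>
  define \<delta> where "\<delta> = \<epsilon> / 20"
  have \<delta>: "\<delta> > 0" using \<epsilon> by (simp add: \<delta>_def)
  have "A \<in> sets lebesgue" using A by (auto simp: sets_restrict_space)
  \<comment> \<open>\<open>cis\<close> identifies the two end points. Removing them, a null set,
    keeps the images \<open>S\<close> and \<open>R\<close> disjoint.\<close>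
  define A' where "A' = A \<inter> {-pi<..<pi}"
  have A': "A' \<in> sets lebesgue" using \<open>A \<in> sets lebesgue\<close> by (auto simp: A'_def)
  obtain Q where Q: "open Q" "A' \<subseteq> Q" "Q - A' \<in> lmeasurable" "emeasure lebesgue (Q - A') < ennreal \<delta>"
    using sets_lebesgue_outer_open[OF A' \<delta>] by blast
  obtain K where K: "closed K" "K \<subseteq> A'" "A' - K \<in> lmeasurable" "emeasure lebesgue (A' - K) < ennreal \<delta>"
    using sets_lebesgue_inner_closed[OF A' \<delta>] by blast
  define S where "S = cis ` (K \<inter> {-pi..pi})"
  define R where "R = cis ` ({-pi..pi} - Q \<inter> {-pi<..<pi})"
  have cc: "continuous_on X cis" for X by (intro continuous_intros)
  have "compact S" unfolding S_def
    by (intro compact_continuous_image cc closed_Int_compact K) auto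
  moreover have "compact R" unfolding R_def
    by (intro compact_continuous_image cc compact_diff) (use Q in auto)
  moreover have "S \<inter> R = {}"
  proof (rule ccontr)
    assume "S \<inter> R \<noteq> {}"
    then obtain x y where xy: "x \<in> K" "x \<in> {-pi..pi}" "y \<in> {-pi..pi} - Q \<inter> {-pi<..<pi}" "cis x = cis y"
      unfolding S_def R_def by blast
    have "x \<in> Q \<inter> {-pi<..<pi}" using xy K(2) Q(2) by (auto simp: A'_def)
    moreover from this xy have "\<bar>x - y\<bar> < 2 * pi" by auto
    ultimately show False using cis_eq_cis_imp_eq[OF xy(4)] xy(3) by auto
  qed
  ultimately obtain F :: "complex \<Rightarrow> real" where F: "continuous_on UNIV F" "\<And>x. F x \<in> closed_segment 1 0"
      "\<And>x. x \<in> S \<Longrightarrow> F x = 1" "\<And>x. x \<in> R \<Longrightarrow> F x = 0"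
    using Urysohn[OF compact_imp_closed compact_imp_closed, of S R] by metis
  have F01: "0 \<le> F x \<and> F x \<le> 1" for x using F(2)[of x] by (simp add: closed_segment_eq_real_ivl)
  obtain G where G: "real_polynomial_function G" "\<And>x. x \<in> sphere 0 1 \<Longrightarrow> \<bar>F x - G x\<bar> < \<delta>"
    using Stone_Weierstrass_real_polynomial_function[of "sphere 0 1" F \<delta>] \<delta> F(1)
    by (metis compact_sphere continuous_on_subset subset_UNIV)
  define p where "p \<theta> = complex_of_real (G (cis \<theta>))" for \<theta>
  have p: "trig_poly p" unfolding p_def by (rule trig_poly_of_real_polynomial[OF G(1)])
  define B where "B = ((Q - A') \<union> (A' - K) \<union> {-pi, pi}) \<inter> {-pi..pi}"
  have QKm: "(Q - A') \<union> (A' - K) \<in> lmeasurable" using Q(3) K(3) by blast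
  have pi_m: "{-pi, pi} \<in> lmeasurable" by (intro negligible_imp_measurable negligible_finite) simp
  have un: "(Q - A') \<union> (A' - K) \<union> {-pi, pi} \<in> lmeasurable" using QKm pi_m by (rule fmeasurable.Un)
  have Bm: "B \<in> lmeasurable" unfolding B_def
    by (rule fmeasurable.Int[OF un]) simp
  have "measure lebesgue B \<le> measure lebesgue ((Q - A') \<union> (A' - K) \<union> {-pi, pi})"
    using un Bm by (intro measure_mono_fmeasurable) (auto simp: B_def)
  also have "\<dots> \<le> measure lebesgue ((Q - A') \<union> (A' - K)) + measure lebesgue {-pi, pi}"
    using QKm pi_m by (intro measure_Un_le) auto
  also have "measure lebesgue {-pi, pi} = 0"
    by (rule negligible_imp_measure0, rule negligible_finite) simp
  also have "measure lebesgue ((Q - A') \<union> (A' - K)) \<le> measure lebesgue (Q - A') + measure lebesgue (A' - K)"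
    using Q(3) K(3) by (intro measure_Un_le) auto
  also have "measure lebesgue (Q - A') < \<delta>"
    using Q(3,4) \<delta> by (simp add: emeasure_eq_measure2 ennreal_less_iff)
  also have "measure lebesgue (A' - K) < \<delta>"
    using K(3,4) \<delta> by (simp add: emeasure_eq_measure2 ennreal_less_iff)
  finally have mB: "measure lebesgue B < 2 * \<delta>" by simp
  have ptw: "cmod (indicator A \<theta> - p \<theta>) \<le> indicator B \<theta> + \<delta>" if \<theta>: "\<theta> \<in> {-pi..pi}" for \<theta>
  proof -
    have "cmod (indicator A \<theta> - p \<theta>) = \<bar>indicator A \<theta> - G (cis \<theta>)\<bar>"
      unfolding p_def by (metis norm_of_real of_real_diff of_real_indicator)
    also have "\<dots> \<le> \<bar>indicator A \<theta> - F (cis \<theta>)\<bar> + \<bar>F (cis \<theta>) - G (cis \<theta>)\<bar>" by simp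
    also have "\<bar>F (cis \<theta>) - G (cis \<theta>)\<bar> \<le> \<delta>" using G(2)[of "cis \<theta>"] by simp
    also have "\<bar>indicator A \<theta> - F (cis \<theta>)\<bar> \<le> indicator B \<theta>"
    proof (cases "\<theta> \<in> B")
      case True
      then show ?thesis using F01[of "cis \<theta>"] by (auto simp: indicator_def)
    next
      case False
      then have nB: "\<theta> \<in> {-pi<..<pi}" "\<theta> \<in> K \<or> \<theta> \<notin> Q" using \<theta> Q(2) by (auto simp: B_def)
      show ?thesis
      proof (cases "\<theta> \<in> K")
        case True
        then have "F (cis \<theta>) = 1" "\<theta> \<in> A" using \<theta> K(2) by (auto intro!: F(3) simp: S_def A'_def)
        then show ?thesis by simp
      next
        case False
        then have "F (cis \<theta>) = 0" "\<theta> \<notin> A" using \<theta> Q(2) nB by (auto intro!: F(4) simp: R_def A'_def)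
        then show ?thesis by simp
      qed
    qed
    finally show ?thesis by simp
  qed
  have B_sub: "B \<subseteq> {-pi..pi}" by (simp add: B_def)
  have Bc: "B \<in> sets circ"
    using fmeasurableD[OF Bm] B_sub by (subst sets_restrict_space_iff) auto
  have "emeasure circ B = emeasure lebesgue B"
    using B_sub by (intro emeasure_restrict_space) auto
  then have "emeasure circ B < \<infinity>"
    using fmeasurableD2[OF Bm] by (simp add: less_top)
  then have iB0: "integrable circ (indicator B :: real \<Rightarrow> real)"
    by (rule integrable_real_indicator[OF Bc])
  then have iB: "integrable circ (\<lambda>\<theta>. indicator B \<theta> + \<delta> :: real)"
    by (rule Bochner_Integration.integrable_add) simp
  have "(LINT \<theta>|circ. cmod (indicator A \<theta> - p \<theta>)) \<le> (LINT \<theta>|circ. indicator B \<theta> + \<delta>)"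
  proof (rule integral_mono[OF _ iB])
    have "integrable circ (\<lambda>\<theta>. 1 * indicator A \<theta> :: complex)"
      by (rule integrable_circ_mult_bounded[where C = 1]) (use A in \<open>auto simp: indicator_def\<close>)
    then show "integrable circ (\<lambda>\<theta>. cmod (indicator A \<theta> - p \<theta>))"
      using trig_poly_integrable[OF p] by (intro integrable_norm Bochner_Integration.integrable_diff) simp_all
  qed (use ptw in simp)
  also have "\<dots> = measure lebesgue B + 2 * pi * \<delta>"
  proof -
    have "(LINT \<theta>|circ. indicator B \<theta> :: real) = measure circ (B \<inter> space circ)"
      by (rule Bochner_Integration.integral_indicator)
    also have "B \<inter> space circ = B" using B_sub by auto
    also have "measure circ B = measure lebesgue B"
      using B_sub by (intro measure_restrict_space) auto
    finally have "(LINT \<theta>|circ. indicator B \<theta> :: real) = measure lebesgue B" .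
    moreover have "(LINT \<theta>|circ. \<delta>) = 2 * pi * \<delta>" by (simp add: measure_restrict_space)
    moreover note iB0
    ultimately show ?thesis by (subst Bochner_Integration.integral_add) auto
  qed
  also have "\<dots> < 2 * \<delta> + 2 * 4 * \<delta>"
    using mB \<delta> pi_less_4 by (intro add_strict_mono mult_strict_right_mono) auto
  also have "\<dots> < \<epsilon>" using \<epsilon> by (simp add: \<delta>_def)
  finally show "\<exists>p. trig_poly p \<and> (LINT \<theta>|circ. cmod (indicator A \<theta> - p \<theta>)) < \<epsilon>" using p by blast
qed

text \<open>Induction over integrable functions: scaled indicators, sums, and limits of dominated
  sequences. Only the indicators carry content.\<close>

theorem trig_poly_dense_L1:
  assumes "integrable circ f" "\<epsilon> > 0"
  shows "\<exists>p. trig_poly p \<and> (LINT \<theta>|circ. cmod (f \<theta> - p \<theta>)) < \<epsilon>"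
  using assms
proof (induction f arbitrary: \<epsilon>)
  case (base A c)
  \<comment> \<open>The summand 1 allows division also for \<open>c = 0\<close>.\<close>
  have c1: "cmod c + 1 > 0" by (simp add: add_nonneg_pos)
  then have "\<epsilon> / (cmod c + 1) > 0" using base by simp
  then obtain p where p: "trig_poly p" "(LINT \<theta>|circ. cmod (indicator A \<theta> - p \<theta>)) < \<epsilon> / (cmod c + 1)"
    using trig_approximable_indicator[OF base(1)] by blast
  have "(LINT \<theta>|circ. cmod (indicator A \<theta> *\<^sub>R c - c * p \<theta>)) = (LINT \<theta>|circ. cmod c * cmod (indicator A \<theta> - p \<theta>))"
    by (intro Bochner_Integration.integral_cong refl)
       (simp add: norm_mult[symmetric] scaleR_conv_of_real algebra_simps of_real_indicator)
  also have "\<dots> = cmod c * (LINT \<theta>|circ. cmod (indicator A \<theta> - p \<theta>))" by simp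
  also have "\<dots> \<le> cmod c * (\<epsilon> / (cmod c + 1))" using p(2) by (intro mult_left_mono) auto
  also have "\<dots> < \<epsilon>" using base c1 by (simp add: pos_divide_less_eq algebra_simps)
  finally show ?case using trig_poly_mult[OF trig_poly_const[of c] p(1)] by blast
next
  case (add f g)
  obtain p where p: "trig_poly p" "(LINT \<theta>|circ. cmod (f \<theta> - p \<theta>)) < \<epsilon> / 2" using add by (meson half_gt_zero)
  obtain q where q: "trig_poly q" "(LINT \<theta>|circ. cmod (g \<theta> - q \<theta>)) < \<epsilon> / 2" using add by (meson half_gt_zero)
  have "(LINT \<theta>|circ. cmod (f \<theta> + g \<theta> - (p \<theta> + q \<theta>))) \<le> (LINT \<theta>|circ. cmod (f \<theta> - p \<theta>) + cmod (g \<theta> - q \<theta>))"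
    using add.hyps trig_poly_integrable[OF p(1)] trig_poly_integrable[OF q(1)]
    by (intro integral_mono) (auto simp: add_diff_add norm_triangle_ineq)
  also have "\<dots> = (LINT \<theta>|circ. cmod (f \<theta> - p \<theta>)) + (LINT \<theta>|circ. cmod (g \<theta> - q \<theta>))"
    using add.hyps trig_poly_integrable[OF p(1)] trig_poly_integrable[OF q(1)] by simp
  also have "\<dots> < \<epsilon>" using p q by simp
  finally show ?case using trig_poly.add[OF p(1) q(1)] by blast
next
  case (lim f s)
  have "(\<lambda>i. LINT \<theta>|circ. cmod (f \<theta> - s i \<theta>)) \<longlonglongrightarrow> (LINT \<theta>|circ. 0)"
  \<comment> \<open>The induction rule provides \<open>s i\<close> bounded by twice the modulus of
    \<open>f\<close>, hence the factor 3 for the difference.\<close>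
  proof (rule integral_dominated_convergence[where w = "\<lambda>\<theta>. 3 * cmod (f \<theta>)"])
    show "AE \<theta> in circ. (\<lambda>i. cmod (f \<theta> - s i \<theta>)) \<longlonglongrightarrow> 0"
    proof (intro AE_I2)
      fix \<theta> assume "\<theta> \<in> space circ"
      from tendsto_norm[OF tendsto_diff[OF tendsto_const lim.hyps(2)[OF this]], of "f \<theta>"]
      show "(\<lambda>i. cmod (f \<theta> - s i \<theta>)) \<longlonglongrightarrow> 0" by simp
    qed
    show "AE \<theta> in circ. norm (cmod (f \<theta> - s i \<theta>)) \<le> 3 * cmod (f \<theta>)" for i
    proof (intro AE_I2)
      fix \<theta> assume "\<theta> \<in> space circ"
      then show "norm (cmod (f \<theta> - s i \<theta>)) \<le> 3 * cmod (f \<theta>)"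
        using lim.hyps(3)[of \<theta> i] norm_triangle_ineq4[of "f \<theta>" "s i \<theta>"] by simp
    qed
  qed (use lim.hyps(1,4) in auto)
  then have "\<forall>\<^sub>F i in sequentially. (LINT \<theta>|circ. cmod (f \<theta> - s i \<theta>)) < \<epsilon> / 2"
    using \<open>\<epsilon> > 0\<close> by (intro order_tendstoD(2)) auto
  then obtain i where i: "(LINT \<theta>|circ. cmod (f \<theta> - s i \<theta>)) < \<epsilon> / 2"
    by (auto simp: eventually_sequentially)
  obtain p where p: "trig_poly p" "(LINT \<theta>|circ. cmod (s i \<theta> - p \<theta>)) < \<epsilon> / 2"
    using lim.IH[of "\<epsilon> / 2" i] \<open>\<epsilon> > 0\<close> by auto
  have "(LINT \<theta>|circ. cmod (f \<theta> - p \<theta>)) \<le> (LINT \<theta>|circ. cmod (f \<theta> - s i \<theta>) + cmod (s i \<theta> - p \<theta>))"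
    using lim.hyps(1,4) trig_poly_integrable[OF p(1)]
    by (intro integral_mono) (auto simp: norm_diff_triangle_ineq[of "f _" _ "s i _"] intro: order_trans[OF norm_diff_triangle_le])
  also have "\<dots> = (LINT \<theta>|circ. cmod (f \<theta> - s i \<theta>)) + (LINT \<theta>|circ. cmod (s i \<theta> - p \<theta>))"
    using lim.hyps(1,4) trig_poly_integrable[OF p(1)] by simp
  also have "\<dots> < \<epsilon>" using p i by simp
  finally show ?case using p(1) by blast
qed

section \<open>Toeplitz matrices\<close>

lemma toeplitz_add_vec:
  assumes "integrable circ f" "integrable circ g" "x \<in> carrier_vec n"
  shows "toeplitz_mat (\<lambda>\<theta>. f \<theta> + g \<theta>) n *\<^sub>v x = toeplitz_mat f n *\<^sub>v x + toeplitz_mat g n *\<^sub>v x"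
proof -
  have "toeplitz_mat (\<lambda>\<theta>. f \<theta> + g \<theta>) n = toeplitz_mat f n + toeplitz_mat g n"
    by (rule eq_matI) (simp_all add: toeplitz_mat_def fourier_coeff_add assms)
  then show ?thesis by (simp add: add_mult_distrib_mat_vec[of _ n n] assms(3))
qed

lemma toeplitz_vec_carrier [simp]: "x \<in> carrier_vec n \<Longrightarrow> toeplitz_mat f n *\<^sub>v x \<in> carrier_vec n"
  by (rule mult_mat_vec_carrier[OF toeplitz_carrier])

lemma toeplitz_one: "toeplitz_mat (\<lambda>_. 1) n = 1\<^sub>m n"
  by (rule eq_matI) (simp_all add: toeplitz_mat_def fourier_coeff_one)

lemma fourier_coeff_char:
  "fourier_coeff (\<lambda>\<theta>. c * exp (\<i> * of_int m * of_real \<theta>)) k = (if k = m then c else 0)"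
  using fourier_coeff_mult_exp[of "\<lambda>_. 1" m k] by (simp add: fourier_coeff_cmult fourier_coeff_one)

lemma trig_poly_bounded:
  "trig_poly p \<Longrightarrow> \<exists>C. \<forall>\<theta>. cmod (p \<theta>) \<le> C"
proof (induction rule: trig_poly.induct)
  case (char c k)
  have "cmod (c * exp (\<i> * of_int k * of_real \<theta>)) \<le> cmod c" for \<theta>
    by (simp add: norm_mult norm_exp_eq_Re)
  then show ?case by blast
next
  case (add p q)
  then obtain C D where "\<And>\<theta>. cmod (p \<theta>) \<le> C" "\<And>\<theta>. cmod (q \<theta>) \<le> D" by blast
  then have "cmod (p \<theta> + q \<theta>) \<le> C + D" for \<theta> by (meson add_mono norm_triangle_le order_trans)
  then show ?case by blast
qed

lemma integrable_circ_mult_trig_poly: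
  assumes "integrable circ q" "trig_poly p"
  shows "integrable circ (\<lambda>\<theta>. q \<theta> * p \<theta>)"
proof -
  obtain C where "\<And>\<theta>. cmod (p \<theta>) \<le> C" using trig_poly_bounded[OF assms(2)] by blast
  then show ?thesis
    using integrable_circ_mult_bounded[OF assms(1) continuous_measurable_circ[OF trig_poly_continuous[OF assms(2)]]]
    by blast
qed

lemma codim_le_vanishing_coordinates:
  assumes "S \<subseteq> {..<n}" "real (card S) \<le> r"
  shows "codim_le n r {x. \<forall>i\<in>S. x $ i = 0}"
proof (rule codim_le_mono[OF codim_le_coordinates[of "1\<^sub>m n" n n S] assms(2)])
  show "finite S" using assms(1) finite_subset by blast
qed (use assms(1) in auto)

text \<open>For a character the second factor is a multiple of a truncated shift, and
  multiplicativity fails only through the coordinates shifted out of range. Their number depends on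
  the frequency but not on \<open>n\<close>, so the failure is negligible against any multiple of
  \<open>n\<close>.\<close>

lemma codim_le_toeplitz_mult_trig_poly:
  assumes q: "integrable circ q" and "trig_poly p"
  shows "\<exists>R. \<forall>n. codim_le n R
    {x. toeplitz_mat q n *\<^sub>v (toeplitz_mat p n *\<^sub>v x) = toeplitz_mat (\<lambda>\<theta>. q \<theta> * p \<theta>) n *\<^sub>v x}"
    (is "\<exists>R. \<forall>n. codim_le n R (?V n p)")
  using assms(2)
proof (induction rule: trig_poly.induct)
  case (char c m)
  let ?p = "\<lambda>\<theta>. c * exp (\<i> * of_int m * of_real \<theta>)"
  show ?case
  proof (intro exI allI)
    fix n :: nat
    \<comment> \<open>The indices that leave the range when shifted by \<open>m\<close>. They lie at
      one end of the range, and translating that end to 0 embeds them into the integers of modulus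
      at most \<open>\<bar>m\<bar>\<close>.\<close>
    define S where "S = {t. t < n \<and> \<not> (0 \<le> int t + m \<and> int t + m < int n)}"
    have "card S \<le> card {- \<bar>m\<bar>..\<bar>m\<bar>}"
    proof (rule card_inj_on_le[where f = "\<lambda>t. if m \<ge> 0 then int t + m - int n else int t"])
      show "inj_on (\<lambda>t. if m \<ge> 0 then int t + m - int n else int t) S" by (auto simp: inj_on_def)
    qed (auto simp: S_def)
    then have cS: "real (card S) \<le> 2 * \<bar>m\<bar> + 1" by simp
    show "codim_le n (2 * \<bar>m\<bar> + 1)
      (?V n ?p)"
    proof (rule codim_le_mono[OF codim_le_vanishing_coordinates[of S n, OF _ cS] order_refl])
      fix x :: "complex Matrix.vec" assume x: "x \<in> carrier_vec n" "x \<in> {x. \<forall>i\<in>S. x $ i = 0}"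
      have qp: "fourier_coeff (\<lambda>\<theta>. q \<theta> * ?p \<theta>) k = c * fourier_coeff q (k - m)" for k
        using fourier_coeff_mult_exp[of "\<lambda>\<theta>. c * q \<theta>" m k] fourier_coeff_cmult[of c q] by (simp add: mult_ac)
      have "(toeplitz_mat q n *\<^sub>v (toeplitz_mat ?p n *\<^sub>v x)) $ s = (toeplitz_mat (\<lambda>\<theta>. q \<theta> * ?p \<theta>) n *\<^sub>v x) $ s"
        if s: "s < n" for s
      proof -
        have "(toeplitz_mat q n *\<^sub>v (toeplitz_mat ?p n *\<^sub>v x)) $ s =
            (\<Sum>u<n. fourier_coeff q (int s - int u) * (\<Sum>t<n. (if int u - int t = m then c else 0) * x $ t))"
          by (subst index_mult_mat_vec_sum[OF toeplitz_carrier toeplitz_vec_carrier[OF x(1)] s],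
              intro sum.cong refl, subst index_mult_mat_vec_sum[OF toeplitz_carrier x(1)])
             (use s in \<open>auto simp: toeplitz_mat_def fourier_coeff_char\<close>)
        also have "\<dots> = (\<Sum>u<n. \<Sum>t<n. if u = nat (int t + m) \<and> 0 \<le> int t + m then fourier_coeff q (int s - (int t + m)) * (c * x $ t) else 0)"
          unfolding sum_distrib_left by (intro sum.cong refl) auto
        also have "\<dots> = (\<Sum>t<n. \<Sum>u<n. if u = nat (int t + m) \<and> 0 \<le> int t + m then fourier_coeff q (int s - (int t + m)) * (c * x $ t) else 0)"
          by (rule sum.swap)
        also have "\<dots> = (\<Sum>t<n. c * fourier_coeff q (int s - int t - m) * x $ t)"
        proof (intro sum.cong refl)
          fix t assume t: "t \<in> {..<n}"
          show "(\<Sum>u<n. if u = nat (int t + m) \<and> 0 \<le> int t + m then fourier_coeff q (int s - (int t + m)) * (c * x $ t) else 0)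
             = c * fourier_coeff q (int s - int t - m) * x $ t"
          proof (cases "t \<in> S")
            case True
            then have "x $ t = 0" using x by auto
            then show ?thesis by (simp cong: if_cong)
          next
            case False
            then have "0 \<le> int t + m" "nat (int t + m) < n" using t by (auto simp: S_def)
            then show ?thesis by (simp add: algebra_simps)
          qed
        qed
        also have "\<dots> = (toeplitz_mat (\<lambda>\<theta>. q \<theta> * ?p \<theta>) n *\<^sub>v x) $ s"
          by (subst index_mult_mat_vec_sum[OF toeplitz_carrier x(1) s]) (use s in \<open>simp add: toeplitz_mat_def qp\<close>)
        finally show ?thesis .
      qed
      then show "x \<in> ?V n ?p"
        by (auto intro!: eq_vecI simp del: index_mult_mat_vec simp: toeplitz_mat_def)
    qed (auto simp: S_def)
  qed
next
  case (add p p')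
  then obtain R R' where R: "\<And>n. codim_le n R (?V n p)"
    "\<And>n. codim_le n R' (?V n p')"
    by blast
  show ?case
  proof (intro exI allI, rule codim_le_mono[OF codim_le_Int[OF R] order_refl])
    fix n and x :: "complex Matrix.vec" assume x: "x \<in> carrier_vec n" "x \<in> ?V n p \<inter> ?V n p'"
    have "toeplitz_mat (\<lambda>\<theta>. q \<theta> * (p \<theta> + p' \<theta>)) n *\<^sub>v x = toeplitz_mat (\<lambda>\<theta>. q \<theta> * p \<theta>) n *\<^sub>v x + toeplitz_mat (\<lambda>\<theta>. q \<theta> * p' \<theta>) n *\<^sub>v x"
      unfolding distrib_left by (intro toeplitz_add_vec integrable_circ_mult_trig_poly q add x)
    moreover have "toeplitz_mat q n *\<^sub>v (toeplitz_mat (\<lambda>\<theta>. p \<theta> + p' \<theta>) n *\<^sub>v x) =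
       toeplitz_mat q n *\<^sub>v (toeplitz_mat p n *\<^sub>v x) + toeplitz_mat q n *\<^sub>v (toeplitz_mat p' n *\<^sub>v x)"
      by (subst toeplitz_add_vec) (auto simp: mult_add_distrib_mat_vec[OF toeplitz_carrier] trig_poly_integrable add x)
    ultimately show "x \<in> ?V n (\<lambda>\<theta>. p \<theta> + p' \<theta>)"
      using x by simp
  qed
qed

text \<open>The trace norm count with the helpful factor \<open>2 * pi\<close> given away, so that a
  codimension rate \<open>r\<close> and a bound \<open>\<eta>\<close> call only for an L^1 norm
  below their product.\<close>

lemma codim_le_toeplitz_small:
  fixes r \<eta> :: real
  assumes g: "integrable circ g" and \<eta>: "\<eta> > 0" and le: "(LINT \<theta>|circ. cmod (g \<theta>)) \<le> r * \<eta>"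
  shows "codim_le n (r * n) (norm_le (toeplitz_mat g n) \<eta>)"
proof (rule codim_le_mono[OF codim_le_toeplitz_L1[OF g \<eta>]])
  let ?I = "LINT \<theta>|circ. cmod (g \<theta>)"
  have "0 \<le> ?I" by simp
  then have "0 \<le> r * \<eta>" using le by linarith
  have "?I / (2 * pi * \<eta>) \<le> r"
  proof -
    have "?I \<le> r * \<eta>" by fact
    also have "\<dots> \<le> r * \<eta> * (2 * pi)"
      using mult_left_mono[of 1 "2 * pi" "r * \<eta>"] \<open>0 \<le> r * \<eta>\<close> pi_gt3 by simp
    finally show ?thesis using \<eta> by (simp add: field_simps)
  qed
  then show "n * ?I / (2 * pi * \<eta>) \<le> r * n"
    using mult_left_mono[of "?I / (2 * pi * \<eta>)" r "real n"] by (simp add: mult.commute)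
qed auto

lemma codim_le_toeplitz_upper:
  fixes \<epsilon> :: real
  assumes "integrable circ f" "\<epsilon> > 0"
  obtains M where "M > 0" "\<And>n. codim_le n (\<epsilon> * n) (norm_le (toeplitz_mat f n) M)"
proof -
  let ?I = "LINT \<theta>|circ. cmod (f \<theta>)"
  define M where "M = (?I + 1) / \<epsilon>"
  have I: "?I \<ge> 0" by simp
  have M: "M > 0" using I assms(2) by (simp add: M_def add_nonneg_pos)
  have "?I \<le> \<epsilon> * M" using assms(2) by (simp add: M_def)
  then show thesis
    using that[OF M] codim_le_toeplitz_small[OF assms(1) M] by blast
qed

text \<open>The sublevel sets shrink to the zero set, which is null, so their measures tend to 0.
  The measure is written as an L^1 norm because the indicator is used below as the symbol of a
  Toeplitz matrix.\<close>

lemma small_sublevel_sparsely_vanishing: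
  assumes f: "integrable circ f" and sv: "sparsely_vanishing_on {-pi..pi} f" and "\<epsilon> > 0"
  obtains \<delta> where "\<delta> > 0" "(LINT \<theta>|circ. cmod (if cmod (f \<theta>) \<le> \<delta> then 1 else 0)) < \<epsilon>"
proof -
  have [measurable]: "f \<in> borel_measurable circ" using f by simp
  have "(\<lambda>i. LINT \<theta>|circ. (if cmod (f \<theta>) \<le> 1 / Suc i then 1 else 0)) \<longlonglongrightarrow> (LINT \<theta>|circ. (0 :: real))"
  proof (rule integral_dominated_convergence[where w = "\<lambda>_. 1"])
    have "{\<theta> \<in> space circ. f \<theta> = 0} \<in> null_sets circ"
      using sv unfolding sparsely_vanishing_on_def
      by (subst null_sets_restrict_space) auto
    then have "AE \<theta> in circ. f \<theta> \<noteq> 0"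
      by (rule AE_I') auto
    then show "AE \<theta> in circ. (\<lambda>i. if cmod (f \<theta>) \<le> 1 / Suc i then 1 else 0) \<longlonglongrightarrow> (0 :: real)"
    proof eventually_elim
      case (elim \<theta>)
      have "(\<lambda>i. 1 / real (Suc i)) \<longlonglongrightarrow> 0"
        using LIMSEQ_inverse_real_of_nat by (simp add: inverse_eq_divide)
      then have "\<forall>\<^sub>F i in sequentially. 1 / real (Suc i) < cmod (f \<theta>)"
        using elim by (intro order_tendstoD(2)) auto
      then have "\<forall>\<^sub>F i in sequentially. (if cmod (f \<theta>) \<le> 1 / Suc i then 1 else 0) = (0 :: real)"
        by eventually_elim auto
      then show ?case by (rule tendsto_eventually)
    qed
  qed auto
  then have "\<forall>\<^sub>F i in sequentially. (LINT \<theta>|circ. (if cmod (f \<theta>) \<le> 1 / Suc i then 1 else 0)) < \<epsilon>"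
    using \<open>\<epsilon> > 0\<close> by (intro order_tendstoD(2)) auto
  then obtain i where "(LINT \<theta>|circ. (if cmod (f \<theta>) \<le> 1 / Suc i then 1 else 0)) < \<epsilon>"
    by (auto simp: eventually_sequentially)
  moreover have "cmod (if cmod (f \<theta>) \<le> 1 / Suc i then 1 else 0) = (if cmod (f \<theta>) \<le> 1 / Suc i then 1 else 0)" for \<theta>
    by simp
  ultimately show thesis by (intro that[of "1 / Suc i"]) (simp_all only:, simp)
qed

text \<open>A truncated reciprocal \<open>q\<close> of \<open>f\<close> satisfies \<open>1 = low + q f\<close> with \<open>low\<close> small in \<open>L\<^sup>1\<close>, and
  \<open>T\<^sub>n[q] T\<^sub>n[f]\<close> differs from \<open>T\<^sub>n[q f]\<close> negligibly, so \<open>T\<^sub>n[q]\<close> is almost a left inverse of \<open>T\<^sub>n[f]\<close>.\<close>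

theorem codim_le_toeplitz_lower:
  fixes \<epsilon> :: real
  assumes f: "integrable circ f" and sv: "sparsely_vanishing_on {-pi..pi} f" and \<epsilon>: "\<epsilon> > 0"
  obtains \<delta> N where "\<delta> > 0"
    "\<And>n. n \<ge> N \<Longrightarrow> codim_le n (\<epsilon> * n) (norm_ge (toeplitz_mat f n) \<delta>)"
proof -
  obtain \<delta>1 where \<delta>1: "\<delta>1 > 0" and chi: "(LINT \<theta>|circ. cmod (if cmod (f \<theta>) \<le> \<delta>1 then 1 else 0)) < \<epsilon> / 20"
    using small_sublevel_sparsely_vanishing[OF f sv, of "\<epsilon> / 20"] \<epsilon> by auto
  have [measurable]: "f \<in> borel_measurable circ" using f by simp
  define low where "low \<theta> = (if cmod (f \<theta>) \<le> \<delta>1 then 1 else 0 :: complex)" for \<theta>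
  define q where "q \<theta> = (if cmod (f \<theta>) \<le> \<delta>1 then 0 else 1 / f \<theta>)" for \<theta>
  have q_le: "cmod (q \<theta>) \<le> 1 / \<delta>1" for \<theta>
    using \<delta>1 by (auto simp: q_def norm_divide frac_le)
  have qm: "q \<in> borel_measurable circ" unfolding q_def by measurable
  have low_m: "low \<in> borel_measurable circ" unfolding low_def by measurable
  have low_le: "cmod (low \<theta>) \<le> 1" for \<theta> by (simp add: low_def)
  have low_int: "integrable circ low"
    using integrable_circ_mult_bounded[of "\<lambda>_. 1", OF _ low_m low_le] by simp
  have q_int: "integrable circ q"
    using integrable_circ_mult_bounded[of "\<lambda>_. 1" q, OF _ qm q_le] by simp
  have mult_q: "integrable circ (\<lambda>\<theta>. q \<theta> * g \<theta>)" if "integrable circ g" for g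
    using integrable_circ_mult_bounded[OF that qm q_le] by (simp add: mult.commute)
  have one: "low \<theta> + q \<theta> * f \<theta> = 1" for \<theta>
    using \<delta>1 by (auto simp: low_def q_def)
  define I where "I = (LINT \<theta>|circ. cmod (q \<theta>))"
  have I: "I \<ge> 0" by (simp add: I_def)
  \<comment> \<open>Chosen so that \<open>I\<close> is at most \<open>\<epsilon> / 10 * K\<close>:
    the Toeplitz matrix of \<open>q\<close> is then bounded by \<open>K\<close> off codimension
    \<open>\<epsilon> / 10 * n\<close>.\<close>
  define K where "K = (I + 1) * 10 / \<epsilon>"
  have K: "K > 0" using I \<epsilon> by (simp add: K_def add_nonneg_pos)
  \<comment> \<open>Small enough for both occurrences of the remainder \<open>g\<close>:
    \<open>\<epsilon>2\<close> is at most \<open>\<epsilon> / 5 * (1 / (8 * K))\<close>, and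
    \<open>\<epsilon>2 / \<delta>1\<close> is at most
    \<open>\<epsilon> / 5 * (1 / 8)\<close>.\<close>
  define \<epsilon>2 where "\<epsilon>2 = \<epsilon> / (40 * (K + 1 / \<delta>1))"
  have K1: "K + 1 / \<delta>1 > 0" using K \<delta>1 by (simp add: add_pos_pos)
  have \<epsilon>2: "\<epsilon>2 > 0" using \<epsilon> K1 by (simp add: \<epsilon>2_def)
  have \<epsilon>2_eq: "40 * (K * \<epsilon>2) + 40 * (\<epsilon>2 / \<delta>1) = \<epsilon>"
  proof -
    have "40 * (K + 1 / \<delta>1) * \<epsilon>2 = \<epsilon>" using K1 by (simp add: \<epsilon>2_def)
    then show ?thesis by (simp add: algebra_simps)
  qed
  obtain p where p: "trig_poly p" and fp: "(LINT \<theta>|circ. cmod (f \<theta> - p \<theta>)) < \<epsilon>2"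
    using trig_poly_dense_L1[OF f \<epsilon>2] by blast
  define g where "g \<theta> = f \<theta> - p \<theta>" for \<theta>
  have g_int: "integrable circ g" unfolding g_def using f trig_poly_integrable[OF p] by simp
  have p_int: "integrable circ p" using trig_poly_integrable[OF p] .
  have gI: "(LINT \<theta>|circ. cmod (g \<theta>)) < \<epsilon>2" using fp by (simp add: g_def)
  have qg: "(LINT \<theta>|circ. cmod (q \<theta> * g \<theta>)) \<le> \<epsilon>2 / \<delta>1"
  proof -
    have "(LINT \<theta>|circ. cmod (q \<theta> * g \<theta>)) \<le> (LINT \<theta>|circ. 1 / \<delta>1 * cmod (g \<theta>))"
      using g_int integrable_norm[OF mult_q[OF g_int]] q_le
      by (intro integral_mono) (auto simp: norm_mult simp del: times_divide_eq_left intro!: mult_right_mono)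
    also have "\<dots> = 1 / \<delta>1 * (LINT \<theta>|circ. cmod (g \<theta>))" by simp
    also have "\<dots> \<le> 1 / \<delta>1 * \<epsilon>2" using gI \<delta>1 by (intro mult_left_mono) auto
    finally show ?thesis by simp
  qed
  obtain R where R: "\<And>n. codim_le n R
    {x. toeplitz_mat q n *\<^sub>v (toeplitz_mat p n *\<^sub>v x) = toeplitz_mat (\<lambda>\<theta>. q \<theta> * p \<theta>) n *\<^sub>v x}"
    using codim_le_toeplitz_mult_trig_poly[OF q_int p] by blast
  define N where "N = nat \<lceil>5 * R / \<epsilon>\<rceil>"
  have main: "codim_le n (\<epsilon> * n) (norm_ge (toeplitz_mat f n) (1 / (2 * K)))" if n: "n \<ge> N" for n
  proof -
    let ?T = "\<lambda>h. toeplitz_mat h n"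
    have Rn: "R \<le> \<epsilon> / 5 * n"
    proof -
      have "5 * R / \<epsilon> \<le> n" using n unfolding N_def by linarith
      then show ?thesis using \<epsilon> by (simp add: field_simps)
    qed
    have c1: "codim_le n (\<epsilon> / 5 * n) (norm_le (?T low) (1 / 4))"
      by (rule codim_le_toeplitz_small[OF low_int]) (use chi in \<open>simp_all add: low_def\<close>)
    have "40 * (\<epsilon>2 / \<delta>1) \<le> \<epsilon>" using \<epsilon>2_eq mult_pos_pos[OF K \<epsilon>2] by linarith
    then have c2: "codim_le n (\<epsilon> / 5 * n) (norm_le (?T (\<lambda>\<theta>. q \<theta> * g \<theta>)) (1 / 8))"
      using qg by (intro codim_le_toeplitz_small[OF mult_q[OF g_int]]) simp_all
    have c3: "codim_le n (\<epsilon> / 10 * n) (norm_le (?T q) K)"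
      by (rule codim_le_toeplitz_small[OF q_int K]) (use \<epsilon> in \<open>simp add: K_def I_def[symmetric]\<close>)
    have "40 * (K * \<epsilon>2) \<le> \<epsilon>" using \<epsilon>2_eq divide_pos_pos[OF \<epsilon>2 \<delta>1] by linarith
    then have "\<epsilon>2 \<le> \<epsilon> / 5 * (1 / (8 * K))" using K by (simp add: field_simps)
    then have c4: "codim_le n (\<epsilon> / 5 * n) (norm_le (?T g) (1 / (8 * K)))"
      using gI K by (intro codim_le_toeplitz_small[OF g_int]) simp_all
    have c5: "codim_le n (\<epsilon> / 5 * n) {x. ?T q *\<^sub>v (?T p *\<^sub>v x) = ?T (\<lambda>\<theta>. q \<theta> * p \<theta>) *\<^sub>v x}"
      using R Rn by (rule codim_le_mono)
    \<comment> \<open>The bound \<open>K\<close> is used at two vectors, the images of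
      \<open>x\<close> under the matrices of \<open>f\<close> and of \<open>g\<close>, hence the two
      preimages at rate \<open>\<epsilon> / 10\<close>. With four conditions at rate
      \<open>\<epsilon> / 5\<close> the total is exactly \<open>\<epsilon> * n\<close>.\<close>
    note c = codim_le_Int[OF codim_le_Int[OF codim_le_Int[OF c1 c2]
        codim_le_Int[OF codim_le_preimage[OF toeplitz_carrier[of f] c3] codim_le_preimage[OF toeplitz_carrier[of g] c3]]]
        codim_le_Int[OF c4 c5]]
    show ?thesis
    proof (rule codim_le_mono[OF c])
      show "\<epsilon> / 5 * n + \<epsilon> / 5 * n + (\<epsilon> / 10 * n + \<epsilon> / 10 * n) + (\<epsilon> / 5 * n + \<epsilon> / 5 * n) \<le> \<epsilon> * n"
        by simp
      fix x :: "complex Matrix.vec" assume x: "x \<in> carrier_vec n" and xx: "x \<in> norm_le (?T low) (1 / 4) \<inter>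
         norm_le (?T (\<lambda>\<theta>. q \<theta> * g \<theta>)) (1 / 8) \<inter>
         ({x. ?T f *\<^sub>v x \<in> norm_le (?T q) K} \<inter> {x. ?T g *\<^sub>v x \<in> norm_le (?T q) K}) \<inter>
         (norm_le (?T g) (1 / (8 * K)) \<inter> {x. ?T q *\<^sub>v (?T p *\<^sub>v x) = ?T (\<lambda>\<theta>. q \<theta> * p \<theta>) *\<^sub>v x})"
      let ?a = "?T low *\<^sub>v x" and ?b = "?T q *\<^sub>v (?T p *\<^sub>v x)" and ?c = "?T (\<lambda>\<theta>. q \<theta> * g \<theta>) *\<^sub>v x"
        and ?d = "?T q *\<^sub>v (?T g *\<^sub>v x)"
      have "x = ?T (\<lambda>\<theta>. low \<theta> + q \<theta> * f \<theta>) *\<^sub>v x"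
        unfolding one toeplitz_one using x by simp
      also have "\<dots> = ?a + ?T (\<lambda>\<theta>. q \<theta> * f \<theta>) *\<^sub>v x"
        by (rule toeplitz_add_vec[OF low_int mult_q[OF f] x])
      also have "(\<lambda>\<theta>. q \<theta> * f \<theta>) = (\<lambda>\<theta>. q \<theta> * p \<theta> + q \<theta> * g \<theta>)"
        by (simp add: g_def algebra_simps)
      also have "?T (\<lambda>\<theta>. q \<theta> * p \<theta> + q \<theta> * g \<theta>) *\<^sub>v x = ?b + ?c"
        using toeplitz_add_vec[OF mult_q[OF p_int] mult_q[OF g_int] x] xx by simp
      finally have x_eq: "x = ?a + (?b + ?c)" .
      have "f = (\<lambda>\<theta>. p \<theta> + g \<theta>)" by (simp add: g_def)
      then have "?T f *\<^sub>v x = ?T p *\<^sub>v x + ?T g *\<^sub>v x"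
        using toeplitz_add_vec[OF p_int g_int x] by simp
      then have Tf: "?T q *\<^sub>v (?T f *\<^sub>v x) = ?b + ?d"
        using x by (simp add: mult_add_distrib_mat_vec[OF toeplitz_carrier])
      have b_eq: "?b = ?T q *\<^sub>v (?T f *\<^sub>v x) + (- 1) \<cdot>\<^sub>v ?d"
        unfolding Tf by (rule eq_vecI) (auto simp: toeplitz_mat_def simp del: index_mult_mat_vec)
      \<comment> \<open>The errors \<open>?a\<close>, \<open>?c\<close> and \<open>?d\<close> take
        up at most 1/4, 1/8 and 1/8 of \<open>vnorm x\<close>. Half of it remains to be carried by
        \<open>?T q *\<^sub>v (?T f *\<^sub>v x)\<close>.\<close>
      have "vnorm x \<le> vnorm ?a + (vnorm ?b + vnorm ?c)"
      proof -
        have "vnorm x = vnorm (?a + (?b + ?c))" using x_eq by simp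
        also have "\<dots> \<le> vnorm ?a + vnorm (?b + ?c)" using x by (intro vnorm_add_le[of _ n]) auto
        also have "vnorm (?b + ?c) \<le> vnorm ?b + vnorm ?c" using x by (intro vnorm_add_le[of _ n]) auto
        finally show ?thesis by simp
      qed
      moreover have "vnorm ?b \<le> vnorm (?T q *\<^sub>v (?T f *\<^sub>v x)) + vnorm ?d"
      proof -
        have "vnorm ?b \<le> vnorm (?T q *\<^sub>v (?T f *\<^sub>v x)) + vnorm ((- 1) \<cdot>\<^sub>v ?d)"
          by (subst b_eq, rule vnorm_add_le[of _ n]) (use x in auto)
        then show ?thesis by (simp add: vnorm_smult)
      qed
      moreover have "vnorm ?d \<le> 1 / 8 * vnorm x"
      proof -
        have "vnorm ?d \<le> K * vnorm (?T g *\<^sub>v x)" using xx by simp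
        also have "\<dots> \<le> K * (1 / (8 * K) * vnorm x)" using xx K by (intro mult_left_mono) auto
        finally show ?thesis using K by simp
      qed
      moreover have "vnorm ?a \<le> 1 / 4 * vnorm x" "vnorm ?c \<le> 1 / 8 * vnorm x"
        "vnorm (?T q *\<^sub>v (?T f *\<^sub>v x)) \<le> K * vnorm (?T f *\<^sub>v x)" using xx by auto
      ultimately have "1 / 2 * vnorm x \<le> K * vnorm (?T f *\<^sub>v x)" by simp
      then show "x \<in> norm_ge (?T f) (1 / (2 * K))" using K by (simp add: field_simps)
    qed
  qed
  show thesis by (rule that[of "1 / (2 * K)" N]) (use K main in auto)
qed

section \<open>The flip, the block sign matrix and the diagonal blocks\<close>

lemma flip_carrier [simp]: "flip_mat n \<in> carrier_mat n n"
  by (simp add: flip_mat_def)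

lemma flip_vec_carrier [simp]: "x \<in> carrier_vec n \<Longrightarrow> flip_mat n *\<^sub>v x \<in> carrier_vec n"
  by (rule mult_mat_vec_carrier[OF flip_carrier])

lemma flip_index:
  assumes "x \<in> carrier_vec n" "s < n"
  shows "(flip_mat n *\<^sub>v x) $ s = x $ (n - 1 - s)"
proof -
  have "(flip_mat n *\<^sub>v x) $ s = (\<Sum>t<n. (if s + 1 + (t + 1) = n + 1 then 1 else 0) * x $ t)"
    using assms by (subst index_mult_mat_vec_sum[OF flip_carrier]) (auto simp: flip_mat_def)
  also have "\<dots> = (\<Sum>t<n. if t = n - 1 - s then x $ t else 0)"
    using assms(2) by (intro sum.cong refl) auto
  finally show ?thesis using assms(2) by simp
qed

lemma vnorm_flip [simp]:
  assumes "x \<in> carrier_vec n" shows "vnorm (flip_mat n *\<^sub>v x) = vnorm x"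
proof -
  have "(vnorm (flip_mat n *\<^sub>v x))\<^sup>2 = (\<Sum>s<n. (cmod (x $ (n - Suc s)))\<^sup>2)"
    unfolding vnorm_sq using assms by (intro sum.cong) (auto simp: flip_index simp del: index_mult_mat_vec simp: flip_mat_def[THEN arg_cong, of dim_row])
  also have "\<dots> = (vnorm x)\<^sup>2"
    using assms sum.nat_diff_reindex[of "\<lambda>s. (cmod (x $ s))\<^sup>2" n] by (simp add: vnorm_sq)
  finally show ?thesis by (simp add: power2_eq_iff_nonneg)
qed

text \<open>The matrix J of the two half blocks. For odd \<open>n\<close> the middle index belongs
  to the positive block.\<close>

definition sign_mat :: "nat \<Rightarrow> complex mat" where
  "sign_mat n = diag_of n (\<lambda>s. if 2 * s < n then 1 else - 1)"

lemma sign_carrier [simp]: "sign_mat n \<in> carrier_mat n n"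
  by (simp add: sign_mat_def)

lemma sign_vec_carrier [simp]: "x \<in> carrier_vec n \<Longrightarrow> sign_mat n *\<^sub>v x \<in> carrier_vec n"
  by (rule mult_mat_vec_carrier[OF sign_carrier])

lemma sign_index:
  "x \<in> carrier_vec n \<Longrightarrow> s < n \<Longrightarrow> (sign_mat n *\<^sub>v x) $ s = (if 2 * s < n then x $ s else - x $ s)"
  by (simp add: sign_mat_def diag_of_mult_vec del: index_mult_mat_vec)

lemma vnorm_sign [simp]: "x \<in> carrier_vec n \<Longrightarrow> vnorm (sign_mat n *\<^sub>v x) = vnorm x"
  by (rule vnorm_cong) (auto simp: sign_mat_def diag_of_mult_vec simp del: index_mult_mat_vec dim_mult_mat_vec)

text \<open>This is (H + J H J) x for the flipped Toeplitz matrix H. Conjugation by J keeps the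
  diagonal blocks and negates the others, so the sum is twice the block diagonal part of H.\<close>

definition flip_defect :: "(real \<Rightarrow> complex) \<Rightarrow> nat \<Rightarrow> complex vec \<Rightarrow> complex vec" where
  "flip_defect f n x = flip_mat n *\<^sub>v (toeplitz_mat f n *\<^sub>v x) +
     sign_mat n *\<^sub>v (flip_mat n *\<^sub>v (toeplitz_mat f n *\<^sub>v (sign_mat n *\<^sub>v x)))"

lemma flip_defect_carrier [simp]: "x \<in> carrier_vec n \<Longrightarrow> flip_defect f n x \<in> carrier_vec n"
  by (simp add: flip_defect_def)

lemma flip_defect_index:
  assumes x: "x \<in> carrier_vec n" and s: "s < n"
  shows "flip_defect f n x $ s =
    (\<Sum>t<n. if (2 * s < n) = (2 * t < n) then 2 * fourier_coeff f (int n - 1 - int s - int t) * x $ t else 0)"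
proof -
  have i: "int (n - Suc s) = int n - 1 - int s" using s by auto
  have T: "(toeplitz_mat f n *\<^sub>v y) $ (n - Suc s) = (\<Sum>t<n. fourier_coeff f (int n - 1 - int s - int t) * y $ t)"
    if "y \<in> carrier_vec n" for y
    by (subst index_mult_mat_vec_sum[OF toeplitz_carrier that])
       (use s in \<open>auto simp: toeplitz_mat_def i simp del: of_nat_diff\<close>)
  have "flip_defect f n x $ s = (\<Sum>t<n. fourier_coeff f (int n - 1 - int s - int t) * x $ t) +
     (if 2 * s < n then 1 else - 1) * (\<Sum>t<n. fourier_coeff f (int n - 1 - int s - int t) * (if 2 * t < n then x $ t else - x $ t))"
    using x s unfolding flip_defect_def
    by (subst index_add_vec) (auto simp: sign_index flip_index T simp del: index_mult_mat_vec simp: carrier_matD[OF sign_carrier])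
  also have "\<dots> = (\<Sum>t<n. if (2 * s < n) = (2 * t < n) then 2 * fourier_coeff f (int n - 1 - int s - int t) * x $ t else 0)"
    unfolding sum_distrib_left sum.distrib[symmetric] by (intro sum.cong refl) auto
  finally show ?thesis .
qed

lemma flip_defect_add:
  assumes "integrable circ f" "integrable circ g" "x \<in> carrier_vec n"
  shows "flip_defect (\<lambda>\<theta>. f \<theta> + g \<theta>) n x = flip_defect f n x + flip_defect g n x"
proof (rule eq_vecI)
  fix s assume "s < dim_vec (flip_defect f n x + flip_defect g n x)"
  then have s: "s < n" "s < dim_vec (flip_defect g n x)"
    using flip_defect_carrier[OF assms(3), of g] by auto
  show "flip_defect (\<lambda>\<theta>. f \<theta> + g \<theta>) n x $ s = (flip_defect f n x + flip_defect g n x) $ s"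
    unfolding index_add_vec(1)[OF s(2)] flip_defect_index[OF assms(3) s(1)] sum.distrib[symmetric]
    by (intro sum.cong refl) (simp add: fourier_coeff_add[OF assms(1,2)] algebra_simps)
next
  show "dim_vec (flip_defect (\<lambda>\<theta>. f \<theta> + g \<theta>) n x) = dim_vec (flip_defect f n x + flip_defect g n x)"
    using flip_defect_carrier[OF assms(3)] by (metis carrier_vecD index_add_vec(2))
qed

text \<open>Up to finite rank, the flipped Toeplitz matrix of a trigonometric polynomial has no entries in
  the two diagonal blocks.\<close>

lemma codim_le_flip_defect_trig_poly:
  assumes "trig_poly p"
  shows "\<exists>R. \<forall>n. codim_le n R {x. flip_defect p n x = 0\<^sub>v n}"
  using assms
proof (induction rule: trig_poly.induct)
  case (char c m)
  let ?p = "\<lambda>\<theta>. c * exp (\<i> * of_int m * of_real \<theta>)"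
  show ?case
  proof (intro exI allI)
    fix n :: nat
    \<comment> \<open>For a single frequency the flipped matrix lives on the antidiagonal where
      \<open>s + t\<close> equals \<open>n - 1 - m\<close>. It meets the diagonal blocks only in
      columns near the middle, all of which are collected in \<open>S\<close>.\<close>
    define S where "S = {t. t < n \<and> \<bar>2 * int t - int n\<bar> \<le> 2 * \<bar>m\<bar> + 2}"
    have "card S \<le> card {- (2 * \<bar>m\<bar> + 2)..2 * \<bar>m\<bar> + 2}"
      by (rule card_inj_on_le[where f = "\<lambda>t. 2 * int t - int n"]) (auto simp: S_def inj_on_def)
    then have cS: "real (card S) \<le> 4 * \<bar>m\<bar> + 5" by simp
    show "codim_le n (4 * \<bar>m\<bar> + 5) {x. flip_defect ?p n x = 0\<^sub>v n}"
    proof (rule codim_le_mono[OF codim_le_vanishing_coordinates[of S n, OF _ cS] order_refl])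
      fix x :: "complex Matrix.vec" assume x: "x \<in> carrier_vec n" "x \<in> {x. \<forall>i\<in>S. x $ i = 0}"
      have "flip_defect ?p n x $ s = 0" if s: "s < n" for s
        unfolding flip_defect_index[OF x(1) s]
      proof (rule sum.neutral, rule ballI)
        fix t assume t: "t \<in> {..<n}"
        have "x $ t = 0" if "(2 * s < n) = (2 * t < n)" "int n - 1 - int s - int t = m"
        proof -
          have "t \<in> S" using that t s unfolding S_def by (cases "2 * t < n") auto
          then show ?thesis using x by auto
        qed
        then show "(if (2 * s < n) = (2 * t < n) then 2 * fourier_coeff ?p (int n - 1 - int s - int t) * x $ t else 0) = 0"
          by (auto simp: fourier_coeff_char)
      qed
      then show "x \<in> {x. flip_defect ?p n x = 0\<^sub>v n}"
        using flip_defect_carrier[OF x(1)] by (auto intro!: eq_vecI)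
    qed (auto simp: S_def)
  qed
next
  case (add p q)
  then obtain R R' where R: "\<And>n. codim_le n R {x. flip_defect p n x = 0\<^sub>v n}" "\<And>n. codim_le n R' {x. flip_defect q n x = 0\<^sub>v n}"
    by blast
  show ?case
    by (intro exI allI, rule codim_le_mono[OF codim_le_Int[OF R] order_refl])
       (auto simp: flip_defect_add trig_poly_integrable add)
qed

text \<open>Density splits \<open>f\<close> into a trigonometric polynomial and a remainder
  \<open>g\<close> of L^1 norm below \<open>(\<epsilon> / 3) * (\<eta> / 2)\<close>. The defect of
  \<open>g\<close> involves its Toeplitz matrix at \<open>x\<close> and at the sign-changed
  \<open>x\<close>, each bounded by \<open>\<eta> / 2\<close> at rate \<open>\<epsilon> / 3\<close>;
  the last third absorbs the constant codimension of the polynomial once \<open>n\<close> is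
  large.\<close>

lemma codim_le_flip_defect:
  fixes \<epsilon> \<eta> :: real
  assumes f: "integrable circ f" and \<epsilon>: "\<epsilon> > 0" and \<eta>: "\<eta> > 0"
  obtains N where "\<And>n. n \<ge> N \<Longrightarrow> codim_le n (\<epsilon> * n) {x. vnorm (flip_defect f n x) \<le> \<eta> * vnorm x}"
proof -
  have "\<epsilon> * \<eta> / 6 > 0" using \<epsilon> \<eta> by simp
  then obtain p where p: "trig_poly p" and fp: "(LINT \<theta>|circ. cmod (f \<theta> - p \<theta>)) < \<epsilon> * \<eta> / 6"
    using trig_poly_dense_L1[OF f] by blast
  define g where "g \<theta> = f \<theta> - p \<theta>" for \<theta>
  have p_int: "integrable circ p" using trig_poly_integrable[OF p] .
  have g_int: "integrable circ g" unfolding g_def using f p_int by simp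
  obtain R where R: "\<And>n. codim_le n R {x. flip_defect p n x = 0\<^sub>v n}"
    using codim_le_flip_defect_trig_poly[OF p] by blast
  define N where "N = nat \<lceil>3 * R / \<epsilon>\<rceil>"
  have "codim_le n (\<epsilon> * n) {x. vnorm (flip_defect f n x) \<le> \<eta> * vnorm x}" if n: "n \<ge> N" for n
  proof -
    let ?V = "norm_le (toeplitz_mat g n) (\<eta> / 2)"
    have Rn: "R \<le> \<epsilon> / 3 * n"
    proof -
      have "3 * R / \<epsilon> \<le> n" using n unfolding N_def by linarith
      then show ?thesis using \<epsilon> by (simp add: field_simps)
    qed
    have V: "codim_le n (\<epsilon> / 3 * n) ?V"
      by (rule codim_le_toeplitz_small[OF g_int]) (use \<eta> fp in \<open>simp_all add: g_def\<close>)
    show ?thesis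
    proof (rule codim_le_mono[OF codim_le_Int[OF R codim_le_Int[OF V codim_le_preimage[OF sign_carrier V]]]])
      show "R + (\<epsilon> / 3 * n + \<epsilon> / 3 * n) \<le> \<epsilon> * n" using Rn by simp
      fix x :: "complex Matrix.vec" assume x: "x \<in> carrier_vec n" and xx: "x \<in> {x. flip_defect p n x = 0\<^sub>v n} \<inter> (?V \<inter> {x. sign_mat n *\<^sub>v x \<in> ?V})"
      have "f = (\<lambda>\<theta>. p \<theta> + g \<theta>)" by (simp add: g_def)
      then have "flip_defect f n x = flip_defect p n x + flip_defect g n x"
        using flip_defect_add[OF p_int g_int x] by simp
      then have "vnorm (flip_defect f n x) = vnorm (flip_defect g n x)"
        using xx x by simp
      also have "\<dots> \<le> vnorm (toeplitz_mat g n *\<^sub>v x) + vnorm (toeplitz_mat g n *\<^sub>v (sign_mat n *\<^sub>v x))"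
        unfolding flip_defect_def by (rule order_trans[OF vnorm_add_le[of _ n]]) (use x in auto)
      also have "\<dots> \<le> \<eta> * vnorm x" using xx x by simp
      finally show "x \<in> {x. vnorm (flip_defect f n x) \<le> \<eta> * vnorm x}" by simp
    qed
  qed
  then show thesis by (rule that)
qed

section \<open>Circulant preconditioners and powers\<close>

definition unitary_diag :: "nat \<Rightarrow> complex mat \<Rightarrow> (nat \<Rightarrow> complex) \<Rightarrow> complex mat" where
  "unitary_diag n U a = U * diag_of n a * mat_adjoint U"

lemma unitary_diag_carrier [simp]: "U \<in> carrier_mat n n \<Longrightarrow> unitary_diag n U a \<in> carrier_mat n n"
  unfolding unitary_diag_def by (meson diag_of_carrier mat_adjoint_carrier mult_carrier_mat)

lemma unitary_diag_mult:
  assumes U: "U \<in> carrier_mat n n" "mat_adjoint U * U = 1\<^sub>m n"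
  shows "unitary_diag n U a * unitary_diag n U b = unitary_diag n U (\<lambda>i. a i * b i)"
proof -
  have Ua: "mat_adjoint U \<in> carrier_mat n n" using U by blast
  have D: "diag_of n a * diag_of n b = diag_of n (\<lambda>i. a i * b i)" by (rule diag_of_mult_diag_of)
  have "unitary_diag n U a * unitary_diag n U b = U * (diag_of n a * ((mat_adjoint U * U) * (diag_of n b * mat_adjoint U)))"
    unfolding unitary_diag_def using U(1) Ua
    by (simp add: assoc_mult_mat[of _ n n _ n _ n] mult_carrier_mat[of _ n n _ n])
  also have "\<dots> = U * (diag_of n a * diag_of n b) * mat_adjoint U"
    using U Ua by (simp add: assoc_mult_mat[of _ n n _ n _ n] mult_carrier_mat[of _ n n _ n] left_mult_one_mat[of _ n n])
  finally show ?thesis unfolding D unitary_diag_def .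
qed

lemma unitary_diag_one:
  assumes "U \<in> carrier_mat n n" "U * mat_adjoint U = 1\<^sub>m n" "\<And>i. i < n \<Longrightarrow> a i = 1"
  shows "unitary_diag n U a = 1\<^sub>m n"
proof -
  have "diag_of n a = 1\<^sub>m n" using assms(3) by (auto simp: diag_of_def intro!: eq_matI)
  then show ?thesis using assms(1,2) by (simp add: unitary_diag_def)
qed

lemma mat_adjoint_unitary_diag:
  assumes U: "U \<in> carrier_mat n n"
  shows "mat_adjoint (unitary_diag n U a) = unitary_diag n U (\<lambda>i. cnj (a i))"
proof -
  have Ua: "mat_adjoint U \<in> carrier_mat n n" using U by blast
  have UD: "U * diag_of n a \<in> carrier_mat n n" using U by auto
  show ?thesis
    unfolding unitary_diag_def mat_adjoint_mult[OF UD Ua] mat_adjoint_mult[OF U diag_of_carrier] adjoint_diag_of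
    using U Ua by (simp add: assoc_mult_mat[of _ n n _ n _ n] mult_carrier_mat[of _ n n _ n])
qed

lemma adjoint_unitary_diag_mult_vec:
  assumes U: "U \<in> carrier_mat n n" "mat_adjoint U * U = 1\<^sub>m n" and x: "x \<in> carrier_vec n" and i: "i < n"
  shows "(mat_adjoint U *\<^sub>v (unitary_diag n U a *\<^sub>v x)) $ i = a i * (mat_adjoint U *\<^sub>v x) $ i"
proof -
  have Ua: "mat_adjoint U \<in> carrier_mat n n" using U by blast
  have y: "mat_adjoint U *\<^sub>v x \<in> carrier_vec n" using mult_mat_vec_carrier[OF Ua x] .
  have D: "diag_of n a *\<^sub>v (mat_adjoint U *\<^sub>v x) \<in> carrier_vec n" using mult_mat_vec_carrier[OF diag_of_carrier y] .
  have "unitary_diag n U a *\<^sub>v x = U *\<^sub>v (diag_of n a *\<^sub>v (mat_adjoint U *\<^sub>v x))"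
    unfolding unitary_diag_def using U(1) Ua x y
    by (simp add: assoc_mult_mat_vec[of _ n n _ n] assoc_mult_mat_vec[OF U(1) diag_of_carrier y])
  then have "mat_adjoint U *\<^sub>v (unitary_diag n U a *\<^sub>v x) = diag_of n a *\<^sub>v (mat_adjoint U *\<^sub>v x)"
    using assoc_mult_mat_vec[OF Ua U(1) D] U(2) D by simp
  then show ?thesis using i by (simp add: diag_of_mult_vec[OF y] del: index_mult_mat_vec)
qed

lemma vnorm_unitary_diag_mult_vec:
  assumes U: "U \<in> carrier_mat n n" "mat_adjoint U * U = 1\<^sub>m n" "U * mat_adjoint U = 1\<^sub>m n" and x: "x \<in> carrier_vec n"
  shows "(vnorm (unitary_diag n U a *\<^sub>v x))\<^sup>2 = (\<Sum>i<n. (cmod (a i))\<^sup>2 * sq_coord (mat_adjoint U) x i)"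
  unfolding vnorm_sq_coordinates[OF U(1,3) mult_mat_vec_carrier[OF unitary_diag_carrier[OF U(1)] x]]
  by (intro sum.cong refl)
     (simp add: adjoint_unitary_diag_mult_vec[OF U(1,2) x] norm_mult power_mult_distrib del: index_mult_mat_vec)

lemma inv_mat_eqI:
  assumes "A \<in> carrier_mat n n" "B \<in> carrier_mat n n" "A * B = 1\<^sub>m n" "B * A = 1\<^sub>m n"
  shows "inv_mat A = B"
proof (cases "mat_inverse A")
  case None
  then have "A \<notin> Units (ring_mat TYPE(complex) n ())" by (rule mat_inverse(1)[OF assms(1)])
  moreover have "A \<in> Units (ring_mat TYPE(complex) n ())"
    unfolding Units_def ring_mat_def using assms by auto
  ultimately show ?thesis by simp
next
  case (Some B')
  have B': "A * B' = 1\<^sub>m n" "B' \<in> carrier_mat n n" using mat_inverse(2)[OF assms(1) Some] by auto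
  have "B' = (B * A) * B'" using assms B' by simp
  also have "\<dots> = B * (A * B')" using assms B' by (intro assoc_mult_mat) auto
  finally have "B' = B" using assms B' by simp
  then show ?thesis using Some by (simp add: inv_mat_def)
qed

lemma inv_mat_unitary_diag:
  assumes U: "U \<in> carrier_mat n n" "mat_adjoint U * U = 1\<^sub>m n" "U * mat_adjoint U = 1\<^sub>m n"
    and a: "\<And>i. i < n \<Longrightarrow> a i \<noteq> 0"
  shows "inv_mat (unitary_diag n U a) = unitary_diag n U (\<lambda>i. 1 / a i)"
  by (rule inv_mat_eqI[of _ n]) (use U a in \<open>auto simp: unitary_diag_mult intro!: unitary_diag_one\<close>)

lemma fourier_mat_unitary':
  "fourier_mat n * mat_adjoint (fourier_mat n) = 1\<^sub>m n"
  by (rule mat_mult_left_right_inverse[OF _ fourier_mat_carrier fourier_mat_unitary]) auto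

lemma diagonal_mat_eq_diag_of:
  "E \<in> carrier_mat n n \<Longrightarrow> diagonal_mat E \<Longrightarrow> E = diag_of n (\<lambda>i. E $$ (i, i))"
  by (auto intro!: eq_matI simp: diag_of_def diagonal_mat_def)

text \<open>In the Fourier basis the absolute value just replaces eigenvalues by their moduli. A
  zero eigenvalue would put a column of the Fourier matrix into the kernel of \<open>C\<close>,
  against invertibility.\<close>

lemma circulant_diagonal_form:
  assumes circ: "circulant_mat n C" and inv: "invertible_mat C"
  obtains l where "\<And>i. i < n \<Longrightarrow> l i \<noteq> 0" "C = unitary_diag n (fourier_mat n) l"
    "circulant_abs n C = unitary_diag n (fourier_mat n) (\<lambda>i. complex_of_real (cmod (l i)))"
proof -
  let ?F = "fourier_mat n" and ?E = "circulant_eig_mat n C"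
  have Fa: "mat_adjoint ?F \<in> carrier_mat n n" by auto
  have C: "C \<in> carrier_mat n n" using circ by (auto simp: circulant_mat_def)
  have E: "?E \<in> carrier_mat n n" unfolding circulant_eig_mat_def by (meson C Fa fourier_mat_carrier mult_carrier_mat)
  define l where "l i = ?E $$ (i, i)" for i
  have El: "?E = diag_of n l"
    unfolding l_def by (rule diagonal_mat_eq_diag_of[OF E circulant_mat_diagonalization(1)[OF circ]])
  have Cl: "C = unitary_diag n ?F l"
    using circulant_mat_diagonalization(2)[OF circ] by (simp add: unitary_diag_def El)
  obtain B where B: "B * C = 1\<^sub>m n" "B \<in> carrier_mat n n"
  proof -
    obtain B where "inverts_mat C B" "inverts_mat B C" using inv by (auto simp: invertible_mat_def)
    then have BC: "C * B = 1\<^sub>m n" "B * C = 1\<^sub>m (dim_row B)" using C by (auto simp: inverts_mat_def)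
    then have "dim_row B = dim_col (B * C)" by simp
    then have r: "dim_row B = n" using C by simp
    have "dim_col B = n" using arg_cong[OF BC(1), of dim_col] by simp
    then show thesis using that[of B] BC r by auto
  qed
  have "l i \<noteq> 0" if i: "i < n" for i
  proof
    assume "l i = 0"
    let ?x = "?F *\<^sub>v unit_vec n i"
    have x: "?x \<in> carrier_vec n" using mult_mat_vec_carrier[OF fourier_mat_carrier unit_vec_carrier] .
    have Fx: "mat_adjoint ?F *\<^sub>v ?x = unit_vec n i"
      using assoc_mult_mat_vec[OF Fa fourier_mat_carrier unit_vec_carrier] fourier_mat_unitary by simp
    have "(vnorm (C *\<^sub>v ?x))\<^sup>2 = (\<Sum>j<n. (cmod (l j))\<^sup>2 * (cmod (unit_vec n i $ j))\<^sup>2)"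
      unfolding Cl by (subst vnorm_unitary_diag_mult_vec[OF fourier_mat_carrier fourier_mat_unitary fourier_mat_unitary' x])
        (simp only: Fx)
    also have "\<dots> = 0" using \<open>l i = 0\<close> by (intro sum.neutral) (auto simp: unit_vec_def)
    finally have "vnorm (C *\<^sub>v ?x) = 0" by simp
    then have Cx: "C *\<^sub>v ?x = 0\<^sub>v n" using vnorm_eq_0_iff[OF mult_mat_vec_carrier[OF C x]] by simp
    have "?x = B *\<^sub>v (C *\<^sub>v ?x)" using assoc_mult_mat_vec[OF B(2) C x] B(1) x by simp
    then have "?x = 0\<^sub>v n" using Cx B(2) by (auto intro!: eq_vecI)
    moreover have "mat_adjoint ?F *\<^sub>v 0\<^sub>v n = 0\<^sub>v n" 
      by (intro eq_vecI) (auto simp: carrier_matD[OF Fa] carrier_matD[OF fourier_mat_carrier])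
    ultimately have "unit_vec n i = (0\<^sub>v n :: complex Matrix.vec)" using Fx by simp
    then have "(unit_vec n i :: complex Matrix.vec) $ i = 0" using i by simp
    then show False using i by simp
  qed
  moreover have "map_mat (\<lambda>z. of_real (cmod z)) ?E = diag_of n (\<lambda>i. complex_of_real (cmod (l i)))"
    unfolding El by (auto simp: diag_of_def intro!: eq_matI)
  then have "circulant_abs n C = unitary_diag n ?F (\<lambda>i. complex_of_real (cmod (l i)))"
    by (simp add: circulant_abs_def unitary_diag_def)
  ultimately show thesis using that Cl by blast
qed

text \<open>Reversing the entries multiplies the discrete Fourier transform by unimodular factors and turns
  \<open>\<omega>\<close> into its conjugate, up to which the moduli agree with those of the transform of \<open>conjugate z\<close>.\<close>

lemma cmod_fourier_flip:
  assumes z: "z \<in> carrier_vec n" and k: "k < n"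
  shows "cmod ((mat_adjoint (fourier_mat n) *\<^sub>v (flip_mat n *\<^sub>v z)) $ k) =
    cmod ((mat_adjoint (fourier_mat n) *\<^sub>v conjugate z) $ k)"
proof -
  define w where "w = exp (- 2 * of_real pi * \<i> / of_nat n :: complex)"
  have w0: "cmod w = 1" by (simp add: w_def)
  then have cw: "cnj w * w = 1" by (metis complex_norm_square mult.commute of_real_1 one_power2)
  have Fa: "mat_adjoint (fourier_mat n) \<in> carrier_mat n n" by auto
  have idx: "(mat_adjoint (fourier_mat n) *\<^sub>v y) $ k = (\<Sum>s<n. cnj w ^ (s * k) * y $ s / of_real (sqrt n))"
    if "y \<in> carrier_vec n" for y
    by (subst index_mult_mat_vec_sum[OF Fa that k])
       (use k in \<open>auto simp: index_mat_adjoint carrier_matD[OF fourier_mat_carrier] fourier_mat_def w_def\<close>)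
  have "(mat_adjoint (fourier_mat n) *\<^sub>v (flip_mat n *\<^sub>v z)) $ k =
      (\<Sum>s<n. cnj w ^ (s * k) * z $ (n - Suc s) / of_real (sqrt n))"
    unfolding idx[OF flip_vec_carrier[OF z]] by (intro sum.cong refl) (simp add: flip_index[OF z] del: index_mult_mat_vec)
  also have "\<dots> = (\<Sum>s<n. cnj w ^ ((n - Suc s) * k) * z $ s / of_real (sqrt n))"
    by (subst sum.nat_diff_reindex[symmetric]) (auto intro!: sum.cong simp: Suc_diff_Suc)
  also have "\<dots> = cnj w ^ ((n - 1) * k) * (\<Sum>s<n. w ^ (s * k) * z $ s / of_real (sqrt n))"
    unfolding sum_distrib_left
  proof (intro sum.cong refl)
    fix s assume "s \<in> {..<n}"
    then have "(n - 1) * k = (n - Suc s) * k + s * k" by (simp flip: distrib_right)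
    then have "cnj w ^ ((n - 1) * k) * w ^ (s * k) = cnj w ^ ((n - Suc s) * k) * (cnj w * w) ^ (s * k)"
      by (simp add: power_add power_mult_distrib mult_ac)
    then show "cnj w ^ ((n - Suc s) * k) * z $ s / of_real (sqrt n) =
        cnj w ^ ((n - 1) * k) * (w ^ (s * k) * z $ s / of_real (sqrt n))"
      using cw by (simp add: mult_ac)
  qed
  also have "(\<Sum>s<n. w ^ (s * k) * z $ s / of_real (sqrt n)) = cnj ((mat_adjoint (fourier_mat n) *\<^sub>v conjugate z) $ k)"
    using z by (simp add: idx del: index_mult_mat_vec)
  finally show ?thesis by (simp add: norm_mult norm_power w0 del: index_mult_mat_vec)
qed

text \<open>Both preconditioners are diagonal in the Fourier basis with entries of equal modulus,
  and the norm sees only the moduli of the Fourier coordinates, which agree for the two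
  vectors.\<close>

lemma vnorm_preconditioner_flip:
  assumes z: "z \<in> carrier_vec n"
  shows "vnorm (unitary_diag n (fourier_mat n) (\<lambda>i. 1 / of_real (cmod (l i))) *\<^sub>v (flip_mat n *\<^sub>v z)) =
    vnorm (unitary_diag n (fourier_mat n) (\<lambda>i. 1 / l i) *\<^sub>v conjugate z)"
proof -
  note F = fourier_mat_carrier fourier_mat_unitary fourier_mat_unitary'
  have "(vnorm (unitary_diag n (fourier_mat n) (\<lambda>i. 1 / of_real (cmod (l i))) *\<^sub>v (flip_mat n *\<^sub>v z)))\<^sup>2 =
    (vnorm (unitary_diag n (fourier_mat n) (\<lambda>i. 1 / l i) *\<^sub>v conjugate z))\<^sup>2"
    using z vnorm_unitary_diag_mult_vec[OF F, of "flip_mat n *\<^sub>v z"] vnorm_unitary_diag_mult_vec[OF F, of "conjugate z"]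
    by (simp add: cmod_fourier_flip norm_divide del: index_mult_mat_vec)
  then show ?thesis by (simp add: power2_eq_iff_nonneg)
qed

text \<open>Write P for the matrix with eigenvalues \<open>p i\<close> in the basis
  \<open>U\<close>. With S the inverse square root of P, \<open>A\<close> = S S H is similar to the
  Hermitian matrix S H S, diagonalized by a unitary V. The matrix \<open>W\<close>, the adjoint of V
  times the square root of P, does three things at once: it diagonalizes \<open>A\<close>, its norm
  \<open>vnorm (W *\<^sub>v x)\<close> is the P-norm, and it is a congruence bringing the form of
  \<open>H\<close> to the eigenvalues of \<open>A\<close>.\<close>

lemma preconditioned_hermitian_eigenvalues:
  assumes U: "U \<in> carrier_mat n n" "mat_adjoint U * U = 1\<^sub>m n" "U * mat_adjoint U = 1\<^sub>m n"
    and p: "\<And>i. i < n \<Longrightarrow> (p i :: real) > 0"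
    and H: "H \<in> carrier_mat n n" "mat_adjoint H = H"
  defines "A \<equiv> unitary_diag n U (\<lambda>i. 1 / of_real (p i)) * H"
  obtains ev W where "W \<in> carrier_mat n n"
    "eigenvalue_mset A = image_mset (\<lambda>i. complex_of_real (ev i)) (mset_set {..<n})"
    "\<And>x i. x \<in> carrier_vec n \<Longrightarrow> i < n \<Longrightarrow> (W *\<^sub>v (A *\<^sub>v x)) $ i = of_real (ev i) * (W *\<^sub>v x) $ i"
    "\<And>x. x \<in> carrier_vec n \<Longrightarrow> (vnorm (W *\<^sub>v x))\<^sup>2 = (\<Sum>i<n. (sqrt (p i))\<^sup>2 * sq_coord (mat_adjoint U) x i)"
    "\<And>x. x \<in> carrier_vec n \<Longrightarrow> (H *\<^sub>v x) \<bullet>c x = of_real (\<Sum>i<n. ev i * sq_coord W x i)"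
proof -
  define S where "S = unitary_diag n U (\<lambda>i. 1 / of_real (sqrt (p i)))"
  define S' where "S' = unitary_diag n U (\<lambda>i. of_real (sqrt (p i)))"
  have S: "S \<in> carrier_mat n n" and S': "S' \<in> carrier_mat n n" using U by (auto simp: S_def S'_def)
  have S_adj: "mat_adjoint S = S" "mat_adjoint S' = S'"
    using U by (simp_all add: S_def S'_def mat_adjoint_unitary_diag)
  have pos: "sqrt (p i) \<noteq> 0" if "i < n" for i using p[OF that] by simp
  have SS': "S * S' = 1\<^sub>m n" "S' * S = 1\<^sub>m n"
    unfolding S_def S'_def using U pos by (auto simp: unitary_diag_mult intro!: unitary_diag_one)
  have "diag_of n (\<lambda>i. 1 / complex_of_real (p i)) = diag_of n (\<lambda>i. 1 / of_real (sqrt (p i)) * (1 / of_real (sqrt (p i))))"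
  proof (rule eq_matI)
    fix i j assume "i < dim_row (diag_of n (\<lambda>i. 1 / complex_of_real (sqrt (p i)) * (1 / of_real (sqrt (p i)))))"
      "j < dim_col (diag_of n (\<lambda>i. 1 / complex_of_real (sqrt (p i)) * (1 / of_real (sqrt (p i)))))"
    then have ij: "i < n" "j < n" by (auto simp: diag_of_def)
    have "complex_of_real (sqrt (p i)) * of_real (sqrt (p i)) = of_real (p i)" if "i < n" for i
      unfolding of_real_mult[symmetric] using p[OF that] by simp
    from this[OF ij(1)] this[OF ij(2)] show "diag_of n (\<lambda>i. 1 / complex_of_real (p i)) $$ (i, j) =
        diag_of n (\<lambda>i. 1 / complex_of_real (sqrt (p i)) * (1 / of_real (sqrt (p i)))) $$ (i, j)"
      using ij by (simp add: diag_of_def)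
  qed (auto simp: diag_of_def)
  then have SS: "unitary_diag n U (\<lambda>i. 1 / of_real (p i)) = S * S"
    unfolding S_def unitary_diag_mult[OF U(1,2)] by (simp add: unitary_diag_def)
  have SHS: "S * H * S \<in> carrier_mat n n" using S H by auto
  have "mat_adjoint (S * H * S) = S * H * S"
    using S H S_adj by (simp add: mat_adjoint_mult[of _ n n _ n] assoc_mult_mat[of _ n n _ n _ n] mult_carrier_mat[of _ n n _ n])
  then obtain V ev where V: "V \<in> carrier_mat n n" "mat_adjoint V * V = 1\<^sub>m n" "V * mat_adjoint V = 1\<^sub>m n"
      and VD: "S * H * S = V * diag_of n (\<lambda>i. complex_of_real (ev i)) * mat_adjoint V"
    using hermitian_diagonalization[OF SHS] by blast
  let ?D = "diag_of n (\<lambda>i. complex_of_real (ev i))"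
  have Va: "mat_adjoint V \<in> carrier_mat n n" using V by blast
  note assoc = assoc_mult_mat[of _ n n _ n _ n] mult_carrier_mat[of _ n n _ n] left_mult_one_mat[of _ n n]
  define W where "W = mat_adjoint V * S'"
  define X where "X = S * V"
  have W: "W \<in> carrier_mat n n" and X: "X \<in> carrier_mat n n" using Va V S S' by (auto simp: W_def X_def)
  have XW: "X * W = 1\<^sub>m n"
  proof -
    have "X * W = S * ((V * mat_adjoint V) * S')" unfolding X_def W_def using S S' V(1) Va by (simp add: assoc)
    then show ?thesis using S' V SS' by simp
  qed
  have WX: "W * X = 1\<^sub>m n"
  proof -
    have "W * X = mat_adjoint V * ((S' * S) * V)" unfolding X_def W_def using S S' V(1) Va by (simp add: assoc)
    then show ?thesis using V SS' by simp
  qed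
  have A_eq: "A = X * ?D * W"
  proof -
    have "A = S * (S * H * S) * S'"
    proof -
      have "S * (S * H * S) * S' = S * (S * (H * (S * S')))" using S S' H by (simp add: assoc)
      also have "\<dots> = A" unfolding A_def SS using S H SS' by (simp add: assoc)
      finally show ?thesis by simp
    qed
    then show ?thesis unfolding VD X_def W_def using S S' V(1) Va by (simp add: assoc)
  qed
  have A: "A \<in> carrier_mat n n" unfolding A_def SS using S H by auto
  have 1: "eigenvalue_mset A = image_mset (\<lambda>i. complex_of_real (ev i)) (mset_set {..<n})"
    by (rule eigenvalue_mset_diagonalizable[OF X W XW WX A_eq])
  have WA: "W * A = ?D * W"
  proof -
    have "W * A = (W * X) * (?D * W)" unfolding A_eq using X W by (simp add: assoc)
    then show ?thesis using W unfolding WX by (simp add: left_mult_one_mat[of _ n n] mult_carrier_mat[of _ n n _ n])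
  qed
  have 2: "(W *\<^sub>v (A *\<^sub>v x)) $ i = of_real (ev i) * (W *\<^sub>v x) $ i" if x: "x \<in> carrier_vec n" and i: "i < n" for x i
  proof -
    have "W *\<^sub>v (A *\<^sub>v x) = ?D *\<^sub>v (W *\<^sub>v x)"
      using assoc_mult_mat_vec[OF W A x] assoc_mult_mat_vec[OF diag_of_carrier W x] WA by metis
    then show ?thesis using i by (simp add: diag_of_mult_vec[OF mult_mat_vec_carrier[OF W x]] del: index_mult_mat_vec)
  qed
  have Wx: "W *\<^sub>v x = mat_adjoint V *\<^sub>v (S' *\<^sub>v x)" if "x \<in> carrier_vec n" for x
    unfolding W_def by (rule assoc_mult_mat_vec[OF Va S' that])
  have 3: "(vnorm (W *\<^sub>v x))\<^sup>2 = (\<Sum>i<n. (sqrt (p i))\<^sup>2 * sq_coord (mat_adjoint U) x i)"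
    if x: "x \<in> carrier_vec n" for x
  proof -
    have "vnorm (W *\<^sub>v x) = vnorm (S' *\<^sub>v x)"
      unfolding Wx[OF x] using V Va mult_mat_vec_carrier[OF S' x] by (intro vnorm_unitary[of _ n n]) auto
    then show ?thesis unfolding S'_def vnorm_unitary_diag_mult_vec[OF U x, symmetric]
      by (simp add: vnorm_unitary_diag_mult_vec[OF U x])
  qed
  have 4: "(H *\<^sub>v x) \<bullet>c x = of_real (\<Sum>i<n. ev i * sq_coord W x i)" if x: "x \<in> carrier_vec n" for x
  proof -
    let ?y = "S' *\<^sub>v x"
    have y: "?y \<in> carrier_vec n" using mult_mat_vec_carrier[OF S' x] .
    have "S' * (S * H * S) * S' = (S' * S) * H * (S * S')" using S S' H by (simp add: assoc)
    then have "H = S' * (S * H * S) * S'" using H SS' by simp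
    then have "H *\<^sub>v x = S' *\<^sub>v ((S * H * S) *\<^sub>v ?y)"
      using S' SHS x y assoc_mult_mat_vec[of "S' * (S * H * S)" n n S' n x] assoc_mult_mat_vec[OF S' SHS y] by auto
    then have "(H *\<^sub>v x) \<bullet>c x = ((S * H * S) *\<^sub>v ?y) \<bullet>c ?y"
      using cscalar_prod_adjoint[OF S' mult_mat_vec_carrier[OF SHS y] x] S_adj by simp
    also have "\<dots> = of_real (\<Sum>i<n. ev i * sq_coord (mat_adjoint V) ?y i)"
      by (rule hermitian_form_coordinates[OF V(1) VD y])
    finally show ?thesis unfolding Wx[OF x] .
  qed
  show thesis by (rule that[OF W 1 2 3 4])
qed

section \<open>Powers and the moduli of eigenvalues\<close>

lemma codim_le_funpow:
  assumes A: "A \<in> carrier_mat n n" and V: "codim_le n r V"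
  shows "codim_le n r {x. ((*\<^sub>v) A ^^ j) x \<in> V}"
proof (induction j)
  case 0
  then show ?case using V by simp
next
  case (Suc j)
  show ?case
    using codim_le_preimage[OF A Suc] by (simp add: funpow_swap1)
qed

lemma funpow_mult_vec_carrier:
  "A \<in> carrier_mat n n \<Longrightarrow> x \<in> carrier_vec n \<Longrightarrow> ((*\<^sub>v) A ^^ j) x \<in> carrier_vec n"
  by (induction j) (auto intro: mult_mat_vec_carrier)

abbreviation coords_in :: "nat \<Rightarrow> complex mat \<Rightarrow> nat set \<Rightarrow> complex Matrix.vec set" where
  "coords_in n W S \<equiv> {x. \<forall>i<n. i \<notin> S \<longrightarrow> (W *\<^sub>v x) $ i = 0}"

lemma codim_le_coordinates_compl:
  assumes W: "W \<in> carrier_mat n n" and S: "S \<subseteq> {..<n}"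
  shows "codim_le n (real n - card S) (coords_in n W S)"
proof (rule codim_le_mono[OF codim_le_coordinates[OF W, of "{..<n} - S"]])
  have "card S \<le> n" using card_mono[OF _ S] by simp
  then show "real (card ({..<n} - S)) \<le> real n - card S"
    using S by (simp add: card_Diff_subset finite_subset[OF S] of_nat_diff)
qed auto

lemma funpow_coordinates:
  assumes A: "A \<in> carrier_mat n n"
    and WA: "\<And>x i. x \<in> carrier_vec n \<Longrightarrow> i < n \<Longrightarrow> (W *\<^sub>v (A *\<^sub>v x)) $ i = of_real (ev i) * (W *\<^sub>v x) $ i"
    and x: "x \<in> carrier_vec n" and i: "i < n"
  shows "(W *\<^sub>v ((*\<^sub>v) A ^^ j) x) $ i = of_real (ev i) ^ j * (W *\<^sub>v x) $ i"
proof (induction j)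
  case (Suc j)
  then show ?case using WA[OF funpow_mult_vec_carrier[OF A x] i] by (simp add: mult_ac del: index_mult_mat_vec)
qed simp

text \<open>The columns of \<open>W\<^sup>-\<^sup>1\<close> are eigenvectors of \<open>A\<close>. On the span of those with \<open>\<bar>ev\<^sub>i\<bar> \<le> c\<close>, powers
  of \<open>A\<close> contract \<open>vnorm (W *\<^sub>v x)\<close> at rate \<open>c\<close>, whereas \<open>vnorm x\<close> shrinks at the slower rate \<open>a\<close> off a
  small codimension. Comparing the two norms after \<open>k\<close> steps bounds the dimension of that span.\<close>

lemma card_small_eigenvalues:
  fixes r s :: real
  assumes A: "A \<in> carrier_mat n n" and W: "W \<in> carrier_mat n n"
    and WA: "\<And>x i. x \<in> carrier_vec n \<Longrightarrow> i < n \<Longrightarrow> (W *\<^sub>v (A *\<^sub>v x)) $ i = of_real (ev i) * (W *\<^sub>v x) $ i"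
    and cA: "codim_le n r (norm_ge A a)"
    and cl: "codim_le n s (norm_ge W \<delta>)"
    and cu: "codim_le n s (norm_le W M)"
    and ac: "0 \<le> c" "0 \<le> a" "0 \<le> \<delta>" and k: "c ^ k * M < a ^ k * \<delta>"
  shows "card {i. i < n \<and> \<bar>ev i\<bar> \<le> c} \<le> real k * r + 2 * s"
proof (rule ccontr)
  assume neg: "\<not> ?thesis"
  define S where "S = {i. i < n \<and> \<bar>ev i\<bar> \<le> c}"
  let ?P = "\<lambda>j x. ((*\<^sub>v) A ^^ j) x"
  \<comment> \<open>The costs: \<open>real n - card S\<close> for lying in the span,
    \<open>r\<close> for each of the \<open>k\<close> iterates, and \<open>s\<close> twice to
    compare norms, with the upper bound on \<open>W\<close> at the start \<open>x\<close> and the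
    lower bound at the end of the orbit.\<close>
  have "codim_le n (real n - card S + (real k * r + (s + s)))
     (coords_in n W S \<inter> ({x. \<forall>j<k. x \<in> {x. ?P j x \<in> norm_ge A a}} \<inter>
       ({x. ?P k x \<in> norm_ge W \<delta>} \<inter> norm_le W M)))"
    by (intro codim_le_Int codim_le_INT codim_le_funpow A cA cl cu codim_le_coordinates_compl W) (auto simp: S_def)
  moreover have "real n - card S + (real k * r + (s + s)) < n" using neg by (simp add: S_def)
  ultimately obtain x where x: "x \<in> carrier_vec n" "x \<noteq> 0\<^sub>v n" and
      x0: "\<And>i. i < n \<Longrightarrow> i \<notin> S \<Longrightarrow> (W *\<^sub>v x) $ i = 0" and
      xa: "\<And>j. j < k \<Longrightarrow> a * vnorm (?P j x) \<le> vnorm (A *\<^sub>v ?P j x)" and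
      xl: "\<delta> * vnorm (?P k x) \<le> vnorm (W *\<^sub>v ?P k x)" and xu: "vnorm (W *\<^sub>v x) \<le> M * vnorm x"
    by (rule codim_le_nonzero) auto
  have "a ^ j * vnorm x \<le> vnorm (?P j x)" if "j \<le> k" for j
    using that
  proof (induction j)
    case (Suc j)
    then have "a * (a ^ j * vnorm x) \<le> a * vnorm (?P j x)" using ac by (intro mult_left_mono) auto
    also have "\<dots> \<le> vnorm (?P (Suc j) x)" using xa[of j] Suc.prems by simp
    finally show ?case by (simp add: mult_ac)
  qed simp
  then have 1: "\<delta> * (a ^ k * vnorm x) \<le> \<delta> * vnorm (?P k x)" using ac by (intro mult_left_mono) auto
  have "(vnorm (W *\<^sub>v ?P k x))\<^sup>2 = (\<Sum>i<n. (cmod (of_real (ev i) ^ k * (W *\<^sub>v x) $ i))\<^sup>2)"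
    using W by (simp add: vnorm_sq funpow_coordinates[OF A WA x(1)] del: index_mult_mat_vec)
  also have "\<dots> \<le> (\<Sum>i<n. (c ^ k)\<^sup>2 * sq_coord W x i)"
  proof (intro sum_mono)
    fix i assume i: "i \<in> {..<n}"
    show "(cmod (of_real (ev i) ^ k * (W *\<^sub>v x) $ i))\<^sup>2 \<le> (c ^ k)\<^sup>2 * sq_coord W x i"
    proof (cases "i \<in> S")
      case True
      then have "\<bar>ev i\<bar> ^ k \<le> c ^ k" by (intro power_mono) (auto simp: S_def)
      then show ?thesis
        by (auto simp: norm_mult norm_power power_mult_distrib simp del: index_mult_mat_vec intro!: mult_right_mono power_mono)
    next
      case False
      then show ?thesis using x0 i by (simp del: index_mult_mat_vec)
    qed
  qed
  also have "\<dots> = (c ^ k * vnorm (W *\<^sub>v x))\<^sup>2"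
    using W by (simp add: vnorm_sq power_mult_distrib sum_distrib_left del: index_mult_mat_vec)
  finally have "vnorm (W *\<^sub>v ?P k x) \<le> c ^ k * vnorm (W *\<^sub>v x)"
    using ac by (auto intro: power2_le_imp_le)
  also have "\<dots> \<le> c ^ k * (M * vnorm x)" using xu ac by (intro mult_left_mono) auto
  finally have "\<delta> * a ^ k * vnorm x \<le> c ^ k * M * vnorm x" using 1 xl by (simp add: mult_ac)
  moreover have "vnorm x > 0" using vnorm_pos x by blast
  ultimately show False using k by (simp add: mult.commute)
qed

text \<open>The expanding counterpart: on the span of the large eigenvalues powers stretch
  \<open>vnorm (W *\<^sub>v x)\<close> at rate at least \<open>c\<close>, while the Euclidean norm
  grows at most at rate \<open>b\<close>. The two comparisons change places: the lower bound on
  \<open>W\<close> is taken at \<open>x\<close>, the upper bound after \<open>k\<close>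
  steps.\<close>

lemma card_large_eigenvalues:
  fixes r s :: real
  assumes A: "A \<in> carrier_mat n n" and W: "W \<in> carrier_mat n n"
    and WA: "\<And>x i. x \<in> carrier_vec n \<Longrightarrow> i < n \<Longrightarrow> (W *\<^sub>v (A *\<^sub>v x)) $ i = of_real (ev i) * (W *\<^sub>v x) $ i"
    and cA: "codim_le n r (norm_le A b)"
    and cl: "codim_le n s (norm_ge W \<delta>)"
    and cu: "codim_le n s (norm_le W M)"
    and ac: "0 \<le> b" "0 \<le> c" "0 \<le> M" and k: "b ^ k * M < c ^ k * \<delta>"
  shows "card {i. i < n \<and> c \<le> \<bar>ev i\<bar>} \<le> real k * r + 2 * s"
proof (rule ccontr)
  assume neg: "\<not> ?thesis"
  define S where "S = {i. i < n \<and> c \<le> \<bar>ev i\<bar>}"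
  let ?P = "\<lambda>j x. ((*\<^sub>v) A ^^ j) x"
  have "codim_le n (real n - card S + (real k * r + (s + s)))
     (coords_in n W S \<inter> ({x. \<forall>j<k. x \<in> {x. ?P j x \<in> norm_le A b}} \<inter>
       (norm_ge W \<delta> \<inter> {x. ?P k x \<in> norm_le W M})))"
    by (intro codim_le_Int codim_le_INT codim_le_funpow A cA cl cu codim_le_coordinates_compl W) (auto simp: S_def)
  moreover have "real n - card S + (real k * r + (s + s)) < n" using neg by (simp add: S_def)
  ultimately obtain x where x: "x \<in> carrier_vec n" "x \<noteq> 0\<^sub>v n" and
      x0: "\<And>i. i < n \<Longrightarrow> i \<notin> S \<Longrightarrow> (W *\<^sub>v x) $ i = 0" and
      xa: "\<And>j. j < k \<Longrightarrow> vnorm (A *\<^sub>v ?P j x) \<le> b * vnorm (?P j x)" and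
      xl: "\<delta> * vnorm x \<le> vnorm (W *\<^sub>v x)" and xu: "vnorm (W *\<^sub>v ?P k x) \<le> M * vnorm (?P k x)"
    by (rule codim_le_nonzero) auto
  have "vnorm (?P j x) \<le> b ^ j * vnorm x" if "j \<le> k" for j
    using that
  proof (induction j)
    case (Suc j)
    have "vnorm (?P (Suc j) x) \<le> b * vnorm (?P j x)" using xa[of j] Suc.prems by simp
    also have "\<dots> \<le> b * (b ^ j * vnorm x)" using Suc ac by (intro mult_left_mono) auto
    finally show ?case by (simp add: mult_ac)
  qed simp
  then have 1: "M * vnorm (?P k x) \<le> M * (b ^ k * vnorm x)" using ac by (intro mult_left_mono) auto
  have "(c ^ k * vnorm (W *\<^sub>v x))\<^sup>2 = (\<Sum>i<n. (c ^ k)\<^sup>2 * sq_coord W x i)"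
    using W by (simp add: vnorm_sq power_mult_distrib sum_distrib_left del: index_mult_mat_vec)
  also have "\<dots> \<le> (\<Sum>i<n. (cmod (of_real (ev i) ^ k * (W *\<^sub>v x) $ i))\<^sup>2)"
  proof (intro sum_mono)
    fix i assume i: "i \<in> {..<n}"
    show "(c ^ k)\<^sup>2 * sq_coord W x i \<le> (cmod (of_real (ev i) ^ k * (W *\<^sub>v x) $ i))\<^sup>2"
    proof (cases "i \<in> S")
      case True
      then have "c ^ k \<le> \<bar>ev i\<bar> ^ k" using ac by (intro power_mono) (auto simp: S_def)
      then show ?thesis using ac
        by (auto simp: norm_mult norm_power power_mult_distrib simp del: index_mult_mat_vec intro!: mult_right_mono power_mono)
    next
      case False
      then show ?thesis using x0 i by (simp del: index_mult_mat_vec)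
    qed
  qed
  also have "\<dots> = (vnorm (W *\<^sub>v ?P k x))\<^sup>2"
    using W by (simp add: vnorm_sq funpow_coordinates[OF A WA x(1)] del: index_mult_mat_vec)
  finally have "c ^ k * vnorm (W *\<^sub>v x) \<le> vnorm (W *\<^sub>v ?P k x)"
    by (auto intro: power2_le_imp_le)
  moreover have "c ^ k * (\<delta> * vnorm x) \<le> c ^ k * vnorm (W *\<^sub>v x)" using xl ac by (intro mult_left_mono) auto
  ultimately have "c ^ k * \<delta> * vnorm x \<le> b ^ k * M * vnorm x" using 1 xu by (simp add: mult_ac)
  moreover have "vnorm x > 0" using vnorm_pos x by blast
  ultimately show False using k by simp
qed

section \<open>Inertia and clustering\<close>

text \<open>If too many \<open>h i\<close> reached \<open>\<delta>\<close>, their spectral subspace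
  and its preimage under \<open>J\<close> would meet in a nonzero vector of the set in
  \<open>cG\<close>. There \<open>Q x\<close> and \<open>Q (J *\<^sub>v x)\<close> are each at least
  \<open>\<delta> * (vnorm x)\<^sup>2\<close>, whereas their sum is at most that.\<close>

lemma card_large_form_eigenvalues:
  fixes r \<delta> :: real
  assumes U: "U \<in> carrier_mat n n" "U * mat_adjoint U = 1\<^sub>m n"
    and Q: "\<And>x. x \<in> carrier_vec n \<Longrightarrow> Q x = (\<Sum>i<n. h i * sq_coord (mat_adjoint U) x i)"
    and J: "J \<in> carrier_mat n n" "\<And>x. x \<in> carrier_vec n \<Longrightarrow> vnorm (J *\<^sub>v x) = vnorm x"
    and cG: "codim_le n r {x. Q x + Q (J *\<^sub>v x) \<le> \<delta> * (vnorm x)\<^sup>2}" and \<delta>: "\<delta> > 0"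
  shows "2 * real (card {i. i < n \<and> \<delta> \<le> h i}) \<le> real n + r"
proof (rule ccontr)
  assume neg: "\<not> ?thesis"
  define S where "S = {i. i < n \<and> \<delta> \<le> h i}"
  have Ua: "mat_adjoint U \<in> carrier_mat n n" using U by blast
  let ?V = "coords_in n (mat_adjoint U) S"
  have V: "codim_le n (real n - card S) ?V"
    by (rule codim_le_coordinates_compl[OF Ua]) (auto simp: S_def)
  have QV: "\<delta> * (vnorm x)\<^sup>2 \<le> Q x" if "x \<in> carrier_vec n" "x \<in> ?V" for x
    unfolding Q[OF that(1)] vnorm_sq_coordinates[OF U that(1)] sum_distrib_left
  proof (intro sum_mono)
    fix i assume "i \<in> {..<n}"
    then show "\<delta> * sq_coord (mat_adjoint U) x i \<le> h i * sq_coord (mat_adjoint U) x i"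
      using that(2) by (cases "i \<in> S") (auto simp: S_def simp del: index_mult_mat_vec intro!: mult_right_mono)
  qed
  have "real n - card S + (real n - card S + r) < n" using neg by (simp add: S_def)
  then obtain x where x: "x \<in> carrier_vec n" "x \<noteq> 0\<^sub>v n" "x \<in> ?V" "J *\<^sub>v x \<in> ?V" "Q x + Q (J *\<^sub>v x) \<le> \<delta> * (vnorm x)\<^sup>2"
    by (rule codim_le_nonzero[OF codim_le_Int[OF V codim_le_Int[OF codim_le_preimage[OF J(1) V] cG]]])
       (auto simp del: index_mult_mat_vec)
  have "\<delta> * (vnorm x)\<^sup>2 \<le> Q (J *\<^sub>v x)"
    using QV[OF mult_mat_vec_carrier[OF J(1) x(1)] x(4)] J(2)[OF x(1)] by simp
  then have "\<delta> * (vnorm x)\<^sup>2 \<le> 0" using QV[OF x(1,3)] x(5) by linarith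
  moreover have "\<delta> * (vnorm x)\<^sup>2 > 0" using vnorm_pos[OF x(1,2)] \<delta> by simp
  ultimately show False by linarith
qed

text \<open>Sylvester's law of inertia, in the form that a subspace on which the form is positive definite
  meets one on which it is nonpositive only in \<open>0\<close>.\<close>

lemma card_nonpositive_le:
  assumes U: "U \<in> carrier_mat n n" "U * mat_adjoint U = 1\<^sub>m n" and W: "W \<in> carrier_mat n n"
    and Qh: "\<And>x. x \<in> carrier_vec n \<Longrightarrow> Q x = (\<Sum>i<n. h i * sq_coord (mat_adjoint U) x i)"
    and Qe: "\<And>x. x \<in> carrier_vec n \<Longrightarrow> Q x = (\<Sum>i<n. ev i * sq_coord W x i)"
    and \<delta>: "(\<delta> :: real) > 0"
  shows "card {i. i < n \<and> ev i \<le> 0} + card {i. i < n \<and> \<delta> \<le> h i} \<le> n"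
proof (rule ccontr)
  assume neg: "\<not> ?thesis"
  define S where "S = {i. i < n \<and> \<delta> \<le> h i}"
  define R where "R = {i. i < n \<and> ev i \<le> 0}"
  have Ua: "mat_adjoint U \<in> carrier_mat n n" using U by blast
  have "codim_le n (real n - card S + (real n - card R))
      (coords_in n (mat_adjoint U) S \<inter> coords_in n W R)"
    by (intro codim_le_Int codim_le_coordinates_compl Ua W) (auto simp: S_def R_def)
  moreover have "real n - card S + (real n - card R) < n" using neg by (simp add: S_def R_def)
  ultimately obtain x where x: "x \<in> carrier_vec n" "x \<noteq> 0\<^sub>v n"
    "\<And>i. i < n \<Longrightarrow> i \<notin> S \<Longrightarrow> (mat_adjoint U *\<^sub>v x) $ i = 0" "\<And>i. i < n \<Longrightarrow> i \<notin> R \<Longrightarrow> (W *\<^sub>v x) $ i = 0"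
    by (rule codim_le_nonzero) auto
  have "\<delta> * (vnorm x)\<^sup>2 \<le> Q x"
    unfolding Qh[OF x(1)] vnorm_sq_coordinates[OF U x(1)] sum_distrib_left
  proof (intro sum_mono)
    fix i assume "i \<in> {..<n}"
    then show "\<delta> * sq_coord (mat_adjoint U) x i \<le> h i * sq_coord (mat_adjoint U) x i"
      using x(3) by (cases "i \<in> S") (auto simp: S_def simp del: index_mult_mat_vec intro!: mult_right_mono)
  qed
  moreover have "Q x \<le> 0"
    unfolding Qe[OF x(1)]
  proof (intro sum_nonpos)
    fix i assume "i \<in> {..<n}"
    then show "ev i * sq_coord W x i \<le> 0"
      using x(4) by (cases "i \<in> R") (auto simp: R_def mult_nonpos_nonneg simp del: index_mult_mat_vec)
  qed
  moreover have "\<delta> * (vnorm x)\<^sup>2 > 0" using vnorm_pos[OF x(1,2)] \<delta> by simp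
  ultimately show False by linarith
qed

text \<open>As \<open>J\<close> is self-adjoint, \<open>Q x + Q (J *\<^sub>v x)\<close> is the form
  of H + J H J, which is small in both signs. So at most \<open>(n + r) / 2\<close> eigenvalues of
  \<open>H\<close> reach \<open>\<delta>\<close>, and at most as many reach
  \<open>- \<delta>\<close> from below; at most \<open>s\<close> lie between. Hence at least
  \<open>(n - r) / 2 - s\<close> occur on either side, and inertia converts this into upper bounds
  for the signs of \<open>ev\<close>.\<close>

lemma card_sign_eigenvalues:
  fixes r s :: real
  assumes H: "H \<in> carrier_mat n n" "mat_adjoint H = H" and W: "W \<in> carrier_mat n n"
    and form: "\<And>x. x \<in> carrier_vec n \<Longrightarrow> (H *\<^sub>v x) \<bullet>c x = of_real (\<Sum>i<n. ev i * sq_coord W x i)"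
    and cH: "codim_le n s (norm_ge H (2 * \<delta>))" and \<delta>: "\<delta> > 0"
    and J: "J \<in> carrier_mat n n" "mat_adjoint J = J" "\<And>x. x \<in> carrier_vec n \<Longrightarrow> vnorm (J *\<^sub>v x) = vnorm x"
    and cG: "codim_le n r {x. vnorm (H *\<^sub>v x + J *\<^sub>v (H *\<^sub>v (J *\<^sub>v x))) \<le> \<delta> * vnorm x}"
  shows "real (card {i. i < n \<and> ev i \<le> 0}) \<le> s + (n + r) / 2"
    and "real (card {i. i < n \<and> 0 \<le> ev i}) \<le> s + (n + r) / 2"
proof -
  obtain U h where U: "U \<in> carrier_mat n n" "mat_adjoint U * U = 1\<^sub>m n" "U * mat_adjoint U = 1\<^sub>m n"
    and Hh: "H = U * diag_of n (\<lambda>i. complex_of_real (h i)) * mat_adjoint U"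
    using hermitian_diagonalization[OF H] by blast
  have Ua: "mat_adjoint U \<in> carrier_mat n n" using U by blast
  define Q where "Q x = Re ((H *\<^sub>v x) \<bullet>c x)" for x
  have Qh: "Q x = (\<Sum>i<n. h i * sq_coord (mat_adjoint U) x i)" if "x \<in> carrier_vec n" for x
    unfolding Q_def hermitian_form_coordinates[OF U(1) Hh that] by (rule Re_complex_of_real)
  have Qe: "Q x = (\<Sum>i<n. ev i * sq_coord W x i)" if "x \<in> carrier_vec n" for x
    unfolding Q_def form[OF that] by (rule Re_complex_of_real)
  have abs_le: "\<bar>Q x + Q (J *\<^sub>v x)\<bar> \<le> \<delta> * (vnorm x)\<^sup>2"
    if x: "x \<in> carrier_vec n" and g: "vnorm (H *\<^sub>v x + J *\<^sub>v (H *\<^sub>v (J *\<^sub>v x))) \<le> \<delta> * vnorm x" for x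
  proof -
    note mc = mult_mat_vec_carrier
    have HJ: "H *\<^sub>v (J *\<^sub>v x) \<in> carrier_vec n" using mc[OF H(1) mc[OF J(1) x]] .
    have "(H *\<^sub>v (J *\<^sub>v x)) \<bullet>c (J *\<^sub>v x) = (J *\<^sub>v (H *\<^sub>v (J *\<^sub>v x))) \<bullet>c x"
      using cscalar_prod_adjoint[OF J(1) HJ x] J(2) by simp
    then have "Q x + Q (J *\<^sub>v x) = Re ((H *\<^sub>v x + J *\<^sub>v (H *\<^sub>v (J *\<^sub>v x))) \<bullet>c x)"
      unfolding Q_def using add_scalar_prod_distrib[OF mc[OF H(1) x] mc[OF J(1) HJ] carrier_vec_conjugate[OF x]] by simp
    also have "\<bar>\<dots>\<bar> \<le> cmod ((H *\<^sub>v x + J *\<^sub>v (H *\<^sub>v (J *\<^sub>v x))) \<bullet>c x)" by (rule abs_Re_le_cmod)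
    also have "\<dots> \<le> vnorm (H *\<^sub>v x + J *\<^sub>v (H *\<^sub>v (J *\<^sub>v x))) * vnorm x"
      using mc[OF H(1) x] mc[OF J(1) HJ] x by (intro cauchy_schwarz_vec[of _ n]) auto
    also have "\<dots> \<le> \<delta> * vnorm x * vnorm x" using g by (intro mult_right_mono) auto
    finally show ?thesis by (simp add: power2_eq_square mult_ac)
  qed
  have pos: "2 * real (card {i. i < n \<and> \<delta> \<le> h i}) \<le> real n + r"
    by (rule card_large_form_eigenvalues[OF U(1,3) Qh J(1,3) _ \<delta>], assumption+, rule codim_le_mono[OF cG order_refl])
       (use abs_le in force)
  have neg: "2 * real (card {i. i < n \<and> \<delta> \<le> - h i}) \<le> real n + r"
  proof (rule card_large_form_eigenvalues[OF U(1,3) _ J(1,3) _ \<delta>, where Q = "\<lambda>x. - Q x"])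
    show "- Q x = (\<Sum>i<n. - h i * sq_coord (mat_adjoint U) x i)" if "x \<in> carrier_vec n" for x
      unfolding Qh[OF that] by (simp add: sum_negf)
    show "codim_le n r {x. - Q x + - Q (J *\<^sub>v x) \<le> \<delta> * (vnorm x)\<^sup>2}"
      by (rule codim_le_mono[OF cG order_refl]) (use abs_le in force)
  qed
  \<comment> \<open>On the spectral subspace of \<open>Z\<close> the matrix \<open>H\<close> shrinks
    norms by the factor \<open>\<delta>\<close> at least, against \<open>2 * \<delta>\<close> in
    \<open>cH\<close>: the factor 2 makes the contradiction strict.\<close>
  define Z where "Z = {i. i < n \<and> \<bar>h i\<bar> < \<delta>}"
  have zero: "real (card Z) \<le> s"
  proof (rule ccontr)
    assume "\<not> ?thesis"
    then have lt: "real n - card Z + s < n" by simp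
    have "codim_le n (real n - card Z + s) (coords_in n (mat_adjoint U) Z \<inter> norm_ge H (2 * \<delta>))"
      by (intro codim_le_Int codim_le_coordinates_compl Ua cH) (auto simp: Z_def)
    then obtain x where x: "x \<in> carrier_vec n" "x \<noteq> 0\<^sub>v n" "\<And>i. i < n \<Longrightarrow> i \<notin> Z \<Longrightarrow> (mat_adjoint U *\<^sub>v x) $ i = 0"
      "2 * \<delta> * vnorm x \<le> vnorm (H *\<^sub>v x)"
      using lt by (rule codim_le_nonzero) auto
    let ?c = "\<lambda>i. sq_coord (mat_adjoint U) x i"
    have "(vnorm (H *\<^sub>v x))\<^sup>2 = (\<Sum>i<n. (h i)\<^sup>2 * ?c i)"
      using vnorm_unitary_diag_mult_vec[OF U x(1), of "\<lambda>i. of_real (h i)"] by (simp add: Hh unitary_diag_def)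
    also have "\<dots> \<le> (\<Sum>i<n. \<delta>\<^sup>2 * ?c i)"
    proof (intro sum_mono)
      fix i assume i: "i \<in> {..<n}"
      show "(h i)\<^sup>2 * ?c i \<le> \<delta>\<^sup>2 * ?c i"
      proof (cases "i \<in> Z")
        case True
        then have "(h i)\<^sup>2 \<le> \<delta>\<^sup>2" by (intro power2_le_iff_abs_le[THEN iffD2]) (use \<delta> in \<open>auto simp: Z_def\<close>)
        then show ?thesis by (rule mult_right_mono) simp
      qed (use x(3) i in \<open>simp del: index_mult_mat_vec\<close>)
    qed
    also have "\<dots> = (\<delta> * vnorm x)\<^sup>2"
      by (simp add: vnorm_sq_coordinates[OF U(1,3) x(1)] power_mult_distrib sum_distrib_left)
    finally have "vnorm (H *\<^sub>v x) \<le> \<delta> * vnorm x" using \<delta> by (auto intro: power2_le_imp_le)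
    then have "2 * \<delta> * vnorm x \<le> \<delta> * vnorm x" using x(4) by linarith
    moreover have "\<delta> * vnorm x > 0" using vnorm_pos[OF x(1,2)] \<delta> by simp
    ultimately show False by linarith
  qed
  have "{..<n} = {i. i < n \<and> \<delta> \<le> h i} \<union> {i. i < n \<and> \<delta> \<le> - h i} \<union> Z"
    using \<delta> by (auto simp: Z_def)
  then have "n = card ({i. i < n \<and> \<delta> \<le> h i} \<union> {i. i < n \<and> \<delta> \<le> - h i} \<union> Z)" by (metis card_lessThan)
  also have "\<dots> \<le> card {i. i < n \<and> \<delta> \<le> h i} + card {i. i < n \<and> \<delta> \<le> - h i} + card Z"
    by (intro card_Un_le[THEN order_trans] add_right_mono card_Un_le)
  finally have tot: "real n \<le> real (card {i. i < n \<and> \<delta> \<le> h i}) + real (card {i. i < n \<and> \<delta> \<le> - h i}) + real (card Z)"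
    by linarith
  have "card {i. i < n \<and> ev i \<le> 0} + card {i. i < n \<and> \<delta> \<le> h i} \<le> n"
    by (rule card_nonpositive_le[OF U(1,3) W Qh Qe \<delta>])
  then have "real (card {i. i < n \<and> ev i \<le> 0}) + real (card {i. i < n \<and> \<delta> \<le> h i}) \<le> real n" by linarith
  then show "real (card {i. i < n \<and> ev i \<le> 0}) \<le> s + (n + r) / 2" using tot neg zero by argo
  have "card {i. i < n \<and> - ev i \<le> 0} + card {i. i < n \<and> \<delta> \<le> - h i} \<le> n"
  proof (rule card_nonpositive_le[OF U(1,3) W _ _ \<delta>, where Q = "\<lambda>x. - Q x"])
    show "- Q x = (\<Sum>i<n. - h i * sq_coord (mat_adjoint U) x i)" if "x \<in> carrier_vec n" for x
      unfolding Qh[OF that] by (simp add: sum_negf)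
    show "- Q x = (\<Sum>i<n. - ev i * sq_coord W x i)" if "x \<in> carrier_vec n" for x
      unfolding Qe[OF that] by (simp add: sum_negf del: index_mult_mat_vec)
  qed
  then have "real (card {i. i < n \<and> 0 \<le> ev i}) + real (card {i. i < n \<and> \<delta> \<le> - h i}) \<le> real n"
    unfolding neg_le_0_iff_le by linarith
  then show "real (card {i. i < n \<and> 0 \<le> ev i}) \<le> s + (n + r) / 2" using tot pos zero by argo
qed

text \<open>Pull the spectral subspace of the small \<open>p i\<close> back under \<open>A\<close>.
  There the norm of \<open>H *\<^sub>v x\<close> is at most \<open>\<tau>\<close> times that of
  \<open>A *\<^sub>v x\<close>, hence at most \<open>\<tau> * b * vnorm x\<close>, below the lower
  bound for \<open>H\<close>. This transfers information on the Toeplitz matrix to the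
  preconditioner.\<close>

lemma card_small_preconditioner_eigenvalues:
  fixes r s :: real
  assumes U: "U \<in> carrier_mat n n" "mat_adjoint U * U = 1\<^sub>m n" "U * mat_adjoint U = 1\<^sub>m n"
    and A: "A \<in> carrier_mat n n"
    and PA: "\<And>x. x \<in> carrier_vec n \<Longrightarrow> unitary_diag n U p *\<^sub>v (A *\<^sub>v x) = H *\<^sub>v x"
    and cA: "codim_le n r (norm_le A b)"
    and cH: "codim_le n s (norm_ge H \<delta>)"
    and \<tau>: "0 \<le> \<tau>" "\<tau> * b < \<delta>"
  shows "card {i. i < n \<and> cmod (p i) < \<tau>} \<le> r + s"
proof (rule ccontr)
  assume neg: "\<not> ?thesis"
  define S where "S = {i. i < n \<and> cmod (p i) < \<tau>}"
  have Ua: "mat_adjoint U \<in> carrier_mat n n" using U by blast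
  have V: "codim_le n (real n - card S) (coords_in n (mat_adjoint U) S)"
    by (rule codim_le_coordinates_compl[OF Ua]) (auto simp: S_def)
  have "real n - card S + (r + s) < n" using neg by (simp add: S_def)
  then obtain x where x: "x \<in> carrier_vec n" "x \<noteq> 0\<^sub>v n"
      "\<And>i. i < n \<Longrightarrow> i \<notin> S \<Longrightarrow> (mat_adjoint U *\<^sub>v (A *\<^sub>v x)) $ i = 0"
      "vnorm (A *\<^sub>v x) \<le> b * vnorm x" "\<delta> * vnorm x \<le> vnorm (H *\<^sub>v x)"
    by (rule codim_le_nonzero[OF codim_le_Int[OF codim_le_preimage[OF A V] codim_le_Int[OF cA cH]]])
       (auto simp del: index_mult_mat_vec)
  let ?c = "\<lambda>i. sq_coord (mat_adjoint U) (A *\<^sub>v x) i"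
  have Ax: "A *\<^sub>v x \<in> carrier_vec n" using mult_mat_vec_carrier[OF A x(1)] .
  have "(vnorm (H *\<^sub>v x))\<^sup>2 \<le> (\<Sum>i<n. \<tau>\<^sup>2 * ?c i)"
    unfolding PA[OF x(1), symmetric] vnorm_unitary_diag_mult_vec[OF U Ax]
  proof (intro sum_mono)
    fix i assume i: "i \<in> {..<n}"
    show "(cmod (p i))\<^sup>2 * ?c i \<le> \<tau>\<^sup>2 * ?c i"
      using x(3) i by (cases "i \<in> S") (auto simp: S_def simp del: index_mult_mat_vec intro!: mult_right_mono power_mono)
  qed
  also have "\<dots> = (\<tau> * vnorm (A *\<^sub>v x))\<^sup>2"
    by (simp add: vnorm_sq_coordinates[OF U(1,3) Ax] power_mult_distrib sum_distrib_left)
  finally have "vnorm (H *\<^sub>v x) \<le> \<tau> * vnorm (A *\<^sub>v x)" using \<tau> by (auto intro: power2_le_imp_le)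
  also have "\<dots> \<le> \<tau> * (b * vnorm x)" using x(4) \<tau> by (intro mult_left_mono) auto
  finally have "\<delta> * vnorm x \<le> \<tau> * b * vnorm x" using x(5) by simp
  then show False using vnorm_pos[OF x(1,2)] \<tau> by simp
qed

text \<open>Dually, on the pulled back spectral subspace of the large \<open>p i\<close> the norm of
  \<open>H *\<^sub>v x\<close> is at least \<open>\<tau> * a * vnorm x\<close>, above the upper
  bound for \<open>H\<close>.\<close>

lemma card_large_preconditioner_eigenvalues:
  fixes r s :: real
  assumes U: "U \<in> carrier_mat n n" "mat_adjoint U * U = 1\<^sub>m n" "U * mat_adjoint U = 1\<^sub>m n"
    and A: "A \<in> carrier_mat n n"
    and PA: "\<And>x. x \<in> carrier_vec n \<Longrightarrow> unitary_diag n U p *\<^sub>v (A *\<^sub>v x) = H *\<^sub>v x"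
    and cA: "codim_le n r (norm_ge A a)"
    and cH: "codim_le n s (norm_le H M)"
    and \<tau>: "0 \<le> \<tau>" "M < \<tau> * a"
  shows "card {i. i < n \<and> \<tau> < cmod (p i)} \<le> r + s"
proof (rule ccontr)
  assume neg: "\<not> ?thesis"
  define S where "S = {i. i < n \<and> \<tau> < cmod (p i)}"
  have Ua: "mat_adjoint U \<in> carrier_mat n n" using U by blast
  have V: "codim_le n (real n - card S) (coords_in n (mat_adjoint U) S)"
    by (rule codim_le_coordinates_compl[OF Ua]) (auto simp: S_def)
  have "real n - card S + (r + s) < n" using neg by (simp add: S_def)
  then obtain x where x: "x \<in> carrier_vec n" "x \<noteq> 0\<^sub>v n"
      "\<And>i. i < n \<Longrightarrow> i \<notin> S \<Longrightarrow> (mat_adjoint U *\<^sub>v (A *\<^sub>v x)) $ i = 0"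
      "a * vnorm x \<le> vnorm (A *\<^sub>v x)" "vnorm (H *\<^sub>v x) \<le> M * vnorm x"
    by (rule codim_le_nonzero[OF codim_le_Int[OF codim_le_preimage[OF A V] codim_le_Int[OF cA cH]]])
       (auto simp del: index_mult_mat_vec)
  let ?c = "\<lambda>i. sq_coord (mat_adjoint U) (A *\<^sub>v x) i"
  have Ax: "A *\<^sub>v x \<in> carrier_vec n" using mult_mat_vec_carrier[OF A x(1)] .
  have "(\<tau> * vnorm (A *\<^sub>v x))\<^sup>2 = (\<Sum>i<n. \<tau>\<^sup>2 * ?c i)"
    by (simp add: vnorm_sq_coordinates[OF U(1,3) Ax] power_mult_distrib sum_distrib_left)
  also have "\<dots> \<le> (vnorm (H *\<^sub>v x))\<^sup>2"
    unfolding PA[OF x(1), symmetric] vnorm_unitary_diag_mult_vec[OF U Ax]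
  proof (intro sum_mono)
    fix i assume i: "i \<in> {..<n}"
    show "\<tau>\<^sup>2 * ?c i \<le> (cmod (p i))\<^sup>2 * ?c i"
      using x(3) i \<tau> by (cases "i \<in> S") (auto simp: S_def simp del: index_mult_mat_vec intro!: mult_right_mono power_mono)
  qed
  finally have "\<tau> * vnorm (A *\<^sub>v x) \<le> vnorm (H *\<^sub>v x)" by (auto intro: power2_le_imp_le)
  moreover have "\<tau> * (a * vnorm x) \<le> \<tau> * vnorm (A *\<^sub>v x)" using x(4) \<tau> by (intro mult_left_mono) auto
  ultimately have "\<tau> * a * vnorm x \<le> M * vnorm x" using x(5) by simp
  then show False using vnorm_pos[OF x(1,2)] \<tau> by simp
qed

section \<open>Flipped Toeplitz matrices and clustered singular values\<close>

lemma flip_toeplitz_index: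
  assumes "s < n" "t < n"
  shows "(flip_mat n * toeplitz_mat f n) $$ (s, t) = fourier_coeff f (int n - 1 - int s - int t)"
proof -
  have i: "int (n - Suc s) = int n - 1 - int s" using assms by auto
  have "(flip_mat n * toeplitz_mat f n) $$ (s, t) = (flip_mat n *\<^sub>v col (toeplitz_mat f n) t) $ s"
    using assms by (simp add: carrier_matD[OF flip_carrier] carrier_matD[OF toeplitz_carrier])
  also have "\<dots> = toeplitz_mat f n $$ (n - Suc s, t)"
    using assms by (subst flip_index) (auto simp: carrier_vecI carrier_matD[OF toeplitz_carrier])
  finally show ?thesis using assms by (simp add: toeplitz_mat_def i)
qed

text \<open>The flip turns a Toeplitz matrix into a Hankel matrix: entries depend on
  \<open>s + t\<close> only, so it is symmetric, and real coefficients make it Hermitian.\<close>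

lemma flip_toeplitz_hermitian:
  assumes "\<And>k. fourier_coeff f k \<in> \<real>"
  shows "mat_adjoint (flip_mat n * toeplitz_mat f n) = flip_mat n * toeplitz_mat f n"
  by (rule eq_matI)
     (use assms in \<open>auto simp: index_mat_adjoint carrier_matD[OF flip_carrier] carrier_matD[OF toeplitz_carrier]
        flip_toeplitz_index Reals_cnj_iff algebra_simps simp del: index_mult_mat(1)\<close>)

lemma conjugate_toeplitz_mult_vec:
  assumes "\<And>k. fourier_coeff f k \<in> \<real>" and x: "x \<in> carrier_vec n"
  shows "conjugate (toeplitz_mat f n *\<^sub>v x) = toeplitz_mat f n *\<^sub>v conjugate x"
proof (rule eq_vecI)
  fix s assume "s < dim_vec (toeplitz_mat f n *\<^sub>v conjugate x)"
  then have s: "s < n" by (simp add: carrier_matD[OF toeplitz_carrier])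
  then have "conjugate (toeplitz_mat f n *\<^sub>v x) $ s = cnj ((toeplitz_mat f n *\<^sub>v x) $ s)"
    by (simp add: carrier_matD[OF toeplitz_carrier] del: index_mult_mat_vec)
  also have "\<dots> = (\<Sum>t<n. cnj (toeplitz_mat f n $$ (s, t)) * cnj (x $ t))"
    by (simp add: index_mult_mat_vec_sum[OF toeplitz_carrier x s] del: index_mult_mat_vec)
  also have "\<dots> = (toeplitz_mat f n *\<^sub>v conjugate x) $ s"
    unfolding index_mult_mat_vec_sum[OF toeplitz_carrier carrier_vec_conjugate[OF x] s]
    using x s assms(1) by (intro sum.cong refl) (auto simp: toeplitz_mat_def Reals_cnj_iff)
  finally show "conjugate (toeplitz_mat f n *\<^sub>v x) $ s = (toeplitz_mat f n *\<^sub>v conjugate x) $ s" .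
qed (simp add: carrier_matD[OF toeplitz_carrier])

text \<open>Test with a tent of height 1 at 1, supported in the window of radius
  \<open>\<eta>\<close>. Its averages tend to 1 and are at most the fraction of singular values in
  the window; as there are \<open>n\<close> singular values in all, few lie outside, whether bounded
  or not.\<close>

lemma singular_value_cluster_codim:
  fixes \<eta> \<rho> :: real
  assumes dist: "singular_value_distribution B (\<lambda>_. 1) {-pi..pi}"
    and B: "\<And>n. n \<ge> 1 \<Longrightarrow> B n \<in> carrier_mat n n" and \<eta>: "0 < \<eta>" "\<eta> \<le> 1" and \<rho>: "0 < \<rho>"
  obtains N where "\<And>n. n \<ge> N \<Longrightarrow> codim_le n (\<rho> * n) (norm_ge (B n) (1 - \<eta>))"
    "\<And>n. n \<ge> N \<Longrightarrow> codim_le n (\<rho> * n) (norm_le (B n) (1 + \<eta>))"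
proof -
  define g where "g x = max 0 (1 - \<bar>x - 1\<bar> / \<eta>)" for x :: real
  define F where "F x = complex_of_real (g x)" for x
  have "continuous_on UNIV F" unfolding F_def g_def by (intro continuous_intros) (use \<eta> in auto)
  moreover have "bounded {x. F x \<noteq> 0}"
  proof (rule bounded_subset[of "{1 - \<eta>..1 + \<eta>}"])
    show "{x. F x \<noteq> 0} \<subseteq> {1 - \<eta>..1 + \<eta>}"
      using \<eta> by (auto simp: F_def g_def max_def field_simps abs_if split: if_splits)
  qed simp
  moreover have "{-pi..pi} \<in> lmeasurable" "0 < measure lebesgue {-pi..pi}" by simp_all
  ultimately have "(\<lambda>n. 1 / of_nat n * (\<Sum>x \<in># singular_value_mset (B n). F x)) \<longlonglongrightarrow> F 1"
    using dist singular_value_distribution_one_iff by blast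
  moreover have "F 1 = 1" by (simp add: F_def g_def)
  ultimately have "(\<lambda>n. Re (1 / of_nat n * (\<Sum>x \<in># singular_value_mset (B n). F x))) \<longlonglongrightarrow> 1"
    using tendsto_Re by fastforce
  then have "\<forall>\<^sub>F n in sequentially. 1 - \<rho> < Re (1 / of_nat n * (\<Sum>x \<in># singular_value_mset (B n). F x))"
    using \<rho> by (intro order_tendstoD(1)) auto
  then obtain N where N: "\<And>n. n \<ge> N \<Longrightarrow> 1 - \<rho> < Re (1 / of_nat n * (\<Sum>x \<in># singular_value_mset (B n). F x))"
    by (auto simp: eventually_sequentially)
  have main: "codim_le n (\<rho> * n) (norm_ge (B n) (1 - \<eta>)) \<and>
      codim_le n (\<rho> * n) (norm_le (B n) (1 + \<eta>))" if n: "n \<ge> max N 1" for n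
  proof -
    have n1: "n \<ge> 1" "n \<ge> N" using n by auto
    obtain U d where U: "U \<in> carrier_mat n n" "mat_adjoint U * U = 1\<^sub>m n" "U * mat_adjoint U = 1\<^sub>m n"
      and d: "\<And>i. 0 \<le> d i" and sv: "singular_value_mset (B n) = image_mset d (mset_set {..<n})"
      and Bx: "\<And>x. x \<in> carrier_vec n \<Longrightarrow> (vnorm (B n *\<^sub>v x))\<^sup>2 = (\<Sum>i<n. (d i)\<^sup>2 * sq_coord (mat_adjoint U) x i)"
      by (rule singular_value_decomposition[OF B[OF n1(1)]]) (rule that; assumption)
    define G where "G = {i. i < n \<and> 1 - \<eta> \<le> d i \<and> d i \<le> 1 + \<eta>}"
    have "(\<Sum>x \<in># singular_value_mset (B n). F x) = of_real (\<Sum>i<n. g (d i))"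
      unfolding sv F_def by (simp add: multiset.map_comp comp_def sum_unfold_sum_mset[symmetric])
    then have eq: "Re (1 / of_nat n * (\<Sum>x \<in># singular_value_mset (B n). F x)) = (\<Sum>i<n. g (d i)) / n"
      by simp
    have "1 - \<rho> < (\<Sum>i<n. g (d i)) / n" using N[OF n1(2)] unfolding eq .
    then have "(1 - \<rho>) * n < (\<Sum>i<n. g (d i))" using n1 by (simp add: pos_less_divide_eq)
    also have "\<dots> \<le> (\<Sum>i<n. if i \<in> G then 1 else 0)"
    proof (intro sum_mono)
      fix i assume "i \<in> {..<n}"
      then show "g (d i) \<le> (if i \<in> G then 1 else 0)"
        using \<eta> by (auto simp: g_def G_def max_def field_simps abs_if split: if_splits)
    qed
    also have "\<dots> = card G"
      by (simp add: sum.If_cases) (rule arg_cong[where f = card], auto simp: G_def)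
    finally have cG: "(1 - \<rho>) * n < card G" .
    have "G \<subseteq> {..<n}" by (auto simp: G_def)
    then have "real n = real (card G) + real (card ({..<n} - G))"
      using card_mono[of "{..<n}" G] by (simp add: card_Diff_subset finite_subset of_nat_diff)
    then have bad: "real (card ({..<n} - G)) \<le> \<rho> * n" using cG by (simp add: algebra_simps)
    have "card {i. i < n \<and> d i < 1 - \<eta>} \<le> card ({..<n} - G)" "card {i. i < n \<and> 1 + \<eta> < d i} \<le> card ({..<n} - G)"
      by (intro card_mono; force simp: G_def)+
    then have "real (card {i. i < n \<and> d i < 1 - \<eta>}) \<le> \<rho> * n" "real (card {i. i < n \<and> 1 + \<eta> < d i}) \<le> \<rho> * n"
      using bad by linarith+
    then show ?thesis
      using codim_le_mono[OF codim_le_singular_values_lower[OF U(1,3) Bx, of "1 - \<eta>"]]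
        codim_le_mono[OF codim_le_singular_values_upper[OF U(1,3) d Bx, of "1 + \<eta>"]] \<eta> by auto
  qed
  show thesis by (rule that[of "max N 1"]) (use main in blast)+
qed

section \<open>Eigenvalue distribution\<close>

lemma geometric_ratio_eventually:
  fixes a b :: real
  assumes "0 \<le> a" "a < b" "0 < \<delta>"
  shows "\<forall>\<^sub>F k in sequentially. a ^ k * M < b ^ k * \<delta>"
proof -
  have "(\<lambda>k. (a / b) ^ k * M) \<longlonglongrightarrow> 0 * M"
    using assms by (intro tendsto_intros LIMSEQ_realpow_zero) auto
  then have "\<forall>\<^sub>F k in sequentially. (a / b) ^ k * M < \<delta>"
    using assms by (intro order_tendstoD(2)) auto
  then show ?thesis
  proof eventually_elim
    case (elim k)
    have "b ^ k > 0" using assms by simp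
    then show ?case using elim by (simp add: power_divide field_simps)
  qed
qed

text \<open>Zero is counted on both sides, so the two upper bounds also imply that each strict sign
  occurs at least \<open>(1 / 2 - \<rho>) * n\<close> times.\<close>

definition balanced_clusters :: "nat \<Rightarrow> (nat \<Rightarrow> real) \<Rightarrow> real \<Rightarrow> real \<Rightarrow> bool" where
  "balanced_clusters n ev \<eta> \<rho> \<longleftrightarrow>
    real (card {i. i < n \<and> (\<bar>ev i\<bar> \<le> 1 - \<eta> \<or> 1 + \<eta> \<le> \<bar>ev i\<bar>)}) \<le> \<rho> * n \<and>
    real (card {i. i < n \<and> ev i \<le> 0}) \<le> (1 / 2 + \<rho>) * n \<and>
    real (card {i. i < n \<and> 0 \<le> ev i}) \<le> (1 / 2 + \<rho>) * n"

lemma preconditioned_flip_eigenvalue_clusters: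
  fixes f :: "real \<Rightarrow> complex" and C :: "nat \<Rightarrow> complex mat" and \<eta> \<rho> :: real
  assumes f: "integrable circ f"
    and f_real: "\<And>k. fourier_coeff f k \<in> \<real>"
    and sv: "sparsely_vanishing_on {-pi..pi} f"
    and circ: "\<And>n. n \<ge> 1 \<Longrightarrow> circulant_mat n (C n)"
    and inv: "\<And>n. n \<ge> 1 \<Longrightarrow> invertible_mat (C n)"
    and approx: "singular_value_distribution (\<lambda>n. inv_mat (C n) * toeplitz_mat f n) (\<lambda>_. 1) {-pi..pi}"
    and \<eta>: "0 < \<eta>" "\<eta> < 1" and \<rho>: "0 < \<rho>"
  shows "\<exists>N. \<forall>n\<ge>N. \<exists>ev.
    eigenvalue_mset (inv_mat (circulant_abs n (C n)) * flip_mat n * toeplitz_mat f n) =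
      image_mset (\<lambda>i. complex_of_real (ev i)) (mset_set {..<n}) \<and> balanced_clusters n ev \<eta> \<rho>"
    (is "\<exists>N. \<forall>n\<ge>N. ?Q n")
proof -
  \<comment> \<open>Eigenvalues of too small modulus cost \<open>5 * \<epsilon> * n\<close>: one for
    the powers and twice two for the norm comparisons. Those of too large modulus cost as much, ten
    in all.\<close>
  define \<epsilon> where "\<epsilon> = \<rho> / 10"
  have \<epsilon>: "\<epsilon> > 0" using \<rho> by (simp add: \<epsilon>_def)
  let ?B = "\<lambda>n. inv_mat (C n) * toeplitz_mat f n"
  have dec: "\<exists>l. (\<forall>i<n. l i \<noteq> 0) \<and> C n = unitary_diag n (fourier_mat n) l \<and>
      circulant_abs n (C n) = unitary_diag n (fourier_mat n) (\<lambda>i. complex_of_real (cmod (l i)))" if "n \<ge> 1" for n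
    using circulant_diagonal_form[OF circ[OF that] inv[OF that]] by metis
  note F = fourier_mat_carrier fourier_mat_unitary fourier_mat_unitary'
  have B: "?B n \<in> carrier_mat n n" if n: "n \<ge> 1" for n
  proof -
    obtain l where "\<forall>i<n. l i \<noteq> 0" "C n = unitary_diag n (fourier_mat n) l" using dec[OF n] by blast
    then have "inv_mat (C n) = unitary_diag n (fourier_mat n) (\<lambda>i. 1 / l i)"
      using inv_mat_unitary_diag[OF F, where a = l] by simp
    then show ?thesis using unitary_diag_carrier[OF fourier_mat_carrier] by (metis mult_carrier_mat toeplitz_carrier)
  qed
  obtain \<delta>0 N0 where \<delta>0: "\<delta>0 > 0"
    and T_lower: "\<And>n. n \<ge> N0 \<Longrightarrow> codim_le n (\<epsilon> * n) (norm_ge (toeplitz_mat f n) \<delta>0)"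
    using codim_le_toeplitz_lower[OF f sv \<epsilon>] by blast
  obtain M0 where M0: "M0 > 0"
    and T_upper: "\<And>n. codim_le n (\<epsilon> * n) (norm_le (toeplitz_mat f n) M0)"
    using codim_le_toeplitz_upper[OF f \<epsilon>] by blast
  obtain N1 where N1: "\<And>n. n \<ge> N1 \<Longrightarrow> codim_le n (\<epsilon> * n) (norm_ge (?B n) (1 - 1 / 2))"
    "\<And>n. n \<ge> N1 \<Longrightarrow> codim_le n (\<epsilon> * n) (norm_le (?B n) (1 + 1 / 2))"
    using singular_value_cluster_codim[OF approx B, of "1 / 2" \<epsilon>] \<epsilon> by auto
  \<comment> \<open>Off small codimension the preconditioned matrix has norm ratio between 1/2 and
    3/2. The thresholds meet \<open>\<tau> * (3 / 2) < \<delta>0\<close> and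
    \<open>M0 < \<tau>' * (1 / 2)\<close>, as the counts of preconditioner eigenvalues
    require.\<close>
  define \<tau> where "\<tau> = \<delta>0 / 2"
  define \<tau>' where "\<tau>' = 4 * M0"
  have \<tau>: "\<tau> > 0" "\<tau>' > 0" using \<delta>0 M0 by (simp_all add: \<tau>_def \<tau>'_def)
  \<comment> \<open>The square roots appear because \<open>W\<close> carries the square root of the
    preconditioner. Halving \<open>\<eta>\<close> for the norm rates leaves a strict gap to the
    eigenvalue rates.\<close>
  have "\<forall>\<^sub>F k in sequentially. (1 - \<eta>) ^ k * sqrt \<tau>' < (1 - \<eta> / 2) ^ k * sqrt \<tau> \<and>
      (1 + \<eta> / 2) ^ k * sqrt \<tau>' < (1 + \<eta>) ^ k * sqrt \<tau>"
    using \<eta> \<tau> by (intro eventually_conj geometric_ratio_eventually) auto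
  then obtain k where k: "(1 - \<eta>) ^ k * sqrt \<tau>' < (1 - \<eta> / 2) ^ k * sqrt \<tau>"
      "(1 + \<eta> / 2) ^ k * sqrt \<tau>' < (1 + \<eta>) ^ k * sqrt \<tau>"
    by (auto simp: eventually_sequentially)
  \<comment> \<open>The refined accuracy is imposed at each of the \<open>k\<close> iterates, hence
    the division; \<open>k + 1\<close> covers \<open>k = 0\<close>.\<close>
  have k1: "\<epsilon> / (k + 1) > 0" using \<epsilon> by simp
  obtain N2 where N2: "\<And>n. n \<ge> N2 \<Longrightarrow> codim_le n (\<epsilon> / (k + 1) * n) (norm_ge (?B n) (1 - \<eta> / 2))"
    "\<And>n. n \<ge> N2 \<Longrightarrow> codim_le n (\<epsilon> / (k + 1) * n) (norm_le (?B n) (1 + \<eta> / 2))"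
    using singular_value_cluster_codim[OF approx B, of "\<eta> / 2" "\<epsilon> / (k + 1)"] k1 \<eta> by auto
  have \<delta>2: "\<delta>0 / 2 > 0" using \<delta>0 by simp
  obtain N3 where N3: "\<And>n. n \<ge> N3 \<Longrightarrow> codim_le n (\<epsilon> * n) {x. vnorm (flip_defect f n x) \<le> \<delta>0 / 2 * vnorm x}"
    using codim_le_flip_defect[OF f \<epsilon> \<delta>2] by blast
  show ?thesis
  proof (intro exI[of _ "max 1 (max (max N0 N1) (max N2 N3))"] allI impI)
    fix n assume n_ge: "n \<ge> max 1 (max (max N0 N1) (max N2 N3))"
    then have n: "n \<ge> 1" "n \<ge> N0" "n \<ge> N1" "n \<ge> N2" "n \<ge> N3" by auto
    obtain l where l: "\<And>i. i < n \<Longrightarrow> l i \<noteq> 0" and Cl: "C n = unitary_diag n (fourier_mat n) l"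
      and Cabs: "circulant_abs n (C n) = unitary_diag n (fourier_mat n) (\<lambda>i. complex_of_real (cmod (l i)))"
      using dec[OF n(1)] by blast
    let ?U = "fourier_mat n" and ?T = "toeplitz_mat f n"
    define H where "H = flip_mat n * ?T"
    define D where "D = unitary_diag n ?U (\<lambda>i. 1 / complex_of_real (cmod (l i)))"
    define A where "A = D * H"
    have D: "D \<in> carrier_mat n n" by (simp add: D_def)
    have H: "H \<in> carrier_mat n n" unfolding H_def by (metis flip_carrier mult_carrier_mat toeplitz_carrier)
    have A: "A \<in> carrier_mat n n" using D H by (simp add: A_def)
    have Hh: "mat_adjoint H = H" unfolding H_def by (rule flip_toeplitz_hermitian[OF f_real])
    have Hx: "H *\<^sub>v x = flip_mat n *\<^sub>v (?T *\<^sub>v x)" if "x \<in> carrier_vec n" for x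
      unfolding H_def by (rule assoc_mult_mat_vec[OF flip_carrier toeplitz_carrier that])
    have Ax: "A *\<^sub>v x = D *\<^sub>v (H *\<^sub>v x)" if "x \<in> carrier_vec n" for x
      unfolding A_def by (rule assoc_mult_mat_vec[OF D H that])
    have X_eq: "inv_mat (circulant_abs n (C n)) * flip_mat n * ?T = A"
    proof -
      have "inv_mat (circulant_abs n (C n)) = D"
        unfolding Cabs D_def using inv_mat_unitary_diag[OF F, where a = "\<lambda>i. complex_of_real (cmod (l i))"] l by simp
      then show ?thesis
        unfolding A_def H_def using assoc_mult_mat[OF D flip_carrier toeplitz_carrier] by simp
    qed
    have invC: "inv_mat (C n) = unitary_diag n ?U (\<lambda>i. 1 / l i)"
      unfolding Cl using inv_mat_unitary_diag[OF F, where a = l] l by simp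
    have nA: "vnorm (A *\<^sub>v x) = vnorm (?B n *\<^sub>v conjugate x)" if x: "x \<in> carrier_vec n" for x
    proof -
      have "vnorm (A *\<^sub>v x) = vnorm (unitary_diag n ?U (\<lambda>i. 1 / l i) *\<^sub>v conjugate (?T *\<^sub>v x))"
        unfolding Ax[OF x] Hx[OF x] D_def by (rule vnorm_preconditioner_flip[OF toeplitz_vec_carrier[OF x]])
      also have "\<dots> = vnorm (?B n *\<^sub>v conjugate x)"
        unfolding conjugate_toeplitz_mult_vec[OF f_real x] invC
        using assoc_mult_mat_vec[OF unitary_diag_carrier[OF fourier_mat_carrier] toeplitz_carrier carrier_vec_conjugate[OF x]] by metis
      finally show ?thesis .
    qed
    have nH: "vnorm (H *\<^sub>v x) = vnorm (?T *\<^sub>v x)" if "x \<in> carrier_vec n" for x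
      unfolding Hx[OF that] using that by simp
    have A_lower: "codim_le n r (norm_ge A a)"
      if "codim_le n r (norm_ge (?B n) a)" for r a
      by (rule codim_le_mono[OF codim_le_conjugate[OF that] order_refl]) (simp add: nA)
    have A_upper: "codim_le n r (norm_le A a)"
      if "codim_le n r (norm_le (?B n) a)" for r a
      by (rule codim_le_mono[OF codim_le_conjugate[OF that] order_refl]) (simp add: nA)
    have H_lower: "codim_le n (\<epsilon> * n) (norm_ge H \<delta>0)"
      by (rule codim_le_mono[OF T_lower[OF n(2)] order_refl]) (simp add: nH)
    have H_upper: "codim_le n (\<epsilon> * n) (norm_le H M0)"
      by (rule codim_le_mono[OF T_upper order_refl]) (simp add: nH)
    have PA: "unitary_diag n ?U (\<lambda>i. complex_of_real (cmod (l i))) *\<^sub>v (A *\<^sub>v x) = H *\<^sub>v x"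
      if x: "x \<in> carrier_vec n" for x
    proof -
      let ?P = "unitary_diag n ?U (\<lambda>i. complex_of_real (cmod (l i)))"
      have "?P * D = 1\<^sub>m n"
        unfolding D_def unitary_diag_mult[OF F(1,2)] by (rule unitary_diag_one[OF F(1,3)]) (simp add: l)
      then show ?thesis
        unfolding Ax[OF x] using mult_mat_vec_carrier[OF H x] D
        by (subst assoc_mult_mat_vec[symmetric, of _ n n _ n]) auto
    qed
    have cards: "real (card {i. i < n \<and> cmod (l i) < \<tau>}) \<le> 2 * \<epsilon> * n" "real (card {i. i < n \<and> \<tau>' < cmod (l i)}) \<le> 2 * \<epsilon> * n"
      using card_small_preconditioner_eigenvalues[OF F A PA A_upper[OF N1(2)[OF n(3)]] H_lower, of \<tau>]
        card_large_preconditioner_eigenvalues[OF F A PA A_lower[OF N1(1)[OF n(3)]] H_upper, of \<tau>'] \<delta>0 M0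
      by (auto simp: \<tau>_def \<tau>'_def)
    have lpos: "cmod (l i) > 0" if "i < n" for i using l[OF that] by simp
    obtain ev W where W: "W \<in> carrier_mat n n"
      and evs: "eigenvalue_mset A = image_mset (\<lambda>i. complex_of_real (ev i)) (mset_set {..<n})"
      and WA: "\<And>x i. x \<in> carrier_vec n \<Longrightarrow> i < n \<Longrightarrow> (W *\<^sub>v (A *\<^sub>v x)) $ i = of_real (ev i) * (W *\<^sub>v x) $ i"
      and Wn: "\<And>x. x \<in> carrier_vec n \<Longrightarrow> (vnorm (W *\<^sub>v x))\<^sup>2 = (\<Sum>i<n. (sqrt (cmod (l i)))\<^sup>2 * sq_coord (mat_adjoint ?U) x i)"
      and form: "\<And>x. x \<in> carrier_vec n \<Longrightarrow> (H *\<^sub>v x) \<bullet>c x = of_real (\<Sum>i<n. ev i * sq_coord W x i)"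
      by (rule preconditioned_hermitian_eigenvalues[where p = "\<lambda>i. cmod (l i)", OF F _ H Hh, folded D_def, folded A_def])
         (erule lpos, (rule that; assumption))
    \<comment> \<open>The singular value count is applied to \<open>W\<close> in the Fourier basis,
      with weights \<open>sqrt (cmod (l i))\<close>; comparing these with \<open>sqrt \<tau>\<close>
      amounts to comparing \<open>cmod (l i)\<close> with \<open>\<tau>\<close>.\<close>
    have W_lower: "codim_le n (2 * \<epsilon> * n) (norm_ge W (sqrt \<tau>))"
      by (rule codim_le_mono[OF codim_le_singular_values_lower[OF F(1,3) Wn, of "sqrt \<tau>"]]) (use cards \<tau> in auto)
    have W_upper: "codim_le n (2 * \<epsilon> * n) (norm_le W (sqrt \<tau>'))"
      by (rule codim_le_mono[OF codim_le_singular_values_upper[OF F(1,3) _ Wn, of "sqrt \<tau>'"]]) (use cards \<tau> in auto)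
    have kn: "real k * (\<epsilon> / (k + 1) * n) \<le> \<epsilon> * n"
    proof -
      have "real k / (k + 1) \<le> 1" by simp
      then show ?thesis using mult_right_mono[of "real k / (k + 1)" 1 "\<epsilon> * n"] \<epsilon> by (simp add: mult_ac)
    qed
    have small: "real (card {i. i < n \<and> \<bar>ev i\<bar> \<le> 1 - \<eta>}) \<le> 5 * \<epsilon> * n"
      using card_small_eigenvalues[OF A W WA A_lower[OF N2(1)[OF n(4)]] W_lower W_upper, of "1 - \<eta>" k] \<eta> \<tau> k kn by auto
    have large: "real (card {i. i < n \<and> 1 + \<eta> \<le> \<bar>ev i\<bar>}) \<le> 5 * \<epsilon> * n"
      using card_large_eigenvalues[OF A W WA A_upper[OF N2(2)[OF n(4)]] W_lower W_upper, of "1 + \<eta>" k] \<eta> \<tau> k kn by auto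
    have "real (card {i. i < n \<and> (\<bar>ev i\<bar> \<le> 1 - \<eta> \<or> 1 + \<eta> \<le> \<bar>ev i\<bar>)}) \<le>
        real (card {i. i < n \<and> \<bar>ev i\<bar> \<le> 1 - \<eta>} + card {i. i < n \<and> 1 + \<eta> \<le> \<bar>ev i\<bar>})"
    proof -
      have eq: "{i. i < n \<and> (\<bar>ev i\<bar> \<le> 1 - \<eta> \<or> 1 + \<eta> \<le> \<bar>ev i\<bar>)} =
          {i. i < n \<and> \<bar>ev i\<bar> \<le> 1 - \<eta>} \<union> {i. i < n \<and> 1 + \<eta> \<le> \<bar>ev i\<bar>}" by auto
      show ?thesis unfolding eq of_nat_le_iff by (rule card_Un_le)
    qed
    then have bad: "real (card {i. i < n \<and> (\<bar>ev i\<bar> \<le> 1 - \<eta> \<or> 1 + \<eta> \<le> \<bar>ev i\<bar>)}) \<le> \<rho> * n"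
      using small large by (simp add: \<epsilon>_def)
    have J: "mat_adjoint (sign_mat n) = sign_mat n"
      unfolding sign_mat_def adjoint_diag_of by (rule arg_cong[where f = "diag_of n"]) auto
    have cH: "codim_le n (\<epsilon> * n) (norm_ge H (2 * (\<delta>0 / 2)))" using H_lower by simp
    have cG: "codim_le n (\<epsilon> * n) {x. vnorm (H *\<^sub>v x + sign_mat n *\<^sub>v (H *\<^sub>v (sign_mat n *\<^sub>v x))) \<le> \<delta>0 / 2 * vnorm x}"
      by (rule codim_le_mono[OF N3[OF n(5)] order_refl]) (simp add: Hx flip_defect_def)
    note signs = card_sign_eigenvalues[OF H Hh W form cH \<delta>2 sign_carrier J vnorm_sign cG]
    have "real (card {i. i < n \<and> ev i \<le> 0}) \<le> (1 / 2 + \<rho>) * n" "real (card {i. i < n \<and> 0 \<le> ev i}) \<le> (1 / 2 + \<rho>) * n"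
    proof -
      have "\<epsilon> * n + (n + \<epsilon> * n) / 2 \<le> (1 / 2 + \<rho>) * n"
        using mult_nonneg_nonneg[of \<rho> "real n"] \<rho> by (simp add: \<epsilon>_def field_simps)
      then show "real (card {i. i < n \<and> ev i \<le> 0}) \<le> (1 / 2 + \<rho>) * n" "real (card {i. i < n \<and> 0 \<le> ev i}) \<le> (1 / 2 + \<rho>) * n"
        using signs by linarith+
    qed
    then show "?Q n"
      using evs bad unfolding X_eq balanced_clusters_def by blast
  qed
qed

section \<open>From balanced clusters to the limit of averages\<close>

lemma bounded_of_bounded_support:
  fixes F :: "complex \<Rightarrow> complex"
  assumes "continuous_on UNIV F" "bounded {z. F z \<noteq> 0}"
  obtains b where "b > 0" "\<And>z. cmod (F z) \<le> b"
proof -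
  have "compact (closure {z. F z \<noteq> 0})" using assms(2) by (simp add: compact_closure)
  then have "bounded (F ` closure {z. F z \<noteq> 0})"
    using assms(1) by (intro compact_imp_bounded compact_continuous_image) (auto intro: continuous_on_subset)
  then obtain b where b: "b > 0" "\<And>z. z \<in> closure {z. F z \<noteq> 0} \<Longrightarrow> cmod (F z) \<le> b"
    unfolding bounded_pos by auto
  have "cmod (F z) \<le> b" for z
    using b closure_subset[of "{z. F z \<noteq> 0}"] by (cases "F z = 0") auto
  then show thesis using that b(1) by blast
qed

text \<open>Moving each eigenvalue to the point 1 or -1 of its sign costs \<open>e\<close> at good
  indices and \<open>2 * b\<close> at the at most \<open>\<rho> * n\<close> bad ones. The resulting
  sum depends only on the number of nonpositive eigenvalues, which differs from \<open>n / 2\<close>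
  by at most \<open>\<rho> * n\<close>; this costs another \<open>2 * b * \<rho>\<close> on
  average.\<close>

lemma average_near_two_clusters:
  fixes F :: "complex \<Rightarrow> complex" and ev :: "nat \<Rightarrow> real"
  assumes n: "n \<ge> 1" and \<eta>: "\<eta> < 1" and e: "0 \<le> e" and b: "\<And>z. cmod (F z) \<le> b"
    and near: "\<And>z. cmod (z - 1) < \<eta> \<Longrightarrow> cmod (F z - F 1) \<le> e" "\<And>z. cmod (z + 1) < \<eta> \<Longrightarrow> cmod (F z - F (- 1)) \<le> e"
    and bal: "balanced_clusters n ev \<eta> \<rho>"
  shows "cmod (1 / of_nat n * (\<Sum>i<n. F (of_real (ev i))) - (F 1 + F (- 1)) / 2) \<le> e + 4 * b * \<rho>"
proof -
  define G where "G i = (if ev i \<le> 0 then F (- 1) else F 1)" for i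
  define Z where "Z = {i. i < n \<and> (\<bar>ev i\<bar> \<le> 1 - \<eta> \<or> 1 + \<eta> \<le> \<bar>ev i\<bar>)}"
  define m where "m = real (card {i. i < n \<and> ev i \<le> 0})"
  have b0: "b \<ge> 0" using b[of 0] norm_ge_zero order_trans by blast
  have G_le: "cmod (G i) \<le> b" for i using b by (simp add: G_def)
  have ptw: "cmod (F (of_real (ev i)) - G i) \<le> e + (if i \<in> Z then 2 * b else 0)" if i: "i < n" for i
  proof (cases "i \<in> Z")
    case True
    have "cmod (F (of_real (ev i)) - G i) \<le> b + b"
      by (rule order_trans[OF norm_triangle_ineq4 add_mono[OF b G_le]])
    then show ?thesis using True e by simp
  next
    case False
    then have good: "1 - \<eta> < \<bar>ev i\<bar>" "\<bar>ev i\<bar> < 1 + \<eta>" using i by (auto simp: Z_def)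
    show ?thesis
    proof (cases "ev i \<le> 0")
      case True
      have "cmod (of_real (ev i) + 1) = \<bar>ev i + 1\<bar>" by (metis norm_of_real of_real_1 of_real_add)
      also have "\<dots> < \<eta>" using good True by linarith
      finally show ?thesis using near(2) True False by (simp add: G_def)
    next
      case pos: False
      have "cmod (of_real (ev i) - 1) = \<bar>ev i - 1\<bar>" by (metis norm_of_real of_real_1 of_real_diff)
      also have "\<dots> < \<eta>" using good pos by linarith
      finally show ?thesis using near(1) pos False by (simp add: G_def)
    qed
  qed
  have "cmod ((\<Sum>i<n. F (of_real (ev i))) - (\<Sum>i<n. G i)) \<le> (\<Sum>i<n. e + (if i \<in> Z then 2 * b else 0))"
    unfolding sum_subtractf[symmetric] using ptw by (intro order_trans[OF norm_sum] sum_mono) auto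
  also have "\<dots> = n * e + card Z * (2 * b)"
  proof -
    have "{..<n} \<inter> Z = Z" by (auto simp: Z_def)
    then show ?thesis by (simp add: sum.distrib sum.If_cases)
  qed
  also have "\<dots> \<le> n * e + \<rho> * n * (2 * b)"
    using bal b0 by (intro add_left_mono mult_right_mono) (auto simp: Z_def balanced_clusters_def)
  finally have d1: "cmod ((\<Sum>i<n. F (of_real (ev i))) - (\<Sum>i<n. G i)) \<le> n * e + \<rho> * n * (2 * b)" .
  have m_eq: "real (card ({..<n} \<inter> - {i. ev i \<le> 0})) = n - m" "real (card ({..<n} \<inter> {i. ev i \<le> 0})) = m"
  proof -
    have "{..<n} \<inter> {i. ev i \<le> 0} = {i. i < n \<and> ev i \<le> 0}" by auto
    then show 1: "real (card ({..<n} \<inter> {i. ev i \<le> 0})) = m" by (simp add: m_def)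
    have "{..<n} = {..<n} \<inter> {i. ev i \<le> 0} \<union> {..<n} \<inter> - {i. ev i \<le> 0}" by auto
    moreover have "card ({..<n} \<inter> {i. ev i \<le> 0} \<union> {..<n} \<inter> - {i. ev i \<le> 0}) =
        card ({..<n} \<inter> {i. ev i \<le> 0}) + card ({..<n} \<inter> - {i. ev i \<le> 0})"
      by (rule card_Un_disjoint) auto
    ultimately have "n = card ({..<n} \<inter> {i. ev i \<le> 0}) + card ({..<n} \<inter> - {i. ev i \<le> 0})"
      by (metis card_lessThan)
    then show "real (card ({..<n} \<inter> - {i. ev i \<le> 0})) = n - m" using 1 by simp
  qed
  have G_sum: "(\<Sum>i<n. G i) = of_real m * F (- 1) + of_real (n - m) * F 1"
  proof -
    have "of_nat (card ({..<n} \<inter> - {i. ev i \<le> 0})) = complex_of_real (n - m)"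
      "of_nat (card ({..<n} \<inter> {i. ev i \<le> 0})) = complex_of_real m"
      by (simp only: m_eq(1)[symmetric] of_real_of_nat_eq, simp only: m_eq(2)[symmetric] of_real_of_nat_eq)
    then show ?thesis by (simp add: G_def sum.If_cases)
  qed
  have "(\<Sum>i<n. G i) - of_nat n * ((F 1 + F (- 1)) / 2) = of_real (m - n / 2) * (F (- 1) - F 1)"
    unfolding G_sum by (simp add: field_simps)
  then have "cmod ((\<Sum>i<n. G i) - of_nat n * ((F 1 + F (- 1)) / 2)) = \<bar>m - n / 2\<bar> * cmod (F (- 1) - F 1)"
    by (simp only: norm_mult norm_of_real)
  also have "\<dots> \<le> (\<rho> * n) * (b + b)"
  proof (rule mult_mono)
    have "card ({..<n} \<inter> - {i. ev i \<le> 0}) \<le> card {i. i < n \<and> 0 \<le> ev i}" by (intro card_mono) auto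
    then have "n - m \<le> (1 / 2 + \<rho>) * n" using bal m_eq(1) unfolding balanced_clusters_def by linarith
    moreover have "m \<le> (1 / 2 + \<rho>) * n" using bal by (simp add: m_def balanced_clusters_def)
    ultimately show "\<bar>m - n / 2\<bar> \<le> \<rho> * n" by (simp add: abs_le_iff algebra_simps)
    then show "0 \<le> \<rho> * n" by linarith
    show "cmod (F (- 1) - F 1) \<le> b + b" by (rule order_trans[OF norm_triangle_ineq4 add_mono[OF b b]])
  qed simp
  finally have d2: "cmod ((\<Sum>i<n. G i) - of_nat n * ((F 1 + F (- 1)) / 2)) \<le> (\<rho> * n) * (b + b)" .
  let ?S = "\<Sum>i<n. F (of_real (ev i))"
  have "cmod (?S - of_nat n * ((F 1 + F (- 1)) / 2)) \<le> n * (e + 4 * b * \<rho>)"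
    using norm_triangle_le[OF add_mono[OF d1 d2]] by (simp add: algebra_simps)
  moreover have "1 / of_nat n * ?S - (F 1 + F (- 1)) / 2 = (?S - of_nat n * ((F 1 + F (- 1)) / 2)) / of_nat n"
    using n by (simp add: field_simps)
  ultimately show ?thesis using n by (simp add: norm_divide divide_le_eq mult.commute)
qed

lemma phi1_integral:
  fixes F :: "complex \<Rightarrow> complex"
  shows "1 / of_real (measure lebesgue {-2 * pi..2 * pi}) * (LINT \<theta>:{-2 * pi..2 * pi}|lebesgue. F (phi1 \<theta>)) =
    (F 1 + F (- 1)) / 2"
proof -
  have const: "(LINT \<theta>:{a..b}|lebesgue. c) = of_real (b - a) * c" if "a \<le> b" for a b and c :: complex
    using that by (subst set_integral_const) (auto simp: scaleR_conv_of_real)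
  have const': "(LINT \<theta>:{a..<b}|lebesgue. c) = of_real (b - a) * c" if "a \<le> b" for a b and c :: complex
    using that by (subst set_integral_const) (auto simp: scaleR_conv_of_real)
  have int: "set_integrable lebesgue {-2 * pi..<0} (\<lambda>_. F (- 1))" "set_integrable lebesgue {0..2 * pi} (\<lambda>_. F 1)"
    unfolding set_integrable_def by (auto intro!: integrable_scaleR_left integrable_real_indicator)
  have "(LINT \<theta>:{-2 * pi..2 * pi}|lebesgue. F (phi1 \<theta>)) =
      (LINT \<theta>|lebesgue. indicator {-2 * pi..<0} \<theta> *\<^sub>R F (- 1) + indicator {0..2 * pi} \<theta> *\<^sub>R F 1)"
    unfolding set_lebesgue_integral_def
    by (intro Bochner_Integration.integral_cong refl) (auto simp: phi1_def indicator_def)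
  also have "\<dots> = (LINT \<theta>:{-2 * pi..<0}|lebesgue. F (- 1)) + (LINT \<theta>:{0..2 * pi}|lebesgue. F 1)"
    unfolding set_lebesgue_integral_def using int unfolding set_integrable_def
    by (rule Bochner_Integration.integral_add)
  also have "\<dots> = of_real (2 * pi) * (F 1 + F (- 1))"
    by (subst const const'; simp add: algebra_simps)+
  finally show ?thesis by (simp add: field_simps)
qed

lemma phi1_measurable: "phi1 \<in> borel_measurable (lebesgue_on \<Omega>)"
proof -
  have "phi1 \<in> borel_measurable lborel" unfolding phi1_def[abs_def] by measurable
  then have "phi1 \<in> borel_measurable lebesgue" by (rule measurable_completion)
  then show ?thesis by (rule measurable_restrict_space1)
qed

theorem theorem3p5:
  fixes f :: "real \<Rightarrow> complex" and C :: "nat \<Rightarrow> complex mat"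
  assumes f_integrable: "set_integrable lebesgue {-pi..pi} f"
    and f_real_coeffs: "\<And>k. fourier_coeff f k \<in> \<real>"
    and f_periodic: "\<And>\<theta>. f (\<theta> + 2 * pi) = f \<theta>"
    and f_sparsely_vanishing: "sparsely_vanishing_on {-pi..pi} f"
    and C_circulant: "\<And>n. n \<ge> 1 \<Longrightarrow> circulant_mat n (C n)"
    and C_nonsingular: "\<And>n. n \<ge> 1 \<Longrightarrow> invertible_mat (C n)"
    and C_approx: "singular_value_distribution
        (\<lambda>n. inv_mat (C n) * toeplitz_mat f n) (\<lambda>_. 1) {-pi..pi}"
  shows "eigenvalue_distribution
    (\<lambda>n. inv_mat (circulant_abs n (C n)) * flip_mat n * toeplitz_mat f n) phi1 {-2 * pi..2 * pi}"
  unfolding eigenvalue_distribution_def phi1_integral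
proof (intro conjI allI impI phi1_measurable)
  let ?X = "\<lambda>n. inv_mat (circulant_abs n (C n)) * flip_mat n * toeplitz_mat f n"
  show "{-2 * pi..2 * pi} \<in> lmeasurable" by simp
  show "0 < measure lebesgue {-2 * pi..2 * pi}" by simp
  fix F :: "complex \<Rightarrow> complex"
  assume cont: "continuous_on UNIV F" and supp: "bounded {z. F z \<noteq> 0}"
  obtain b where b: "b > 0" "\<And>z. cmod (F z) \<le> b" using bounded_of_bounded_support[OF cont supp] by blast
  show "(\<lambda>n. 1 / of_nat n * (\<Sum>z \<in># eigenvalue_mset (?X n). F z)) \<longlonglongrightarrow> (F 1 + F (- 1)) / 2"
  proof (rule LIMSEQ_I)
    fix r :: real assume r: "r > 0"
    obtain \<eta>1 where \<eta>1: "\<eta>1 > 0" "\<And>z. cmod (z - 1) < \<eta>1 \<Longrightarrow> cmod (F z - F 1) < r / 4"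
      using cont r unfolding continuous_on_iff dist_norm by (metis UNIV_I zero_less_divide_iff zero_less_numeral)
    obtain \<eta>2 where \<eta>2: "\<eta>2 > 0" "\<And>z. cmod (z - (- 1)) < \<eta>2 \<Longrightarrow> cmod (F z - F (- 1)) < r / 4"
      using cont r unfolding continuous_on_iff dist_norm by (metis UNIV_I zero_less_divide_iff zero_less_numeral)
    \<comment> \<open>The cap 1/2 secures \<open>\<eta> < 1\<close>, so that the windows around the
      two limit points lie on opposite sides of 0.\<close>
    define \<eta> where "\<eta> = min (1 / 2) (min \<eta>1 \<eta>2)"
    have \<eta>: "0 < \<eta>" "\<eta> < 1" using \<eta>1(1) \<eta>2(1) by (auto simp: \<eta>_def)
    have near: "cmod (F z - F 1) \<le> r / 4" if "cmod (z - 1) < \<eta>" for z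
      using \<eta>1(2)[of z] that by (simp add: \<eta>_def)
    have near': "cmod (F z - F (- 1)) \<le> r / 4" if "cmod (z + 1) < \<eta>" for z
      using \<eta>2(2)[of z] that by (simp add: \<eta>_def)
    \<comment> \<open>With this choice \<open>4 * b * \<rho>\<close> is \<open>r / 2\<close>, and
      the total error is at most \<open>3 * r / 4\<close>.\<close>
    define \<rho> where "\<rho> = r / (8 * b)"
    have \<rho>: "\<rho> > 0" using r b by (simp add: \<rho>_def)
    have f_int: "integrable circ f" using f_integrable integrable_circ_iff by blast
    obtain N where N: "\<And>n. n \<ge> N \<Longrightarrow> \<exists>ev. eigenvalue_mset (?X n) =
        image_mset (\<lambda>i. complex_of_real (ev i)) (mset_set {..<n}) \<and> balanced_clusters n ev \<eta> \<rho>"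
      using preconditioned_flip_eigenvalue_clusters[OF f_int f_real_coeffs f_sparsely_vanishing C_circulant C_nonsingular C_approx \<eta> \<rho>]
      by blast
    show "\<exists>no. \<forall>n\<ge>no. cmod (1 / of_nat n * (\<Sum>z \<in># eigenvalue_mset (?X n). F z) - (F 1 + F (- 1)) / 2) < r"
    proof (intro exI[of _ "max 1 N"] allI impI)
      fix n assume "n \<ge> max 1 N"
      then have n: "n \<ge> 1" "n \<ge> N" by auto
      obtain ev where ev: "eigenvalue_mset (?X n) = image_mset (\<lambda>i. complex_of_real (ev i)) (mset_set {..<n})"
        "balanced_clusters n ev \<eta> \<rho>"
        using N[OF n(2)] by blast
      have "(\<Sum>z \<in># eigenvalue_mset (?X n). F z) = (\<Sum>i<n. F (of_real (ev i)))"
        unfolding ev(1) by (simp add: multiset.map_comp comp_def sum_unfold_sum_mset)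
      moreover have "cmod (1 / of_nat n * (\<Sum>i<n. F (of_real (ev i))) - (F 1 + F (- 1)) / 2) \<le> r / 4 + 4 * b * \<rho>"
        using r by (intro average_near_two_clusters[OF n(1) \<eta>(2) _ b(2) near near' ev(2)]) auto
      moreover have "r / 4 + 4 * b * \<rho> < r" using b r by (simp add: \<rho>_def)
      ultimately show "cmod (1 / of_nat n * (\<Sum>z \<in># eigenvalue_mset (?X n). F z) - (F 1 + F (- 1)) / 2) < r"
        by simp
    qed
  qed
qed

end
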